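(* Consider $N$ agents $\dot x_i = A x_i + B u_i$, $i=1,\ldots,N$, with $x_i\in\mathbb{R}^n$, $u_i\in\mathbb{R}^m$, and a leader $\dot x_0 = A x_0$, $x_0\in\mathbb{R}^n$, where the pair $(A,B)$ is controllable. Assume that the communication graph $\mathcal{G}$ has a spanning tree and that the leader is connected to a root node. Apply a PCPE input of order $n+1$ to any one of the agents and collect the input-state data $(u,x)$ on $[0,MT)$. Consider the problem of determining matrices $\Lambda\in\mathbb{R}^{M(N+1)\times nN}$, $P_i\in\mathbb{R}^{n\times n}$ and $F_i\in\mathbb{R}^{m\times n}$, $i=1,\ldots,N$, such that $$(\mathcal{L}_g\otimes \mathcal{H}_T(x(0)))\Lambda = \operatorname{blkdiag}_i\{P_i\},$$ $$(\mathcal{L}_g\otimes \mathcal{H}_T(\dot x(0)))\Lambda + \Lambda^\top(\mathcal{L}_g\otimes \mathcal{H}_T(\dot x(0)))^\top \prec 0,$$ $$[\mathcal{H}_T(u)\quad 0_{m\times MN}]\,\Lambda = 0,$$ $$P_i\succ 0,\quad i=1,\ldots,N,$$ $$(\mathcal{I}_g\otimes \mathcal{H}_T(u))\Lambda = \operatorname{blkdiag}_i\{F_i\}.$$ This problem is feasible. Moreover, for any solution, the distributed inputs $u_i=-K_i\delta_i$ with $K_i=-F_iP_i^{-1}$, $i=1,\ldots,N$, achieve state synchronization with the leader, that is, $x_i(t)-x_0(t)\to 0$ as $t\to\infty$ for $i=1,\ldots,N$ (for all initial conditions).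
   Context: Notation: $P\succ 0$ means that $P$ is symmetric positive definite ($\prec 0$: symmetric negative definite); $\otimes$ is the Kronecker product; $\operatorname{blkdiag}_i\{D_i\}$ is the block diagonal matrix with diagonal blocks $D_1,\ldots,D_N$. Graph: $\mathcal{G}=(\mathcal{V},\mathcal{E})$ is a directed graph on nodes $v_1,\ldots,v_N$ with weights $a_{ij}>0$ if $(v_j,v_i)\in\mathcal{E}$ and $a_{ij}=0$ otherwise, $a_{ii}=0$. Adjacency matrix $\mathcal{A}=[a_{ij}]$, in-degrees $d_i=\sum_j a_{ij}$, $D=\operatorname{diag}_i\{d_i\}$, Laplacian $\mathcal{L}=D-\mathcal{A}$. The pinning gain satisfies $g_i>0$ if agent $i$ can access the leader information and $g_i=0$ otherwise; $g=[g_1\cdots g_N]^\top$, $G=\operatorname{diag}_i\{g_i\}$. $\mathcal{G}$ has a spanning tree if there is a node (a root) from which there is a directed path to every other node; the leader is connected to a root node if $g_i>0$ for some root $v_i$. Define $\mathcal{L}_g=[-g\quad \mathcal{L}+G]\in\mathbb{R}^{N\times(N+1)}$ and $\mathcal{I}_g=[0_{N\times 1}\quad I_N]\in\mathbb{R}^{N\times(N+1)}$. Local synchronization error: $\delta_i=\sum_{j=1}^N a_{ij}(x_i-x_j)+g_i(x_i-x_0)$. Data matrices: for a signal $\xi:[0,MT)\to\mathbb{R}^\sigma$, with $M\in\mathbb{N}$ and $T>0$, $\mathcal{H}_T(\xi(t))=[\xi(t)\ \ \xi(t+T)\ \cdots\ \xi(t+(M-1)T)]$ for $0\le t<T$. The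 data $(u,x)$ satisfy $\dot x=Ax+Bu$ on $[0,MT)$, where at the switching instants $jT$ the derivative is the right derivative, so $\mathcal{H}_T(\dot x(0))=A\mathcal{H}_T(x(0))+B\mathcal{H}_T(u)$. PCPE (piecewise constant persistently exciting) input of order $L$: $T>0$ satisfies $T\ne 2\pi\kappa/|\operatorname{Im}(\lambda_j-\lambda_k)|$ for all $\kappa\in\mathbb{Z}$ and any two eigenvalues $\lambda_j,\lambda_k$ of $A$ (no condition when $\operatorname{Im}(\lambda_j-\lambda_k)=0$), and $u(t+jT)=\mu_j$ for $0\le t<T$, $j=0,\ldots,M-1$, where $\mu_j\in\mathbb{R}^m$ are such that the block Hankel matrix with $L$ block rows and $M-L+1$ columns, whose $(r,s)$ block is $\mu_{r+s}$ ($0\le r\le L-1$, $0\le s\le M-L$), has rank $mL$. For such an input, $\mathcal{H}_T(u(t))$ is constant in $t$ and is written $\mathcal{H}_T(u)$. *)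

theory Defs
  imports
    "HOL-Analysis.Derivative"
    "Jordan_Normal_Form.DL_Rank"
    "Jordan_Normal_Form.Char_Poly"
    "Jordan_Normal_Form.Gauss_Jordan_Elimination"
begin

text \<open>
  Vectors and matrices are those of \<open>Jordan_Normal_Form\<close>, with explicit dimensions; all indices
  (agents, data samples, coordinates) start at 0.  The type of these vectors carries no topology,
  so limits, continuity and derivatives of signals are taken coordinatewise.
\<close>

section \<open>Matrices\<close>

definition kronecker :: "real mat \<Rightarrow> real mat \<Rightarrow> real mat" where
  "kronecker A B = mat (dim_row A * dim_row B) (dim_col A * dim_col B)
     (\<lambda>(i, j). A $$ (i div dim_row B, j div dim_col B) * B $$ (i mod dim_row B, j mod dim_col B))"

definition append_cols :: "real mat \<Rightarrow> real mat \<Rightarrow> real mat" where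
  "append_cols A B = four_block_mat A B (0\<^sub>m 0 (dim_col A)) (0\<^sub>m 0 (dim_col B))"

definition pos_def :: "nat \<Rightarrow> real mat \<Rightarrow> bool" where
  "pos_def n P \<longleftrightarrow> P \<in> carrier_mat n n \<and> transpose_mat P = P \<and>
     (\<forall>v \<in> carrier_vec n. v \<noteq> 0\<^sub>v n \<longrightarrow> v \<bullet> (P *\<^sub>v v) > 0)"

definition neg_def :: "nat \<Rightarrow> real mat \<Rightarrow> bool" where
  "neg_def n P \<longleftrightarrow> P \<in> carrier_mat n n \<and> transpose_mat P = P \<and>
     (\<forall>v \<in> carrier_vec n. v \<noteq> 0\<^sub>v n \<longrightarrow> v \<bullet> (P *\<^sub>v v) < 0)"

section \<open>Signals and linear systems\<close>

definition has_vec_deriv :: "nat \<Rightarrow> (real \<Rightarrow> real vec) \<Rightarrow> real vec \<Rightarrow> real filter \<Rightarrow> bool" where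
  "has_vec_deriv n x v F \<longleftrightarrow> (\<forall>k<n. ((\<lambda>t. x t $ k) has_vector_derivative v $ k) F)"

definition vec_continuous_on :: "nat \<Rightarrow> real set \<Rightarrow> (real \<Rightarrow> real vec) \<Rightarrow> bool" where
  "vec_continuous_on n S x \<longleftrightarrow> (\<forall>k<n. continuous_on S (\<lambda>t. x t $ k))"

definition right_deriv :: "nat \<Rightarrow> (real \<Rightarrow> real vec) \<Rightarrow> real \<Rightarrow> real vec" where
  "right_deriv n x t = vec n (\<lambda>k. vector_derivative (\<lambda>s. x s $ k) (at t within {t..}))"

text \<open>Controllability of the pair \<open>(A, B)\<close>: every state can be steered to every other state in
  finite time.  For linear time-invariant systems, restricting to continuous inputs gives the same
  notion as piecewise continuous or locally integrable ones.\<close>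

definition controllable :: "nat \<Rightarrow> nat \<Rightarrow> real mat \<Rightarrow> real mat \<Rightarrow> bool" where
  "controllable n m A B \<longleftrightarrow>
     (\<forall>a \<in> carrier_vec n. \<forall>b \<in> carrier_vec n. \<exists>\<tau>>0. \<exists>u x.
        (\<forall>t \<in> {0..\<tau>}. u t \<in> carrier_vec m \<and> x t \<in> carrier_vec n) \<and>
        vec_continuous_on m {0..\<tau>} u \<and>
        (\<forall>t \<in> {0..\<tau>}. has_vec_deriv n x (A *\<^sub>v x t + B *\<^sub>v u t) (at t within {0..\<tau>})) \<and>
        x 0 = a \<and> x \<tau> = b)"

section \<open>Data\<close>

definition data_mat :: "nat \<Rightarrow> nat \<Rightarrow> real \<Rightarrow> (real \<Rightarrow> real vec) \<Rightarrow> real \<Rightarrow> real mat" where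
  "data_mat \<sigma> M T \<xi> t = mat \<sigma> M (\<lambda>(i, j). \<xi> (t + real j * T) $ i)"

text \<open>Input-state data on \<open>[0, MT)\<close>.  The derivative relative to \<open>[jT, (j+1)T)\<close> is the right
  derivative at the switching instant \<open>jT\<close> and the ordinary derivative at the other points.
  Continuity of the state across the switching instants does not follow from this, so it is
  required separately.\<close>

definition input_state_data :: "nat \<Rightarrow> nat \<Rightarrow> real mat \<Rightarrow> real mat \<Rightarrow> nat \<Rightarrow> real \<Rightarrow>
    (real \<Rightarrow> real vec) \<Rightarrow> (real \<Rightarrow> real vec) \<Rightarrow> bool" where
  "input_state_data n m A B M T u x \<longleftrightarrow>
     (\<forall>t \<in> {0..<real M * T}. u t \<in> carrier_vec m \<and> x t \<in> carrier_vec n) \<and>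
     vec_continuous_on n {0..<real M * T} x \<and>
     (\<forall>j<M. \<forall>t \<in> {real j * T..<real (Suc j) * T}.
        has_vec_deriv n x (A *\<^sub>v x t + B *\<^sub>v u t) (at t within {real j * T..<real (Suc j) * T}))"

definition block_hankel :: "nat \<Rightarrow> nat \<Rightarrow> nat \<Rightarrow> (nat \<Rightarrow> real vec) \<Rightarrow> real mat" where
  "block_hankel m L c \<mu> = mat (m * L) c (\<lambda>(i, s). \<mu> (i div m + s) $ (i mod m))"

definition admissible_period :: "real mat \<Rightarrow> real \<Rightarrow> bool" where
  "admissible_period A T \<longleftrightarrow> T > 0 \<and>
     (\<forall>z w. eigenvalue (map_mat complex_of_real A) z \<and> eigenvalue (map_mat complex_of_real A) w \<and>
        Im (z - w) \<noteq> 0 \<longrightarrow> (\<forall>\<kappa>::int. T \<noteq> 2 * pi * of_int \<kappa> / \<bar>Im (z - w)\<bar>))"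

text \<open>The Hankel matrix has \<open>M - L + 1\<close> columns; it is written \<open>M + 1 - L\<close> because subtraction
  on natural numbers truncates.\<close>

definition pcpe :: "nat \<Rightarrow> real mat \<Rightarrow> nat \<Rightarrow> nat \<Rightarrow> real \<Rightarrow> (real \<Rightarrow> real vec) \<Rightarrow> bool" where
  "pcpe m A L M T u \<longleftrightarrow> admissible_period A T \<and>
     (\<exists>\<mu>. (\<forall>j<M. \<mu> j \<in> carrier_vec m) \<and>
          (\<forall>j<M. \<forall>t \<in> {0..<T}. u (t + real j * T) = \<mu> j) \<and>
          vec_space.rank (m * L) (block_hankel m L (M + 1 - L) \<mu>) = m * L)"

section \<open>Communication graph\<close>

text \<open>\<open>E\<close> is the edge set on the nodes \<open>{0..<N}\<close> and \<open>W\<close> the adjacency matrix: a pair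
  \<open>(j, i)\<close> in \<open>E\<close> is an edge from \<open>j\<close> to \<open>i\<close> and has weight \<open>W $$ (i, j)\<close>.\<close>

definition weighted_digraph :: "nat \<Rightarrow> (nat \<times> nat) set \<Rightarrow> real mat \<Rightarrow> bool" where
  "weighted_digraph N E W \<longleftrightarrow> E \<subseteq> {0..<N} \<times> {0..<N} \<and> W \<in> carrier_mat N N \<and>
     (\<forall>i<N. \<forall>j<N. if (j, i) \<in> E then W $$ (i, j) > 0 else W $$ (i, j) = 0) \<and>
     (\<forall>i<N. W $$ (i, i) = 0)"

definition is_root :: "nat \<Rightarrow> (nat \<times> nat) set \<Rightarrow> nat \<Rightarrow> bool" where
  "is_root N E r \<longleftrightarrow> r < N \<and> (\<forall>i<N. (r, i) \<in> E\<^sup>*)"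

definition has_spanning_tree :: "nat \<Rightarrow> (nat \<times> nat) set \<Rightarrow> bool" where
  "has_spanning_tree N E \<longleftrightarrow> (\<exists>r. is_root N E r)"

text \<open>\<open>Acc\<close> is the set of agents that can access the leader information.\<close>

definition pinning_gain :: "nat \<Rightarrow> nat set \<Rightarrow> real vec \<Rightarrow> bool" where
  "pinning_gain N Acc g \<longleftrightarrow> Acc \<subseteq> {0..<N} \<and> g \<in> carrier_vec N \<and>
     (\<forall>i<N. if i \<in> Acc then g $ i > 0 else g $ i = 0)"

definition leader_connected_to_root :: "nat \<Rightarrow> (nat \<times> nat) set \<Rightarrow> real vec \<Rightarrow> bool" where
  "leader_connected_to_root N E g \<longleftrightarrow> (\<exists>r. is_root N E r \<and> g $ r > 0)"

definition laplacian :: "nat \<Rightarrow> real mat \<Rightarrow> real mat" where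
  "laplacian N W = mat_diag N (\<lambda>i. \<Sum>j<N. W $$ (i, j)) - W"

definition pinned_laplacian :: "nat \<Rightarrow> real mat \<Rightarrow> real vec \<Rightarrow> real mat" where
  "pinned_laplacian N W g =
     append_cols (mat_of_cols N [- g]) (laplacian N W + mat_diag N (\<lambda>i. g $ i))"

definition pinned_identity :: "nat \<Rightarrow> real mat" where
  "pinned_identity N = append_cols (0\<^sub>m N 1) (1\<^sub>m N)"

section \<open>The design problem and synchronization\<close>

text \<open>\<open>X\<close>, \<open>Xd\<close> and \<open>U\<close> are the data matrices of the state, of its derivative and of the
  input.\<close>

definition design_solution :: "nat \<Rightarrow> nat \<Rightarrow> nat \<Rightarrow> nat \<Rightarrow> real mat \<Rightarrow> real vec \<Rightarrow>
    real mat \<Rightarrow> real mat \<Rightarrow> real mat \<Rightarrow> real mat \<Rightarrow> (nat \<Rightarrow> real mat) \<Rightarrow> (nat \<Rightarrow> real mat) \<Rightarrow> bool" where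
  "design_solution n m N M W g X Xd U \<Lambda> P F \<longleftrightarrow>
     \<Lambda> \<in> carrier_mat (M * (N + 1)) (n * N) \<and>
     (\<forall>i<N. P i \<in> carrier_mat n n) \<and>
     (\<forall>i<N. F i \<in> carrier_mat m n) \<and>
     kronecker (pinned_laplacian N W g) X * \<Lambda> = diag_block_mat (map P [0..<N]) \<and>
     neg_def (n * N) (kronecker (pinned_laplacian N W g) Xd * \<Lambda> +
       transpose_mat \<Lambda> * transpose_mat (kronecker (pinned_laplacian N W g) Xd)) \<and>
     append_cols U (0\<^sub>m m (M * N)) * \<Lambda> = 0\<^sub>m m (n * N) \<and>
     (\<forall>i<N. pos_def n (P i)) \<and>
     kronecker (pinned_identity N) U * \<Lambda> = diag_block_mat (map F [0..<N])"

text \<open>\<open>mat_inverse\<close> returns an option; positive definite matrices are invertible, so \<open>the\<close> is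
  only applied to an actual inverse.\<close>

definition feedback_gain :: "real mat \<Rightarrow> real mat \<Rightarrow> real mat" where
  "feedback_gain F P = - (F * the (mat_inverse P))"

definition sync_error :: "nat \<Rightarrow> nat \<Rightarrow> real mat \<Rightarrow> real vec \<Rightarrow> (real \<Rightarrow> real vec) \<Rightarrow>
    (nat \<Rightarrow> real \<Rightarrow> real vec) \<Rightarrow> nat \<Rightarrow> real \<Rightarrow> real vec" where
  "sync_error n N W g x0 xs i t = vec n (\<lambda>k.
     (\<Sum>j<N. W $$ (i, j) * (xs i t $ k - xs j t $ k)) + g $ i * (xs i t $ k - x0 t $ k))"

text \<open>Trajectories on \<open>[0, \<infinity>)\<close> of the leader \<open>x0\<close> and of the agents \<open>xs i\<close>
  under the distributed inputs with gains \<open>K i\<close>; the initial states are arbitrary.\<close>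

definition closed_loop :: "nat \<Rightarrow> real mat \<Rightarrow> real mat \<Rightarrow> nat \<Rightarrow> real mat \<Rightarrow> real vec \<Rightarrow>
    (nat \<Rightarrow> real mat) \<Rightarrow> (real \<Rightarrow> real vec) \<Rightarrow> (nat \<Rightarrow> real \<Rightarrow> real vec) \<Rightarrow> bool" where
  "closed_loop n A B N W g K x0 xs \<longleftrightarrow>
     (\<forall>t\<ge>0. x0 t \<in> carrier_vec n \<and> has_vec_deriv n x0 (A *\<^sub>v x0 t) (at t within {0..})) \<and>
     (\<forall>i<N. \<forall>t\<ge>0. xs i t \<in> carrier_vec n \<and>
        has_vec_deriv n (xs i) (A *\<^sub>v xs i t + B *\<^sub>v (- (K i *\<^sub>v sync_error n N W g x0 xs i t)))
          (at t within {0..}))"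

definition synchronizes :: "nat \<Rightarrow> nat \<Rightarrow> (real \<Rightarrow> real vec) \<Rightarrow> (nat \<Rightarrow> real \<Rightarrow> real vec) \<Rightarrow> bool" where
  "synchronizes n N x0 xs \<longleftrightarrow>
     (\<forall>i<N. \<forall>k<n. ((\<lambda>t. xs i t $ k - x0 t $ k) \<longlongrightarrow> 0) at_top)"

end

theory Submission
  imports Defs
    "HOL-Computational_Algebra.Fundamental_Theorem_Algebra"
    "HOL-Analysis.Complex_Transcendental"
    "HOL-Analysis.Henstock_Kurzweil_Integration"
begin

text \<open>
  With \<open>H = \<L> + G\<close>, every solution satisfies
  \<open>(\<L>\<^sub>g \<otimes> X') \<Lambda> = (I \<otimes> A) blkdiag P + (H \<otimes> B) blkdiag F\<close>, where \<open>X\<close> is the data matrix of the state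
  and \<open>X'\<close> that of its derivative.  So the matrix inequality says that
  \<open>\<Sum>i. \<delta>\<^sub>i \<bullet> P\<^sub>i\<^sup>-\<^sup>1 \<delta>\<^sub>i\<close> is a Lyapunov function for \<open>\<delta> = (H \<otimes> I) (x - 1 \<otimes> x\<^sub>0)\<close>, and \<open>H\<close> is invertible
  because the leader reaches every agent.

  For feasibility, \<open>H\<close> is a nonsingular M-matrix, so \<open>H diag q\<close> has a positive definite symmetric
  part for some \<open>q > 0\<close>, and \<open>P\<^sub>i = q\<^sub>i P\<close>, \<open>F\<^sub>i = - c q\<^sub>i B\<^sup>T\<close> works for a Gramian \<open>P\<close> and large
  \<open>c\<close>.  The matrix \<open>\<Lambda>\<close> is then obtained from a right inverse of the stacked data matrices
  \<open>X\<close>, \<open>U\<close>, which have full row rank: the sampling period preserves controllability, and for a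
  controllable discrete-time system persistency of excitation gives full rank (Willems' lemma).
\<close>

text \<open>Controllability is used only through left eigenvectors. If functionals vanish on the
  Krylov sequence of a nonzero vector, an annihilating polynomial of that vector produces an
  eigenvector on which they still vanish, and for \<open>A\<close> and \<open>B\<close> such a
  vector contradicts controllability. This one device serves both for the rank of the data and for
  the definiteness of the Gramian. The obstacle is sampling: an eigenvector of the exponential of
  \<open>T A\<^sup>T\<close> may mix eigenvectors of \<open>A\<^sup>T\<close> for different
  eigenvalues, and the period condition rules this out. Order \<open>n + 1\<close> fits because
  eliminating an \<open>n\<close>-dimensional state takes a polynomial of degree at most
  \<open>n\<close>, hence at most \<open>n + 1\<close> consecutive inputs. In the feasibility proof
  all agents share one \<open>P\<close> and one \<open>B\<^sup>T\<close> up to the weights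
  \<open>q\<close>, so the quadratic form splits into a graph part governed by
  \<open>H diag q\<close> and an agent part governed by \<open>A P\<close>. The strict inequality
  comes from \<open>A + 1\<close>: the Gramian satisfies
  \<open>A P + P A\<^sup>T + 2 P \<le> 2 \<kappa> B B\<^sup>T\<close>, and the gain \<open>c\<close>
  has to outweigh only the right-hand side.\<close>

unbundle no vec_syntax
unbundle no inner_syntax

section \<open>Real matrices and quadratic forms\<close>

lemma mat_mult_vec_index:
  assumes "A \<in> carrier_mat a b" "v \<in> carrier_vec b" "i < a"
  shows "(A *\<^sub>v v) $ i = (\<Sum>j<b. A $$ (i, j) * v $ j)"
  using assms by (auto simp: scalar_prod_def lessThan_atLeast0 intro!: sum.cong)

lemma mat_mult_index:
  assumes "A \<in> carrier_mat a b" "B \<in> carrier_mat b c" "i < a" "j < c"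
  shows "(A * B) $$ (i, j) = (\<Sum>k<b. A $$ (i, k) * B $$ (k, j))"
  using assms by (auto simp: scalar_prod_def lessThan_atLeast0 intro!: sum.cong)

lemma scalar_prod_sum:
  assumes "w \<in> carrier_vec n"
  shows "v \<bullet> w = (\<Sum>i<n. v $ i * w $ i)"
  using assms by (auto simp: scalar_prod_def lessThan_atLeast0 intro!: sum.cong)

lemma scalar_prod_self_ge_0: "(v :: real vec) \<bullet> v \<ge> 0"
  by (auto simp: scalar_prod_def intro!: sum_nonneg)

lemma scalar_prod_self_eq_0:
  assumes "(v :: real vec) \<in> carrier_vec n" "v \<bullet> v = 0"
  shows "v = 0\<^sub>v n"
proof -
  have "(\<Sum>i<n. v $ i * v $ i) = 0" using assms scalar_prod_sum[of v n v] by simp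
  then have "\<forall>i\<in>{..<n}. v $ i * v $ i = 0"
    by (subst (asm) sum_nonneg_eq_0_iff) auto
  then show ?thesis using assms by (intro eq_vecI) auto
qed

lemma scalar_prod_transpose:
  fixes A :: "'a :: comm_ring_1 mat"
  assumes "A \<in> carrier_mat a b" "v \<in> carrier_vec a" "w \<in> carrier_vec b"
  shows "(transpose_mat A *\<^sub>v v) \<bullet> w = v \<bullet> (A *\<^sub>v w)"
  by (rule transpose_vec_mult_scalar[OF assms(1,3,2)])

lemma inj_mat_inverse:
  fixes A :: "'a :: field mat"
  assumes A: "A \<in> carrier_mat n n"
    and inj: "\<And>v. v \<in> carrier_vec n \<Longrightarrow> A *\<^sub>v v = 0\<^sub>v n \<Longrightarrow> v = 0\<^sub>v n"
  obtains B where "B \<in> carrier_mat n n" "A * B = 1\<^sub>m n" "B * A = 1\<^sub>m n" "mat_inverse A = Some B"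
proof -
  have "det A \<noteq> 0" using det_0_iff_vec_prod_zero[OF A] inj by blast
  then have "A \<in> Units (ring_mat TYPE('a) n ())" by (rule det_non_zero_imp_unit[OF A])
  then obtain B where "mat_inverse A = Some B" using mat_inverse(1)[OF A, of "()"] by (cases "mat_inverse A") auto
  then show thesis using mat_inverse(2)[OF A] that by blast
qed

lemma transpose_inverse:
  fixes A :: "'a :: comm_ring_1 mat"
  assumes "A \<in> carrier_mat n n" "B \<in> carrier_mat n n" "A * B = 1\<^sub>m n"
  shows "transpose_mat B * transpose_mat A = 1\<^sub>m n"
  using transpose_mult[OF assms(1,2)] assms(3) by simp

lemma pos_def_inverse:
  assumes "pos_def n P"
  obtains R where "R \<in> carrier_mat n n" "P * R = 1\<^sub>m n" "R * P = 1\<^sub>m n" "mat_inverse P = Some R"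
proof (rule inj_mat_inverse[of P n])
  show P: "P \<in> carrier_mat n n" using assms by (simp add: pos_def_def)
  show "v = 0\<^sub>v n" if "v \<in> carrier_vec n" "P *\<^sub>v v = 0\<^sub>v n" for v
    using assms that by (force simp: pos_def_def)
qed (use that in blast)

lemma quadratic_form_bound:
  assumes C: "C \<in> carrier_mat n n"
  obtains c :: real where "c > 0" "\<And>v. v \<in> carrier_vec n \<Longrightarrow> v \<bullet> (C *\<^sub>v v) \<le> c * (v \<bullet> v)"
proof -
  \<comment> \<open>Every product \<open>\<bar>v $ i\<bar> * \<bar>v $ j\<bar>\<close> is at most
    \<open>v \<bullet> v\<close>, so the sum of the absolute entries suffices; the extra 1 keeps
    \<open>c\<close> positive when all entries vanish.\<close>
  define c where "c = 1 + (\<Sum>i<n. \<Sum>j<n. \<bar>C $$ (i, j)\<bar>)"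
  have "v \<bullet> (C *\<^sub>v v) \<le> c * (v \<bullet> v)" if v: "v \<in> carrier_vec n" for v
  proof -
    have le: "\<bar>v $ i\<bar> * \<bar>v $ j\<bar> \<le> v \<bullet> v" if "i < n" "j < n" for i j
    proof -
      have sq: "(v $ k)\<^sup>2 \<le> v \<bullet> v" if "k < n" for k
        using member_le_sum[of k "{..<n}" "\<lambda>i. v $ i * v $ i"] that scalar_prod_sum[OF v, of v]
        by (simp add: power2_eq_square)
      have "2 * (\<bar>v $ i\<bar> * \<bar>v $ j\<bar>) \<le> (v $ i)\<^sup>2 + (v $ j)\<^sup>2"
        using sum_squares_bound[of "\<bar>v $ i\<bar>" "\<bar>v $ j\<bar>"] by simp
      then show ?thesis using sq[OF that(1)] sq[OF that(2)] by simp
    qed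
    have "v \<bullet> (C *\<^sub>v v) = (\<Sum>i<n. \<Sum>j<n. C $$ (i, j) * (v $ i * v $ j))"
      using C v mat_mult_vec_index[OF C v]
      by (subst scalar_prod_sum[of _ n]) (simp_all add: sum_distrib_left mult.left_commute)
    also have "\<dots> \<le> (\<Sum>i<n. \<Sum>j<n. \<bar>C $$ (i, j)\<bar> * (v \<bullet> v))"
    proof (intro sum_mono)
      fix i j assume "i \<in> {..<n}" "j \<in> {..<n}"
      then have "\<bar>C $$ (i, j)\<bar> * (\<bar>v $ i\<bar> * \<bar>v $ j\<bar>) \<le> \<bar>C $$ (i, j)\<bar> * (v \<bullet> v)"
        by (intro mult_left_mono le) auto
      moreover have "C $$ (i, j) * (v $ i * v $ j) \<le> \<bar>C $$ (i, j)\<bar> * (\<bar>v $ i\<bar> * \<bar>v $ j\<bar>)"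
        unfolding abs_mult[symmetric] by (rule abs_ge_self)
      ultimately show "C $$ (i, j) * (v $ i * v $ j) \<le> \<bar>C $$ (i, j)\<bar> * (v \<bullet> v)"
        by (rule order_trans[rotated])
    qed
    also have "\<dots> = (c - 1) * (v \<bullet> v)" by (simp add: c_def sum_distrib_right)
    also have "\<dots> \<le> c * (v \<bullet> v)" using scalar_prod_self_ge_0[of v] by (simp add: algebra_simps)
    finally show ?thesis .
  qed
  moreover have "c > 0" unfolding c_def by (intro add_pos_nonneg sum_nonneg) auto
  ultimately show thesis using that by blast
qed

text \<open>With \<open>y = P\<^sup>-\<^sup>1 z\<close>, expanding \<open>0 \<le> (z - s y) \<bullet> P (z - s y)\<close> for a small \<open>s > 0\<close> bounds
  the form from below without a compactness argument.\<close>

lemma pos_def_lower_bound: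
  assumes "pos_def n P"
  obtains e where "e > 0" "\<And>v. v \<in> carrier_vec n \<Longrightarrow> e * (v \<bullet> v) \<le> v \<bullet> (P *\<^sub>v v)"
proof -
  have P: "P \<in> carrier_mat n n" and sym: "transpose_mat P = P"
    and pos: "\<And>v. v \<in> carrier_vec n \<Longrightarrow> v \<noteq> 0\<^sub>v n \<Longrightarrow> v \<bullet> (P *\<^sub>v v) > 0"
    using assms by (auto simp: pos_def_def)
  have nonneg: "v \<bullet> (P *\<^sub>v v) \<ge> 0" if "v \<in> carrier_vec n" for v
    using pos[OF that] that P by (cases "v = 0\<^sub>v n") auto
  obtain R where R: "R \<in> carrier_mat n n" and PR: "P * R = 1\<^sub>m n"
    using pos_def_inverse[OF assms] by metis
  obtain c where c: "c > 0" and bound: "\<And>v. v \<in> carrier_vec n \<Longrightarrow> v \<bullet> (R *\<^sub>v v) \<le> c * (v \<bullet> v)"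
    using quadratic_form_bound[OF R] by metis
  have "1 / c * (v \<bullet> v) \<le> v \<bullet> (P *\<^sub>v v)" if v: "v \<in> carrier_vec n" for v
  proof -
    define y where "y = R *\<^sub>v v"
    have y: "y \<in> carrier_vec n" using R v by (simp add: y_def)
    have Py: "P *\<^sub>v y = v"
      using PR v unfolding y_def by (subst assoc_mult_mat_vec[symmetric, OF P R v]) simp
    have yPv: "y \<bullet> (P *\<^sub>v v) = v \<bullet> v"
      using scalar_prod_transpose[OF P y v] sym Py by simp
    \<comment> \<open>The expansion yields the lower bound
      \<open>(2 s - c s^2) (v \<bullet> v)\<close>, and \<open>s = 1 / c\<close> maximises
      it.\<close>
    define s where "s = 1 / c"
    have Pd: "P *\<^sub>v (v - s \<cdot>\<^sub>v y) = P *\<^sub>v v - s \<cdot>\<^sub>v v"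
      using P v y Py by (simp add: mult_minus_distrib_mat_vec[OF P v] mult_mat_vec[OF P y])
    have Pv: "P *\<^sub>v v \<in> carrier_vec n" using P v by simp
    have "0 \<le> (v - s \<cdot>\<^sub>v y) \<bullet> (P *\<^sub>v v - s \<cdot>\<^sub>v v)"
      using nonneg[of "v - s \<cdot>\<^sub>v y"] v y Pd by simp
    also have "\<dots> = v \<bullet> (P *\<^sub>v v) - 2 * s * (v \<bullet> v) + s * s * (v \<bullet> y)"
      using v y Pv yPv
      by (simp add: minus_scalar_prod_distrib[of _ n] scalar_prod_minus_distrib[of _ n]
          comm_scalar_prod[of y n v] algebra_simps)
    finally have "2 * s * (v \<bullet> v) \<le> v \<bullet> (P *\<^sub>v v) + s * s * (v \<bullet> y)" by simp
    moreover have "s * s * (v \<bullet> y) \<le> s * s * (c * (v \<bullet> v))"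
      using bound[OF v] by (intro mult_left_mono) (auto simp: y_def)
    moreover have "s * s * (c * (v \<bullet> v)) = s * (v \<bullet> v)" using c by (simp add: s_def)
    ultimately show ?thesis by (simp add: s_def)
  qed
  then show thesis using that[of "1 / c"] c by simp
qed

text \<open>Since \<open>v \<bullet> R R\<^sup>T v\<close> is the squared norm of
  \<open>R\<^sup>T v\<close>, the square matrix \<open>R R\<^sup>T\<close> is injective. With
  \<open>B\<close> its inverse, \<open>R\<^sup>T B\<close> is the right inverse.\<close>

lemma right_inverse_of_trivial_left_kernel:
  fixes R :: "real mat"
  assumes R: "R \<in> carrier_mat r M"
    and ker: "\<And>v. v \<in> carrier_vec r \<Longrightarrow> transpose_mat R *\<^sub>v v = 0\<^sub>v M \<Longrightarrow> v = 0\<^sub>v r"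
  obtains S where "S \<in> carrier_mat M r" "R * S = 1\<^sub>m r"
proof -
  have Rt: "transpose_mat R \<in> carrier_mat M r" using R by simp
  obtain B where B: "B \<in> carrier_mat r r" "R * transpose_mat R * B = 1\<^sub>m r"
  proof (rule inj_mat_inverse[of "R * transpose_mat R" r])
    show "R * transpose_mat R \<in> carrier_mat r r" using R by simp
    show "v = 0\<^sub>v r" if v: "v \<in> carrier_vec r" and 0: "R * transpose_mat R *\<^sub>v v = 0\<^sub>v r" for v
    proof (rule ker[OF v])
      have w: "transpose_mat R *\<^sub>v v \<in> carrier_vec M" using Rt v by simp
      have "(transpose_mat R *\<^sub>v v) \<bullet> (transpose_mat R *\<^sub>v v) = v \<bullet> (R * transpose_mat R *\<^sub>v v)"
        using scalar_prod_transpose[OF R v w] assoc_mult_mat_vec[OF R Rt v] by simp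
      also have "\<dots> = 0" using v 0 by simp
      finally show "transpose_mat R *\<^sub>v v = 0\<^sub>v M" using scalar_prod_self_eq_0[OF w] by simp
    qed
  qed auto
  show thesis
    by (rule that[of "transpose_mat R * B"]) (use R Rt B assoc_mult_mat[OF R Rt B(1)] in auto)
qed

section \<open>Annihilating polynomials and eigenvectors\<close>

definition krylov :: "'a :: comm_ring_1 mat \<Rightarrow> 'a vec \<Rightarrow> nat \<Rightarrow> 'a vec" where
  "krylov M w k = ((\<lambda>v. M *\<^sub>v v) ^^ k) w"

lemma krylov_0 [simp]: "krylov M w 0 = w"
  and krylov_Suc: "krylov M w (Suc k) = M *\<^sub>v krylov M w k"
  by (simp_all add: krylov_def)

lemma krylov_carrier [simp]:
  "M \<in> carrier_mat n n \<Longrightarrow> w \<in> carrier_vec n \<Longrightarrow> krylov M w k \<in> carrier_vec n"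
  by (induction k) (auto simp: krylov_Suc)

lemma krylov_Suc': "krylov M w (Suc k) = krylov M (M *\<^sub>v w) k"
  by (simp add: krylov_def funpow_swap1)

text \<open>The vector \<open>p(M) w\<close>. Tracking a single vector rather than the matrix
  \<open>p(M)\<close> keeps everything inside the Krylov space of \<open>w\<close>, where the
  functionals of interest are known to vanish.\<close>

definition poly_apply :: "'a :: comm_ring_1 poly \<Rightarrow> 'a mat \<Rightarrow> 'a vec \<Rightarrow> 'a vec" where
  "poly_apply p M w = vec (dim_vec w) (\<lambda>i. \<Sum>k\<le>degree p. coeff p k * krylov M w k $ i)"

lemma poly_apply_carrier [simp]: "w \<in> carrier_vec n \<Longrightarrow> poly_apply p M w \<in> carrier_vec n"
  by (rule carrier_vecI) (simp add: poly_apply_def)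

lemma coeff_sum_extend:
  fixes p :: "'a :: comm_ring_1 poly"
  assumes "degree p \<le> d"
  shows "(\<Sum>k\<le>degree p. coeff p k * f k) = (\<Sum>k\<le>d. coeff p k * f k)"
  using assms by (intro sum.mono_neutral_left) (auto simp: coeff_eq_0)

text \<open>The bound \<open>d\<close> may exceed the degree, so polynomials of unknown degree can
  be summed up to a fixed index such as \<open>n\<close>.\<close>

lemma poly_apply_index:
  assumes "w \<in> carrier_vec n" "i < n" "degree p \<le> d"
  shows "poly_apply p M w $ i = (\<Sum>k\<le>d. coeff p k * krylov M w k $ i)"
  using assms coeff_sum_extend[OF assms(3)] by (simp add: poly_apply_def)

lemma poly_apply_scalar_prod:
  assumes "M \<in> carrier_mat n n" "w \<in> carrier_vec n" "degree p \<le> d"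
  shows "b \<bullet> poly_apply p M w = (\<Sum>k\<le>d. coeff p k * (b \<bullet> krylov M w k))"
proof -
  have "b \<bullet> poly_apply p M w = (\<Sum>i<n. \<Sum>k\<le>d. b $ i * (coeff p k * krylov M w k $ i))"
    using assms by (simp add: scalar_prod_sum[of _ n] poly_apply_index sum_distrib_left)
  also have "\<dots> = (\<Sum>k\<le>d. \<Sum>i<n. b $ i * (coeff p k * krylov M w k $ i))"
    by (rule sum.swap)
  finally show ?thesis
    using assms by (simp add: scalar_prod_sum[of _ n] sum_distrib_left mult.left_commute)
qed

lemma mult_mat_poly_apply:
  assumes "F \<in> carrier_mat n n" "M \<in> carrier_mat n n" "w \<in> carrier_vec n" "i < n" "degree p \<le> d"
  shows "(F *\<^sub>v poly_apply p M w) $ i = (\<Sum>k\<le>d. coeff p k * (F *\<^sub>v krylov M w k) $ i)"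
  using assms poly_apply_scalar_prod[of M n w p d "row F i"] by simp

lemma poly_apply_linear_factor:
  fixes p :: "'a :: idom poly"
  assumes M: "M \<in> carrier_mat n n" and w: "w \<in> carrier_vec n"
  shows "poly_apply ([:- c, 1:] * p) M w = M *\<^sub>v poly_apply p M w - c \<cdot>\<^sub>v poly_apply p M w"
proof (rule eq_vecI)
  let ?d = "degree p"
  fix i assume "i < dim_vec (M *\<^sub>v poly_apply p M w - c \<cdot>\<^sub>v poly_apply p M w)"
  then have i: "i < n" using M w by (simp add: poly_apply_def)
  have deg: "degree ([:- c, 1:] * p) \<le> Suc ?d"
    using degree_mult_le[of "[:- c, 1:]" p] by simp
  have cf: "coeff ([:- c, 1:] * p) k = (case k of 0 \<Rightarrow> 0 | Suc l \<Rightarrow> coeff p l) - c * coeff p k" for k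
    by (auto simp: coeff_pCons split: nat.split)
  have "poly_apply ([:- c, 1:] * p) M w $ i =
      (\<Sum>k\<le>Suc ?d. (case k of 0 \<Rightarrow> 0 | Suc l \<Rightarrow> coeff p l) * krylov M w k $ i)
      - c * (\<Sum>k\<le>Suc ?d. coeff p k * krylov M w k $ i)"
    unfolding poly_apply_index[OF w i deg] cf
    by (simp only: left_diff_distrib sum_subtractf sum_distrib_left mult.assoc)
  also have "(\<Sum>k\<le>Suc ?d. (case k of 0 \<Rightarrow> 0 | Suc l \<Rightarrow> coeff p l) * krylov M w k $ i) =
      (\<Sum>k\<le>?d. coeff p k * krylov M w (Suc k) $ i)"
    by (subst sum.atMost_Suc_shift) simp
  also have "\<dots> = (M *\<^sub>v poly_apply p M w) $ i"
    using mult_mat_poly_apply[OF M M w i, of p ?d] by (simp add: krylov_Suc)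
  also have "(\<Sum>k\<le>Suc ?d. coeff p k * krylov M w k $ i) = poly_apply p M w $ i"
    using poly_apply_index[OF w i, of p "Suc ?d"] by simp
  finally show "poly_apply ([:- c, 1:] * p) M w $ i =
      (M *\<^sub>v poly_apply p M w - c \<cdot>\<^sub>v poly_apply p M w) $ i"
    using i M w by (simp add: poly_apply_def)
qed (use M w in \<open>simp add: poly_apply_def\<close>)

text \<open>The \<open>n + 1\<close> Krylov vectors with indices \<open>0\<close> to
  \<open>n\<close> live in dimension \<open>n\<close>, so they satisfy a linear relation; its
  coefficients are those of \<open>p\<close>.\<close>

lemma annihilating_poly_exists:
  fixes M :: "'a :: idom mat"
  assumes M: "M \<in> carrier_mat n n" and w: "w \<in> carrier_vec n"
  obtains p where "p \<noteq> 0" "degree p \<le> n" "poly_apply p M w = 0\<^sub>v n"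
proof -
  \<comment> \<open>The Krylov vectors are the columns. A zero last row makes the matrix square and
    singular, so determinants supply a kernel vector.\<close>
  define C where "C = mat (Suc n) (Suc n) (\<lambda>(i, k). if i < n then krylov M w k $ i else 0)"
  have C: "C \<in> carrier_mat (Suc n) (Suc n)" by (simp add: C_def)
  have "transpose_mat C *\<^sub>v unit_vec (Suc n) n = 0\<^sub>v (Suc n)"
    using C by (intro eq_vecI) (auto simp: C_def)
  moreover have "unit_vec (Suc n) n \<noteq> (0\<^sub>v (Suc n) :: 'a vec)" by simp
  ultimately have "det (transpose_mat C) = 0"
    using det_0_iff_vec_prod_zero[of "transpose_mat C" "Suc n"] C unit_vec_carrier by fastforce
  then have "det C = 0" using det_transpose[OF C] by simp
  then obtain v where v: "v \<in> carrier_vec (Suc n)" "v \<noteq> 0\<^sub>v (Suc n)" "C *\<^sub>v v = 0\<^sub>v (Suc n)"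
    using det_0_iff_vec_prod_zero[OF C] by blast
  define p where "p = Poly (map (\<lambda>k. v $ k) [0..<Suc n])"
  have cf: "coeff p k = v $ k" if "k \<le> n" for k
    using that by (simp add: p_def nth_default_def del: upt_Suc)
  have deg: "degree p \<le> n"
    by (rule degree_le) (auto simp: p_def nth_default_def simp del: upt_Suc)
  obtain k where "k < Suc n" "v $ k \<noteq> 0"
    using v by (metis eq_vecI carrier_vecD index_zero_vec)
  then have "p \<noteq> 0" using cf[of k] by auto
  moreover have "poly_apply p M w = 0\<^sub>v n"
  proof (rule eq_vecI)
    fix i assume "i < dim_vec (0\<^sub>v n :: 'a vec)"
    then have i: "i < n" by simp
    have "poly_apply p M w $ i = (\<Sum>k\<le>n. v $ k * krylov M w k $ i)"
      using poly_apply_index[OF w i deg] by (simp add: cf)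
    also have "\<dots> = (C *\<^sub>v v) $ i"
      using i by (subst mat_mult_vec_index[OF C v(1)])
        (simp_all add: C_def lessThan_Suc_atMost mult.commute)
    finally show "poly_apply p M w $ i = 0\<^sub>v n $ i" using v i by simp
  qed (use w in \<open>simp add: poly_apply_def\<close>)
  ultimately show thesis using that deg by blast
qed

text \<open>The minimal polynomial of \<open>w\<close> under \<open>M\<close> up to a scalar factor;
  it is not normalised to be monic.\<close>

definition minimal_annihilator :: "'a :: comm_ring_1 mat \<Rightarrow> 'a vec \<Rightarrow> 'a poly \<Rightarrow> bool" where
  "minimal_annihilator M w p \<longleftrightarrow> p \<noteq> 0 \<and> poly_apply p M w = 0\<^sub>v (dim_vec w) \<and>
     (\<forall>q. q \<noteq> 0 \<longrightarrow> degree q < degree p \<longrightarrow> poly_apply q M w \<noteq> 0\<^sub>v (dim_vec w))"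

lemma minimal_annihilator_exists:
  assumes "p \<noteq> 0" "poly_apply p M w = 0\<^sub>v (dim_vec w)"
  obtains q where "minimal_annihilator M w q" "degree q \<le> degree p"
proof -
  define Q where "Q q \<longleftrightarrow> q \<noteq> 0 \<and> poly_apply q M w = 0\<^sub>v (dim_vec w)" for q
  have "Q p" using assms by (simp add: Q_def)
  then obtain q where "Q q" "\<And>r. Q r \<Longrightarrow> degree q \<le> degree r"
    using ex_has_least_nat[of Q p degree] by auto
  then show thesis using that[of q] \<open>Q p\<close>
    unfolding minimal_annihilator_def Q_def by (meson leD)
qed

lemma degree_linear_mult:
  fixes q :: "'a :: idom poly"
  assumes "q \<noteq> 0"
  shows "degree ([:- z, 1:] * q) = Suc (degree q)"
  using assms by (subst degree_mult_eq) auto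

text \<open>Split off a complex root \<open>z\<close> of \<open>p\<close>. The cofactor
  \<open>q\<close> has smaller degree, so minimality keeps \<open>q(M) w\<close> nonzero, while
  \<open>(M - z) q(M) w = p(M) w\<close> vanishes.\<close>

lemma minimal_annihilator_split:
  fixes M :: "complex mat"
  assumes M: "M \<in> carrier_mat n n" and w: "w \<in> carrier_vec n" "w \<noteq> 0\<^sub>v n"
    and p: "minimal_annihilator M w p"
  obtains z q where "p = [:- z, 1:] * q" "degree p = Suc (degree q)" "q \<noteq> 0"
    "poly_apply q M w \<noteq> 0\<^sub>v n" "M *\<^sub>v poly_apply q M w = z \<cdot>\<^sub>v poly_apply q M w"
proof -
  have p0: "p \<noteq> 0" and ann: "poly_apply p M w = 0\<^sub>v n"
    and min: "\<And>q. q \<noteq> 0 \<Longrightarrow> degree q < degree p \<Longrightarrow> poly_apply q M w \<noteq> 0\<^sub>v n"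
    using p w by (auto simp: minimal_annihilator_def)
  \<comment> \<open>A nonzero constant annihilates only the zero vector, so there is a root to split
    off.\<close>
  have "degree p \<noteq> 0"
  proof
    assume "degree p = 0"
    then obtain a where a: "p = [:a:]" by (rule degree_eq_zeroE)
    have "w = 0\<^sub>v n"
    proof (rule eq_vecI)
      fix i assume "i < dim_vec (0\<^sub>v n :: complex vec)"
      then show "w $ i = 0\<^sub>v n $ i"
        using poly_apply_index[OF w(1), of i p 0 M] ann a p0 by simp
    qed (use w in simp)
    with w show False by simp
  qed
  then obtain z where "poly p z = 0"
    using fundamental_theorem_of_algebra[of p] by (auto simp: constant_degree)
  then obtain q where q: "p = [:- z, 1:] * q" by (auto simp: poly_eq_0_iff_dvd)
  then have q0: "q \<noteq> 0" using p0 by auto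
  have deg: "degree p = Suc (degree q)" unfolding q using q0 by (rule degree_linear_mult)
  let ?u = "poly_apply q M w"
  have u: "?u \<in> carrier_vec n" using w by simp
  have "M *\<^sub>v ?u - z \<cdot>\<^sub>v ?u = 0\<^sub>v n"
    using ann unfolding q poly_apply_linear_factor[OF M w(1)] .
  then have "M *\<^sub>v ?u = z \<cdot>\<^sub>v ?u"
    using M u by (intro eq_vecI) (auto simp: vec_eq_iff)
  then show thesis using that[OF q deg q0] min[OF q0] deg by simp
qed

text \<open>The passage from a rank condition of Kalman type to the eigenvector test of Hautus: the
  eigenvector is \<open>q(M) w\<close> with \<open>q\<close> of degree below that of
  \<open>p\<close>, hence a combination of Krylov vectors that the functionals in \<open>S\<close>
  kill.\<close>

lemma eigenvector_in_krylov_kernel: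
  fixes M :: "complex mat"
  assumes M: "M \<in> carrier_mat n n" and w: "w \<in> carrier_vec n" "w \<noteq> 0\<^sub>v n"
    and p: "p \<noteq> 0" "poly_apply p M w = 0\<^sub>v n"
    and kill: "\<And>b k. b \<in> S \<Longrightarrow> k < degree p \<Longrightarrow> b \<bullet> krylov M w k = 0"
  obtains z u where "u \<in> carrier_vec n" "u \<noteq> 0\<^sub>v n" "M *\<^sub>v u = z \<cdot>\<^sub>v u"
    "\<And>b. b \<in> S \<Longrightarrow> b \<bullet> u = 0"
proof -
  obtain r where r: "minimal_annihilator M w r" "degree r \<le> degree p"
    using minimal_annihilator_exists[OF p(1), of M w] p w by auto
  obtain z q where q: "degree r = Suc (degree q)" "poly_apply q M w \<noteq> 0\<^sub>v n"
    "M *\<^sub>v poly_apply q M w = z \<cdot>\<^sub>v poly_apply q M w"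
    using minimal_annihilator_split[OF M w r(1)] by metis
  have "b \<bullet> poly_apply q M w = 0" if "b \<in> S" for b
    unfolding poly_apply_scalar_prod[OF M w(1) order_refl]
    using kill[OF that] q(1) r(2) by (intro sum.neutral) auto
  then show thesis using that[OF poly_apply_carrier[OF w(1)] q(2,3)] by blast
qed

lemma krylov_eigenvector:
  fixes M F :: "complex mat"
  assumes F: "F \<in> carrier_mat n n" and M: "M \<in> carrier_mat n n" and w: "w \<in> carrier_vec n"
    and comm: "F * M = M * F" and eig: "F *\<^sub>v w = l \<cdot>\<^sub>v w"
  shows "F *\<^sub>v krylov M w k = l \<cdot>\<^sub>v krylov M w k"
proof (induction k)
  case (Suc k)
  have k: "krylov M w k \<in> carrier_vec n" using M w by simp
  have "F *\<^sub>v (M *\<^sub>v krylov M w k) = M *\<^sub>v (F *\<^sub>v krylov M w k)"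
    using F M k comm by (simp flip: assoc_mult_mat_vec)
  then show ?case using Suc mult_mat_vec[OF M k] by (simp add: krylov_Suc)
qed (use eig in simp)

lemma poly_apply_eigenvector:
  fixes M F :: "complex mat"
  assumes F: "F \<in> carrier_mat n n" and M: "M \<in> carrier_mat n n" and w: "w \<in> carrier_vec n"
    and comm: "F * M = M * F" and eig: "F *\<^sub>v w = l \<cdot>\<^sub>v w"
  shows "F *\<^sub>v poly_apply p M w = l \<cdot>\<^sub>v poly_apply p M w"
proof (rule eq_vecI)
  fix i assume "i < dim_vec (l \<cdot>\<^sub>v poly_apply p M w)"
  then have i: "i < n" using w by (simp add: poly_apply_def)
  have k: "krylov M w k \<in> carrier_vec n" for k using M w by simp
  show "(F *\<^sub>v poly_apply p M w) $ i = (l \<cdot>\<^sub>v poly_apply p M w) $ i"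
    unfolding mult_mat_poly_apply[OF F M w i order_refl] krylov_eigenvector[OF F M w comm eig]
    using i w k[THEN carrier_vecD]
    by (simp add: poly_apply_index[OF w i order_refl] poly_apply_carrier[THEN carrier_vecD]
        sum_distrib_left mult.left_commute)
qed (use F w in \<open>simp add: poly_apply_def\<close>)

text \<open>On an eigenspace of \<open>F\<close>, which is invariant under \<open>M\<close>, the hypotheses leave \<open>M\<close> only one
  eigenvalue and no Jordan chain of length two, so \<open>M\<close> is a scalar there.\<close>

lemma eigenvector_of_commuting:
  fixes M F :: "complex mat"
  assumes F: "F \<in> carrier_mat n n" and M: "M \<in> carrier_mat n n"
    and w: "w \<in> carrier_vec n" "w \<noteq> 0\<^sub>v n"
    and comm: "F * M = M * F" and eig: "F *\<^sub>v w = l \<cdot>\<^sub>v w"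
    and uniq: "\<And>z z' u u'. u \<in> carrier_vec n \<Longrightarrow> u \<noteq> 0\<^sub>v n \<Longrightarrow> u' \<in> carrier_vec n \<Longrightarrow> u' \<noteq> 0\<^sub>v n \<Longrightarrow>
      M *\<^sub>v u = z \<cdot>\<^sub>v u \<Longrightarrow> M *\<^sub>v u' = z' \<cdot>\<^sub>v u' \<Longrightarrow> F *\<^sub>v u = l \<cdot>\<^sub>v u \<Longrightarrow> F *\<^sub>v u' = l \<cdot>\<^sub>v u' \<Longrightarrow> z = z'"
    and chain: "\<And>z u u'. u \<in> carrier_vec n \<Longrightarrow> u' \<in> carrier_vec n \<Longrightarrow>
      M *\<^sub>v u = z \<cdot>\<^sub>v u + u' \<Longrightarrow> M *\<^sub>v u' = z \<cdot>\<^sub>v u' \<Longrightarrow> F *\<^sub>v u = l \<cdot>\<^sub>v u \<Longrightarrow>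
      F *\<^sub>v u' = l \<cdot>\<^sub>v u' \<Longrightarrow> u' = 0\<^sub>v n"
  obtains z where "M *\<^sub>v w = z \<cdot>\<^sub>v w"
proof -
  obtain p0 where "p0 \<noteq> 0" "poly_apply p0 M w = 0\<^sub>v n"
    using annihilating_poly_exists[OF M w(1)] by metis
  then obtain p where p: "minimal_annihilator M w p"
    using minimal_annihilator_exists[of p0 M w] w by auto
  then have ann: "poly_apply p M w = 0\<^sub>v n"
    and min: "\<And>q. q \<noteq> 0 \<Longrightarrow> degree q < degree p \<Longrightarrow> poly_apply q M w \<noteq> 0\<^sub>v n"
    using w by (auto simp: minimal_annihilator_def)
  obtain z q where q: "p = [:- z, 1:] * q" "degree p = Suc (degree q)" "q \<noteq> 0"
    "M *\<^sub>v poly_apply q M w = z \<cdot>\<^sub>v poly_apply q M w"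
    using minimal_annihilator_split[OF M w p] by metis
  have Fp: "F *\<^sub>v poly_apply r M w = l \<cdot>\<^sub>v poly_apply r M w" for r
    by (rule poly_apply_eigenvector[OF F M w(1) comm eig])
  have "degree q = 0"
  proof (rule ccontr)
    assume "degree q \<noteq> 0"
    then obtain z' where "poly q z' = 0"
      using fundamental_theorem_of_algebra[of q] by (auto simp: constant_degree)
    then obtain r where r: "q = [:- z', 1:] * r" by (auto simp: poly_eq_0_iff_dvd)
    have r0: "r \<noteq> 0" using q(3) r by auto
    have degq: "degree q = Suc (degree r)" unfolding r using r0 by (rule degree_linear_mult)
    \<comment> \<open>With \<open>p = (X - z) (X - z') r\<close>, the cofactors
      \<open>q = (X - z') r\<close> and \<open>s = (X - z) r\<close> give eigenvectors for
      \<open>z\<close> and \<open>z'\<close>. Once \<open>z = z'\<close>, the vectors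
      \<open>r(M) w\<close> and \<open>s(M) w\<close> form a Jordan chain.\<close>
    define s where "s = [:- z, 1:] * r"
    have s0: "s \<noteq> 0" using r0 by (simp add: s_def del: mult_pCons_left)
    have degs: "degree s = Suc (degree r)" unfolding s_def using r0 by (rule degree_linear_mult)
    have ps: "p = [:- z', 1:] * s" unfolding q r s_def by (simp only: mult.left_commute)
    define u where "u = poly_apply r M w"
    define u1 where "u1 = poly_apply q M w"
    define u2 where "u2 = poly_apply s M w"
    have car: "u \<in> carrier_vec n" "u1 \<in> carrier_vec n" "u2 \<in> carrier_vec n"
      using w by (simp_all add: u_def u1_def u2_def)
    have nz: "u1 \<noteq> 0\<^sub>v n" "u2 \<noteq> 0\<^sub>v n"
      using min[OF q(3)] min[OF s0] q(2) degs degq by (simp_all add: u1_def u2_def)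
    have "M *\<^sub>v u2 - z' \<cdot>\<^sub>v u2 = 0\<^sub>v n"
      using ann unfolding ps poly_apply_linear_factor[OF M w(1)] u2_def .
    then have e2: "M *\<^sub>v u2 = z' \<cdot>\<^sub>v u2"
      using M car by (intro eq_vecI) (auto simp: vec_eq_iff)
    have e1: "M *\<^sub>v u1 = z \<cdot>\<^sub>v u1" using q(4) by (simp add: u1_def)
    have zz: "z = z'"
      by (rule uniq[OF car(2) nz(1) car(3) nz(2) e1 e2]) (simp_all add: u1_def u2_def Fp)
    have "u2 = M *\<^sub>v u - z \<cdot>\<^sub>v u"
      unfolding u2_def s_def u_def by (rule poly_apply_linear_factor[OF M w(1)])
    then have "M *\<^sub>v u = z \<cdot>\<^sub>v u + u2"
      using M car by (intro eq_vecI) auto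
    then have "u2 = 0\<^sub>v n" using chain[OF car(1,3)] e2 zz Fp by (simp add: u_def u2_def)
    with nz show False by simp
  qed
  then obtain a where a: "q = [:a:]" by (rule degree_eq_zeroE)
  then have a0: "a \<noteq> 0" using q(3) by auto
  have aw: "poly_apply q M w = a \<cdot>\<^sub>v w"
    using w a by (intro eq_vecI) (auto simp: poly_apply_def)
  have "a \<cdot>\<^sub>v (M *\<^sub>v w) = a \<cdot>\<^sub>v (z \<cdot>\<^sub>v w)"
    using q(4) M w unfolding aw by (simp add: mult_mat_vec smult_smult_assoc mult.commute)
  then have "M *\<^sub>v w = z \<cdot>\<^sub>v w"
    using a0 M w by (auto simp: vec_eq_iff)
  then show thesis using that by blast
qed

section \<open>The matrix exponential\<close>

text \<open>Exponential generating function. A coordinate of \<open>exp (s M) w\<close> has this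
  form, with \<open>a k\<close> the same coordinate of the \<open>k\<close>-th Krylov vector, and
  differentiation only shifts \<open>a\<close>.\<close>

definition egf :: "(nat \<Rightarrow> complex) \<Rightarrow> complex \<Rightarrow> complex" where
  "egf a s = (\<Sum>k. a k / fact k * s ^ k)"

lemma egf_summable:
  fixes a :: "nat \<Rightarrow> complex"
  assumes "\<And>k. norm (a k) \<le> C * K ^ k"
  shows "summable (\<lambda>k. a k / fact k * s ^ k)"
proof (rule summable_comparison_test')
  show "summable (\<lambda>k. C * (inverse (fact k) * (K * norm s) ^ k))"
    by (intro summable_mult summable_exp)
  show "norm (a k / fact k * s ^ k) \<le> C * (inverse (fact k) * (K * norm s) ^ k)" if "k \<ge> 0" for k
    using mult_right_mono[OF assms, of "inverse (fact k) * norm s ^ k" k]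
    by (simp add: norm_mult norm_divide norm_power power_mult_distrib field_simps)
qed

lemma egf_sums:
  assumes "\<And>k. norm (a k) \<le> C * K ^ k"
  shows "(\<lambda>k. a k / fact k * s ^ k) sums egf a s"
  unfolding egf_def using egf_summable[OF assms] by (rule summable_sums)

lemma egf_derivative:
  assumes "\<And>k. norm (a k) \<le> C * K ^ k"
  shows "(egf a has_field_derivative egf (\<lambda>k. a (Suc k)) s) (at s)"
proof -
  have "((\<lambda>s. \<Sum>k. a k / fact k * s ^ k) has_field_derivative
      (\<Sum>k. diffs (\<lambda>k. a k / fact k) k * s ^ k)) (at s)"
    by (rule termdiffs_strong[of _ "of_real (norm s + 1)"]) (use egf_summable[OF assms] in auto)
  moreover have "diffs (\<lambda>k. a k / fact k) k = a (Suc k) / fact k" for k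
    by (simp add: diffs_def del: of_nat_Suc)
  ultimately show ?thesis by (simp add: egf_def[abs_def])
qed

lemma egf_unique: "(\<lambda>k. a k / fact k * s ^ k) sums c \<Longrightarrow> egf a s = c"
  by (simp add: egf_def sums_iff)

lemma egf_linear:
  assumes "\<And>j k. j \<in> J \<Longrightarrow> norm (a j k) \<le> C j * K j ^ k"
  shows "egf (\<lambda>k. \<Sum>j\<in>J. a j k * c j) s = (\<Sum>j\<in>J. egf (a j) s * c j)"
proof (rule egf_unique)
  have "(\<lambda>k. \<Sum>j\<in>J. a j k / fact k * s ^ k * c j) sums (\<Sum>j\<in>J. egf (a j) s * c j)"
    using assms by (intro sums_sum sums_mult2 egf_sums) auto
  then show "(\<lambda>k. (\<Sum>j\<in>J. a j k * c j) / fact k * s ^ k) sums (\<Sum>j\<in>J. egf (a j) s * c j)"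
    by (simp add: sum_divide_distrib sum_distrib_left sum_distrib_right mult_ac)
qed

lemma exp_sums: "(\<lambda>k. z ^ k / fact k * s ^ k) sums exp (z * s :: complex)"
  using exp_converges[of "z * s"]
  by (simp add: scaleR_conv_of_real power_mult_distrib divide_simps)

lemma egf_power: "egf (\<lambda>k. z ^ k * c) s = exp (z * s) * c"
  using sums_mult2[OF exp_sums[of z s], of c] by (intro egf_unique) (simp add: mult_ac)

text \<open>The coefficient sequence of a Jordan chain of length two. The truncated
  \<open>k - 1\<close> at \<open>k = 0\<close> is harmless because of the factor
  \<open>of_nat k\<close>.\<close>

lemma egf_chain:
  "egf (\<lambda>k. z ^ k * c + of_nat k * z ^ (k - 1) * d) s = exp (z * s) * c + s * exp (z * s) * d"
proof (rule egf_unique)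
  have "(\<lambda>k. of_nat (Suc k) * z ^ k * d / fact (Suc k) * s ^ Suc k) sums (s * exp (z * s) * d)"
    using sums_mult2[OF sums_mult[OF exp_sums[of z s], of s], of d]
    by (simp add: mult_ac del: of_nat_Suc)
  then have "(\<lambda>k. of_nat k * z ^ (k - 1) * d / fact k * s ^ k) sums (s * exp (z * s) * d)"
    using sums_Suc_iff[of "\<lambda>k. of_nat k * z ^ (k - 1) * d / fact k * s ^ k" "s * exp (z * s) * d"]
    by simp
  from sums_add[OF sums_mult2[OF exp_sums[of z s], of c] this]
  show "(\<lambda>k. (z ^ k * c + of_nat k * z ^ (k - 1) * d) / fact k * s ^ k) sums
      (exp (z * s) * c + s * exp (z * s) * d)"
    by (simp add: add_divide_distrib distrib_left mult_ac)
qed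

text \<open>The shift for which \<open>egf (shift_seq a)\<close> is the antiderivative of
  \<open>egf a\<close> that vanishes at 0.\<close>

definition shift_seq :: "(nat \<Rightarrow> complex) \<Rightarrow> nat \<Rightarrow> complex" where
  "shift_seq a k = (case k of 0 \<Rightarrow> 0 | Suc l \<Rightarrow> a l)"

lemma shift_seq_simps [simp]: "shift_seq a 0 = 0" "shift_seq a (Suc k) = a k"
  by (simp_all add: shift_seq_def)

lemma shift_seq_bound:
  assumes "\<And>k. norm (a k) \<le> C * K ^ k" "K \<ge> 1"
  shows "norm (shift_seq a k) \<le> C * K ^ k"
proof (cases k)
  case 0
  have "C \<ge> 0" using assms(1)[of 0] norm_ge_zero[of "a 0"] by (simp del: norm_ge_zero)
  then show ?thesis using 0 by simp
next
  case (Suc l)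
  have "0 \<le> C * K ^ l" using assms(1)[of l] norm_ge_zero order_trans by blast
  then have "C * K ^ l * 1 \<le> C * K ^ l * K" using assms(2) by (intro mult_left_mono)
  then show ?thesis using Suc assms(1)[of l] by (simp add: mult_ac)
qed

text \<open>The value is the integral of \<open>exp (z r) * c\<close> over \<open>r\<close> from 0
  to \<open>s\<close>; the case \<open>z = 0\<close> is treated separately below.\<close>

lemma egf_shift_power:
  assumes "z \<noteq> 0"
  shows "egf (shift_seq (\<lambda>k. z ^ k * c)) s = (exp (z * s) - 1) / z * c"
proof (rule egf_unique)
  have "(\<lambda>k. z ^ Suc k / fact (Suc k) * s ^ Suc k) sums (exp (z * s) - 1)"
    using exp_sums[of z s] sums_Suc_iff[of "\<lambda>k. z ^ k / fact k * s ^ k"] by simp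
  from sums_mult2[OF sums_divide[OF this, of z], of c]
  have "(\<lambda>k. shift_seq (\<lambda>k. z ^ k * c) (Suc k) / fact (Suc k) * s ^ Suc k) sums
      ((exp (z * s) - 1) / z * c)"
    using assms by (simp add: mult_ac)
  then show "(\<lambda>k. shift_seq (\<lambda>k. z ^ k * c) k / fact k * s ^ k) sums ((exp (z * s) - 1) / z * c)"
    using sums_Suc_iff[of "\<lambda>k. shift_seq (\<lambda>k. z ^ k * c) k / fact k * s ^ k"] by simp
qed

lemma egf_shift_power_0: "egf (shift_seq (\<lambda>k. 0 ^ k * c)) s = s * c"
proof (rule egf_unique)
  \<comment> \<open>Since \<open>0 ^ 0 = 1\<close>, the coefficient at index 1 is the only one that
    can be nonzero.\<close>
  have "(\<lambda>k. shift_seq (\<lambda>k. 0 ^ k * c) k / fact k * s ^ k) sums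
      (\<Sum>k\<in>{1}. shift_seq (\<lambda>k. 0 ^ k * c) k / fact k * s ^ k)"
  proof (rule sums_finite)
    fix k :: nat assume "k \<notin> {1}"
    then show "shift_seq (\<lambda>k. 0 ^ k * c) k / fact k * s ^ k = 0"
      by (auto simp: shift_seq_def split: nat.split)
  qed simp
  then show "(\<lambda>k. shift_seq (\<lambda>k. 0 ^ k * c) k / fact k * s ^ k) sums (s * c)"
    by (simp add: shift_seq_def mult.commute)
qed

definition mat_exp :: "nat \<Rightarrow> complex mat \<Rightarrow> complex \<Rightarrow> complex mat" where
  "mat_exp n M s = mat n n (\<lambda>(i, j). egf (\<lambda>k. (M ^\<^sub>m k) $$ (i, j)) s)"

text \<open>The integral of \<open>mat_exp n M\<close> from \<open>0\<close> to \<open>s\<close>.\<close>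

definition mat_exp_int :: "nat \<Rightarrow> complex mat \<Rightarrow> complex \<Rightarrow> complex mat" where
  "mat_exp_int n M s = mat n n (\<lambda>(i, j). egf (shift_seq (\<lambda>k. (M ^\<^sub>m k) $$ (i, j))) s)"

lemma mat_exp_carrier [simp]:
  "mat_exp n M s \<in> carrier_mat n n" "mat_exp_int n M s \<in> carrier_mat n n"
  by (simp_all add: mat_exp_def mat_exp_int_def)

lemma pow_mat_mult_vec:
  assumes "M \<in> carrier_mat n n" "w \<in> carrier_vec n"
  shows "M ^\<^sub>m k *\<^sub>v w = krylov M w k"
  using assms(2)
proof (induction k arbitrary: w)
  case (Suc k)
  have "M ^\<^sub>m Suc k *\<^sub>v w = M ^\<^sub>m k *\<^sub>v (M *\<^sub>v w)"
    using assms(1) Suc.prems by (simp add: assoc_mult_mat_vec[of _ n n])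
  then show ?case using Suc assms(1) by (simp add: krylov_Suc')
qed (use assms in simp)

text \<open>Induction on the power, with \<open>K\<close> above every column sum of absolute values.
  The shape \<open>1 * K ^ k\<close> matches the bounds of the \<open>egf\<close> lemmas, and
  \<open>K \<ge> 1\<close> serves \<open>shift_seq_bound\<close>.\<close>

lemma pow_mat_bound:
  fixes M :: "complex mat"
  assumes M: "M \<in> carrier_mat n n"
  obtains K where "K \<ge> 1" "\<And>i j k. i < n \<Longrightarrow> j < n \<Longrightarrow> norm ((M ^\<^sub>m k) $$ (i, j)) \<le> 1 * K ^ k"
proof -
  define K where "K = 1 + (\<Sum>j<n. \<Sum>l<n. norm (M $$ (l, j)))"
  have K: "K \<ge> 1" by (simp add: K_def sum_nonneg)
  have "norm ((M ^\<^sub>m k) $$ (i, j)) \<le> K ^ k" if "i < n" "j < n" for i j k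
    using that(2)
  proof (induction k arbitrary: j)
    case 0
    then show ?case using that M by simp
  next
    case (Suc k)
    have "norm ((M ^\<^sub>m Suc k) $$ (i, j)) = norm (\<Sum>l<n. (M ^\<^sub>m k) $$ (i, l) * M $$ (l, j))"
      using mat_mult_index[of "M ^\<^sub>m k" n n M n i j] M Suc.prems that by simp
    also have "\<dots> \<le> (\<Sum>l<n. norm ((M ^\<^sub>m k) $$ (i, l)) * norm (M $$ (l, j)))"
      by (rule sum_norm_le) (simp add: norm_mult)
    also have "\<dots> \<le> (\<Sum>l<n. K ^ k * norm (M $$ (l, j)))"
      using Suc.IH by (intro sum_mono mult_right_mono) auto
    also have "\<dots> = K ^ k * (\<Sum>l<n. norm (M $$ (l, j)))" by (simp add: sum_distrib_left)
    also have "\<dots> \<le> K ^ k * K"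
    proof (rule mult_left_mono)
      show "(\<Sum>l<n. norm (M $$ (l, j))) \<le> K"
        unfolding K_def
        using member_le_sum[of j "{..<n}" "\<lambda>j. \<Sum>l<n. norm (M $$ (l, j))"] Suc.prems
        by (simp add: sum_nonneg)
    qed (use K in simp)
    finally show ?case by (simp add: mult.commute)
  qed
  then show thesis using that[OF K] by simp
qed

lemma krylov_bound:
  fixes M :: "complex mat"
  assumes M: "M \<in> carrier_mat n n" and w: "w \<in> carrier_vec n"
  obtains C K where "K \<ge> 1" "\<And>i k. i < n \<Longrightarrow> norm (krylov M w k $ i) \<le> C * K ^ k"
proof -
  obtain K where K: "K \<ge> 1" "\<And>i j k. i < n \<Longrightarrow> j < n \<Longrightarrow> norm ((M ^\<^sub>m k) $$ (i, j)) \<le> 1 * K ^ k"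
    using pow_mat_bound[OF M] by metis
  have "norm (krylov M w k $ i) \<le> (\<Sum>j<n. norm (w $ j)) * K ^ k" if "i < n" for i k
  proof -
    have "krylov M w k $ i = (\<Sum>j<n. (M ^\<^sub>m k) $$ (i, j) * w $ j)"
      unfolding pow_mat_mult_vec[OF M w, symmetric]
      by (rule mat_mult_vec_index[of _ n n]) (use M w that in auto)
    also have "norm \<dots> \<le> (\<Sum>j<n. K ^ k * norm (w $ j))"
      using K(2)[OF that] by (intro sum_norm_le) (simp add: norm_mult mult_right_mono)
    finally show ?thesis by (simp add: sum_distrib_left[symmetric] mult.commute)
  qed
  then show thesis using that K(1) by blast
qed

text \<open>Reduces the action on a vector to scalar series, so that an explicit Krylov sequence, as
  for eigenvectors and Jordan chains, gives a closed form.\<close>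

lemma mat_exp_vec:
  assumes M: "M \<in> carrier_mat n n" and w: "w \<in> carrier_vec n" and i: "i < n"
  shows "(mat_exp n M s *\<^sub>v w) $ i = egf (\<lambda>k. krylov M w k $ i) s"
proof -
  obtain K where K: "K \<ge> 1" "\<And>i j k. i < n \<Longrightarrow> j < n \<Longrightarrow> norm ((M ^\<^sub>m k) $$ (i, j)) \<le> 1 * K ^ k"
    using pow_mat_bound[OF M] by metis
  have "krylov M w k $ i = (\<Sum>j\<in>{..<n}. (M ^\<^sub>m k) $$ (i, j) * w $ j)" for k
    unfolding pow_mat_mult_vec[OF M w, symmetric]
    by (rule mat_mult_vec_index[of _ n n]) (use M w i in auto)
  then show ?thesis
    using i K(2) unfolding mat_mult_vec_index[OF mat_exp_carrier(1) w i]
    by (simp, subst egf_linear[of "{..<n}" "\<lambda>j k. (M ^\<^sub>m k) $$ (i, j)" "\<lambda>_. 1" "\<lambda>_. K"])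
      (simp_all add: mat_exp_def)
qed

lemma mat_exp_int_vec:
  assumes M: "M \<in> carrier_mat n n" and w: "w \<in> carrier_vec n" and i: "i < n"
  shows "(mat_exp_int n M s *\<^sub>v w) $ i = egf (shift_seq (\<lambda>k. krylov M w k $ i)) s"
proof -
  obtain K where K: "K \<ge> 1" "\<And>i j k. i < n \<Longrightarrow> j < n \<Longrightarrow> norm ((M ^\<^sub>m k) $$ (i, j)) \<le> 1 * K ^ k"
    using pow_mat_bound[OF M] by metis
  have kr: "krylov M w k $ i = (\<Sum>j\<in>{..<n}. (M ^\<^sub>m k) $$ (i, j) * w $ j)" for k
    unfolding pow_mat_mult_vec[OF M w, symmetric]
    by (rule mat_mult_vec_index[of _ n n]) (use M w i in auto)
  have "shift_seq (\<lambda>k. krylov M w k $ i) =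
      (\<lambda>k. \<Sum>j\<in>{..<n}. shift_seq (\<lambda>k. (M ^\<^sub>m k) $$ (i, j)) k * w $ j)"
    by (auto simp: fun_eq_iff shift_seq_def kr split: nat.split)
  moreover have "norm (shift_seq (\<lambda>k. (M ^\<^sub>m k) $$ (i, j)) k) \<le> 1 * K ^ k" if "j < n" for j k
    by (rule shift_seq_bound[OF K(2)[OF i that] K(1)])
  ultimately show ?thesis
    using i unfolding mat_mult_vec_index[OF mat_exp_carrier(2) w i]
    by (simp, subst egf_linear[of "{..<n}" "\<lambda>j. shift_seq (\<lambda>k. (M ^\<^sub>m k) $$ (i, j))" "\<lambda>_. 1" "\<lambda>_. K"])
      (simp_all add: mat_exp_int_def)
qed

lemma mat_exp_commute_vec:
  assumes M: "M \<in> carrier_mat n n" and w: "w \<in> carrier_vec n"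
  shows "mat_exp n M s *\<^sub>v (M *\<^sub>v w) = M *\<^sub>v (mat_exp n M s *\<^sub>v w)"
proof (rule eq_vecI)
  fix i assume "i < dim_vec (M *\<^sub>v (mat_exp n M s *\<^sub>v w))"
  then have i: "i < n" using M by simp
  obtain C K where K: "K \<ge> 1" "\<And>i k. i < n \<Longrightarrow> norm (krylov M w k $ i) \<le> C * K ^ k"
    using krylov_bound[OF M w] by metis
  have kr: "krylov M (M *\<^sub>v w) k $ i = (\<Sum>j\<in>{..<n}. krylov M w k $ j * M $$ (i, j))" for k
    unfolding krylov_Suc'[symmetric] krylov_Suc
    using mat_mult_vec_index[OF M krylov_carrier[OF M w] i] by (simp add: mult.commute)
  have Mw: "M *\<^sub>v w \<in> carrier_vec n" using M w by simp
  have Ew: "mat_exp n M s *\<^sub>v w \<in> carrier_vec n"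
    using mult_mat_vec_carrier[OF mat_exp_carrier(1) w] .
  show "(mat_exp n M s *\<^sub>v (M *\<^sub>v w)) $ i = (M *\<^sub>v (mat_exp n M s *\<^sub>v w)) $ i"
    unfolding mat_exp_vec[OF M Mw i] mat_mult_vec_index[OF M Ew i] kr
    using K(2) mat_exp_vec[OF M w]
    by (subst egf_linear[of "{..<n}" "\<lambda>j k. krylov M w k $ j" "\<lambda>_. C" "\<lambda>_. K"])
      (simp_all add: mult.commute)
qed (use M in \<open>simp add: mat_exp_def\<close>)

lemma mat_eq_by_vec:
  fixes A B :: "'a :: comm_ring_1 mat"
  assumes "A \<in> carrier_mat a b" "B \<in> carrier_mat a b"
    and "\<And>v. v \<in> carrier_vec b \<Longrightarrow> A *\<^sub>v v = B *\<^sub>v v"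
  shows "A = B"
proof (rule eq_matI)
  fix i j assume "i < dim_row B" "j < dim_col B"
  then have ij: "i < a" "j < b" using assms by auto
  then show "A $$ (i, j) = B $$ (i, j)"
    using arg_cong[OF assms(3)[OF unit_vec_carrier], of "\<lambda>v. v $ i" j] assms(1,2) by simp
qed (use assms in auto)

lemma mat_exp_commute:
  assumes M: "M \<in> carrier_mat n n"
  shows "mat_exp n M s * M = M * mat_exp n M s"
proof (rule mat_eq_by_vec[of _ n n])
  show "mat_exp n M s * M *\<^sub>v v = M * mat_exp n M s *\<^sub>v v" if "v \<in> carrier_vec n" for v
    using mat_exp_commute_vec[OF M that] assoc_mult_mat_vec[OF mat_exp_carrier(1) M that]
      assoc_mult_mat_vec[OF M mat_exp_carrier(1) that] by simp
qed (use M in \<open>auto simp: mat_exp_def\<close>)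

lemma mat_exp_derivative:
  assumes M: "M \<in> carrier_mat n n" and w: "w \<in> carrier_vec n" and i: "i < n"
  shows "((\<lambda>s. (mat_exp n M s *\<^sub>v w) $ i) has_field_derivative
    (M *\<^sub>v (mat_exp n M s *\<^sub>v w)) $ i) (at s)"
proof -
  obtain C K where K: "K \<ge> 1" "\<And>i k. i < n \<Longrightarrow> norm (krylov M w k $ i) \<le> C * K ^ k"
    using krylov_bound[OF M w] by metis
  have Mw: "M *\<^sub>v w \<in> carrier_vec n" using M w by simp
  show ?thesis
    using egf_derivative[OF K(2)[OF i], of s]
    unfolding mat_exp_vec[OF M w i, abs_def] mat_exp_commute_vec[OF M w, symmetric]
      mat_exp_vec[OF M Mw i] krylov_Suc'[symmetric] .
qed

lemma mat_exp_int_derivative: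
  assumes M: "M \<in> carrier_mat n n" and w: "w \<in> carrier_vec n" and i: "i < n"
  shows "((\<lambda>s. (mat_exp_int n M s *\<^sub>v w) $ i) has_field_derivative (mat_exp n M s *\<^sub>v w) $ i) (at s)"
proof -
  obtain C K where K: "K \<ge> 1" "\<And>i k. i < n \<Longrightarrow> norm (krylov M w k $ i) \<le> C * K ^ k"
    using krylov_bound[OF M w] by metis
  show ?thesis
    using egf_derivative[OF shift_seq_bound[OF K(2)[OF i] K(1)], of s]
    unfolding mat_exp_vec[OF M w i] mat_exp_int_vec[OF M w i, abs_def] shift_seq_simps .
qed

lemma mat_exp_0:
  assumes M: "M \<in> carrier_mat n n" and w: "w \<in> carrier_vec n"
  shows "mat_exp n M 0 *\<^sub>v w = w" "mat_exp_int n M 0 *\<^sub>v w = 0\<^sub>v n"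
proof -
  have "egf a 0 = a 0" for a unfolding egf_def by (subst powser_zero) simp
  then show "mat_exp n M 0 *\<^sub>v w = w" "mat_exp_int n M 0 *\<^sub>v w = 0\<^sub>v n"
    using w by (auto intro!: eq_vecI simp: mat_exp_vec[OF M w] mat_exp_int_vec[OF M w]
        simp del: index_mult_mat_vec) (auto simp: mat_exp_def mat_exp_int_def)
qed

lemma krylov_eigen:
  fixes M :: "complex mat"
  assumes M: "M \<in> carrier_mat n n" and u: "u \<in> carrier_vec n" and eig: "M *\<^sub>v u = z \<cdot>\<^sub>v u"
  shows "krylov M u k = z ^ k \<cdot>\<^sub>v u"
  by (induction k) (use eig u in \<open>simp_all add: krylov_Suc mult_mat_vec[OF M u] smult_smult_assoc mult.commute\<close>)

lemma krylov_chain: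
  fixes M :: "complex mat"
  assumes M: "M \<in> carrier_mat n n" and u: "u \<in> carrier_vec n" and u': "u' \<in> carrier_vec n"
    and eig: "M *\<^sub>v u = z \<cdot>\<^sub>v u + u'" "M *\<^sub>v u' = z \<cdot>\<^sub>v u'"
  shows "krylov M u k = z ^ k \<cdot>\<^sub>v u + (of_nat k * z ^ (k - 1)) \<cdot>\<^sub>v u'"
proof (induction k)
  case (Suc k)
  have "krylov M u (Suc k) = z ^ k \<cdot>\<^sub>v (z \<cdot>\<^sub>v u + u') + (of_nat k * z ^ (k - 1)) \<cdot>\<^sub>v (z \<cdot>\<^sub>v u')"
    unfolding krylov_Suc Suc using M u u' eig
    by (simp add: mult_add_distrib_mat_vec[of _ n n] mult_mat_vec[OF M])
  then show ?case using u u'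
    by (cases k) (auto intro!: eq_vecI simp: algebra_simps)
qed (use u u' in \<open>auto intro!: eq_vecI\<close>)

lemma mat_exp_eigen:
  assumes M: "M \<in> carrier_mat n n" and u: "u \<in> carrier_vec n" and eig: "M *\<^sub>v u = z \<cdot>\<^sub>v u"
  shows "mat_exp n M s *\<^sub>v u = exp (z * s) \<cdot>\<^sub>v u"
  using u by (intro eq_vecI) (auto simp: mat_exp_vec[OF M u] krylov_eigen[OF M u eig] egf_power
    simp del: index_mult_mat_vec, simp add: mat_exp_def)

lemma mat_exp_int_eigen:
  assumes M: "M \<in> carrier_mat n n" and u: "u \<in> carrier_vec n" and eig: "M *\<^sub>v u = z \<cdot>\<^sub>v u"
  shows "mat_exp_int n M s *\<^sub>v u = (if z = 0 then s else (exp (z * s) - 1) / z) \<cdot>\<^sub>v u"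
proof (rule eq_vecI)
  fix i assume "i < dim_vec ((if z = 0 then s else (exp (z * s) - 1) / z) \<cdot>\<^sub>v u)"
  then have i: "i < n" using u by simp
  have kr: "(\<lambda>k. krylov M u k $ i) = (\<lambda>k. z ^ k * u $ i)"
    using i u by (simp add: krylov_eigen[OF M u eig])
  show "(mat_exp_int n M s *\<^sub>v u) $ i = ((if z = 0 then s else (exp (z * s) - 1) / z) \<cdot>\<^sub>v u) $ i"
    unfolding mat_exp_int_vec[OF M u i] kr
    using i u egf_shift_power_0[of "u $ i" s] egf_shift_power[of z "u $ i" s] by (cases "z = 0") simp_all
qed (use u in \<open>simp add: mat_exp_int_def\<close>)

text \<open>A Jordan chain of length two is not flattened by the exponential: for
  \<open>s \<noteq> 0\<close> the extra term vanishes only if \<open>u'\<close> does. This is what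
  verifies the chain hypothesis of \<open>eigenvector_of_commuting\<close>.\<close>

lemma mat_exp_chain:
  assumes M: "M \<in> carrier_mat n n" and u: "u \<in> carrier_vec n" and u': "u' \<in> carrier_vec n"
    and eig: "M *\<^sub>v u = z \<cdot>\<^sub>v u + u'" "M *\<^sub>v u' = z \<cdot>\<^sub>v u'"
  shows "mat_exp n M s *\<^sub>v u = exp (z * s) \<cdot>\<^sub>v u + (s * exp (z * s)) \<cdot>\<^sub>v u'"
proof (rule eq_vecI)
  fix i assume "i < dim_vec (exp (z * s) \<cdot>\<^sub>v u + (s * exp (z * s)) \<cdot>\<^sub>v u')"
  then have i: "i < n" using u' by simp
  have kr: "(\<lambda>k. krylov M u k $ i) = (\<lambda>k. z ^ k * u $ i + of_nat k * z ^ (k - 1) * u' $ i)"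
    using i u u' by (simp add: krylov_chain[OF M u u' eig])
  show "(mat_exp n M s *\<^sub>v u) $ i = (exp (z * s) \<cdot>\<^sub>v u + (s * exp (z * s)) \<cdot>\<^sub>v u') $ i"
    unfolding mat_exp_vec[OF M u i] kr egf_chain using i u u' by simp
qed (use u' in \<open>simp add: mat_exp_def\<close>)

section \<open>Sampled linear systems\<close>

abbreviation cvec :: "real vec \<Rightarrow> complex vec" where
  "cvec \<equiv> map_vec complex_of_real"

abbreviation cmat :: "real mat \<Rightarrow> complex mat" where
  "cmat \<equiv> map_mat complex_of_real"

lemma cvec_mult_mat:
  assumes "A \<in> carrier_mat a b" "v \<in> carrier_vec b"
  shows "cvec (A *\<^sub>v v) = cmat A *\<^sub>v cvec v"
  by (rule of_real_hom.mult_mat_vec_hom[OF assms])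

lemma scalar_prod_cvec:
  assumes "v \<in> carrier_vec n"
  shows "w \<bullet> cvec v = (\<Sum>i<n. w $ i * complex_of_real (v $ i))"
  using assms scalar_prod_sum[of "cvec v" n w] by simp

text \<open>The scalar product is bilinear, without conjugation, so over the complex numbers too the
  adjoint is the plain transpose, and left eigenvectors of \<open>A\<close> are eigenvectors of its
  transpose.\<close>

lemma scalar_prod_cvec_mult:
  assumes "A \<in> carrier_mat a b" "w \<in> carrier_vec a" "v \<in> carrier_vec b"
  shows "w \<bullet> cvec (A *\<^sub>v v) = (transpose_mat (cmat A) *\<^sub>v w) \<bullet> cvec v"
  unfolding cvec_mult_mat[OF assms(1,3)] using assms
  by (intro scalar_prod_transpose[symmetric, of _ a b]) auto

lemma has_vec_deriv_cvec:
  assumes "has_vec_deriv n x v F" "x t \<in> carrier_vec n" "v \<in> carrier_vec n" "k < n"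
  shows "((\<lambda>t. complex_of_real (x t $ k)) has_vector_derivative complex_of_real (v $ k)) F"
  using assms unfolding has_vec_deriv_def
  by (intro bounded_linear.has_vector_derivative[OF bounded_linear_of_real]) auto

lemma vec_continuous_on_cvec:
  assumes "vec_continuous_on n S x" "k < n"
  shows "continuous_on S (\<lambda>t. complex_of_real (x t $ k))"
  using assms unfolding vec_continuous_on_def by (intro continuous_on_of_real) auto

text \<open>At \<open>b\<close> only continuity is assumed: the data prescribe derivatives on
  half-open sampling intervals, and at the next switching instant the input may already have
  changed.\<close>

lemma constant_on_interval:
  fixes f :: "real \<Rightarrow> complex"
  assumes "a \<le> b" "continuous_on {a..b} f"
    and "\<And>t. t \<in> {a..<b} \<Longrightarrow> (f has_vector_derivative 0) (at t within {a..<b})"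
  shows "f b = f a"
proof (rule has_derivative_zero_unique_strong_interval[of "{a, b}" a b f])
  fix t assume t: "t \<in> {a..b} - {a, b}"
  then have "(f has_vector_derivative 0) (at t within {a<..<b})"
    by (auto intro!: has_vector_derivative_within_subset[OF assms(3)])
  then have "(f has_vector_derivative 0) (at t)"
    using t by (subst (asm) at_within_open) auto
  then show "(f has_derivative (\<lambda>h. 0)) (at t within {a..b})"
    by (auto simp: has_vector_derivative_def intro: has_derivative_at_withinI)
qed (use assms in auto)

text \<open>The function \<open>t \<mapsto> (E (b - t) w) \<bullet> x t + (\<Psi> (b - t) w) \<bullet> c\<close> is constant, where \<open>E\<close> is the
  exponential of \<open>A\<^sup>T\<close> and \<open>\<Psi>\<close> its integral.\<close>

lemma sampled_state:
  assumes A: "A \<in> carrier_mat n n" and ab: "a \<le> b" and w: "w \<in> carrier_vec n" and c: "c \<in> carrier_vec n"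
    and x: "\<And>t. t \<in> {a..b} \<Longrightarrow> x t \<in> carrier_vec n" "vec_continuous_on n {a..b} x"
    and deriv: "\<And>t. t \<in> {a..<b} \<Longrightarrow> has_vec_deriv n x (A *\<^sub>v x t + c) (at t within {a..<b})"
  defines "M \<equiv> transpose_mat (cmat A)"
  shows "w \<bullet> cvec (x b) = (mat_exp n M (of_real (b - a)) *\<^sub>v w) \<bullet> cvec (x a)
    + (mat_exp_int n M (of_real (b - a)) *\<^sub>v w) \<bullet> cvec c"
proof -
  have M: "M \<in> carrier_mat n n" using A by (simp add: M_def)
  define e where "e t = mat_exp n M (of_real (b - t)) *\<^sub>v w" for t
  define h where "h t = mat_exp_int n M (of_real (b - t)) *\<^sub>v w" for t
  have e: "e t \<in> carrier_vec n" and h: "h t \<in> carrier_vec n" for t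
    unfolding e_def h_def by (rule mult_mat_vec_carrier[OF mat_exp_carrier(1) w],
      rule mult_mat_vec_carrier[OF mat_exp_carrier(2) w])
  define f where "f t = (\<Sum>i<n. e t $ i * of_real (x t $ i)) + (\<Sum>i<n. h t $ i * of_real (c $ i))" for t
  have rev: "((\<lambda>t. g (of_real (b - t))) has_vector_derivative - g') (at t within S)"
    if "(g has_field_derivative g') (at (of_real (b - t)))" for g g' t S
  proof -
    have "((\<lambda>s. g (of_real b - s)) has_field_derivative g' * (-1)) (at (of_real t))"
      using that by (intro DERIV_chain2[of g]) (auto intro!: derivative_eq_intros)
    from has_vector_derivative_real_field[OF this] show ?thesis by simp
  qed
  have de: "((\<lambda>t. e t $ i) has_vector_derivative - (M *\<^sub>v e t) $ i) (at t within S)" if "i < n" for i t S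
    unfolding e_def by (rule rev) (rule mat_exp_derivative[OF M w that])
  have dh: "((\<lambda>t. h t $ i) has_vector_derivative - e t $ i) (at t within S)" if "i < n" for i t S
    unfolding e_def h_def by (rule rev) (rule mat_exp_int_derivative[OF M w that])
  have "f b = f a"
  proof (rule constant_on_interval[OF ab])
    show "continuous_on {a..b} f"
      unfolding f_def
      using vec_continuous_on_cvec[OF x(2)] de dh
      by (intro continuous_intros)
        (auto intro!: continuous_on_vector_derivative)
  next
    fix t assume t: "t \<in> {a..<b}"
    then have xt: "x t \<in> carrier_vec n" using x(1) by simp
    have v: "A *\<^sub>v x t + c \<in> carrier_vec n"
      using mult_mat_vec_carrier[OF A xt] c by (rule add_carrier_vec)
    have "(f has_vector_derivative
        (\<Sum>i<n. e t $ i * of_real ((A *\<^sub>v x t + c) $ i) + (- (M *\<^sub>v e t) $ i) * of_real (x t $ i))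
        + (\<Sum>i<n. h t $ i * 0 + (- e t $ i) * of_real (c $ i))) (at t within {a..<b})"
      unfolding f_def
      using has_vec_deriv_cvec[OF deriv[OF t] xt v] de dh
      by (intro has_vector_derivative_add has_vector_derivative_sum has_vector_derivative_mult
          has_vector_derivative_const) auto
    \<comment> \<open>The terms in \<open>c\<close> cancel because the derivative of
      \<open>h\<close> is \<open>- e\<close>; the terms in \<open>x t\<close> cancel by moving the
      transpose \<open>M\<close> across the scalar product.\<close>
    moreover have "(\<Sum>i<n. e t $ i * of_real ((A *\<^sub>v x t + c) $ i) + (- (M *\<^sub>v e t) $ i) * of_real (x t $ i))
        + (\<Sum>i<n. h t $ i * 0 + (- e t $ i) * of_real (c $ i)) = 0"
    proof -
      have "(\<Sum>i<n. (M *\<^sub>v e t) $ i * of_real (x t $ i)) = (M *\<^sub>v e t) \<bullet> cvec (x t)"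
        by (rule scalar_prod_cvec[OF xt, symmetric])
      also have "\<dots> = e t \<bullet> cvec (A *\<^sub>v x t)"
        unfolding M_def by (rule scalar_prod_cvec_mult[OF A e xt, symmetric])
      also have "\<dots> = (\<Sum>i<n. e t $ i * of_real ((A *\<^sub>v x t) $ i))"
        by (rule scalar_prod_cvec[OF mult_mat_vec_carrier[OF A xt]])
      finally show ?thesis
        using A c by (simp add: sum.distrib sum_negf sum_subtractf algebra_simps)
    qed
    ultimately show "(f has_vector_derivative 0) (at t within {a..<b})" by simp
  qed
  moreover have "f b = w \<bullet> cvec (x b)"
    using mat_exp_0[OF M w] x(1)[of b] ab
    by (simp add: f_def e_def h_def scalar_prod_sum[of _ n])
  moreover have "f a = e a \<bullet> cvec (x a) + h a \<bullet> cvec c"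
    using x(1)[of a] ab c by (simp add: f_def scalar_prod_sum[of _ n])
  ultimately show ?thesis by (simp add: e_def h_def)
qed

text \<open>Along a left eigenvector of \<open>A\<close> annihilated by \<open>B\<close>, every trajectory from \<open>0\<close> stays \<open>0\<close>,
  whatever the input.\<close>

lemma controllable_hautus:
  assumes A: "A \<in> carrier_mat n n" and B: "B \<in> carrier_mat n m" and ctr: "controllable n m A B"
    and w: "w \<in> carrier_vec n" and eig: "transpose_mat (cmat A) *\<^sub>v w = z \<cdot>\<^sub>v w"
    and kill: "transpose_mat (cmat B) *\<^sub>v w = 0\<^sub>v m"
  shows "w = 0\<^sub>v n"
proof -
  \<comment> \<open>Steering from 0 to an arbitrary \<open>b\<close> shows that \<open>w\<close>
    annihilates every real vector, in particular the unit vectors.\<close>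
  have "w \<bullet> cvec b = 0" if b: "b \<in> carrier_vec n" for b
  proof -
    obtain \<tau> u x where \<tau>: "\<tau> > 0"
      and car: "\<And>t. t \<in> {0..\<tau>} \<Longrightarrow> u t \<in> carrier_vec m \<and> x t \<in> carrier_vec n"
      and deriv: "\<And>t. t \<in> {0..\<tau>} \<Longrightarrow> has_vec_deriv n x (A *\<^sub>v x t + B *\<^sub>v u t) (at t within {0..\<tau>})"
      and ends: "x 0 = 0\<^sub>v n" "x \<tau> = b"
      using ctr b unfolding controllable_def
      by (metis zero_carrier_vec)
    define y where "y t = (\<Sum>i<n. w $ i * of_real (x t $ i))" for t
    have y: "y t = w \<bullet> cvec (x t)" if "t \<in> {0..\<tau>}" for t
      using car[OF that] unfolding y_def by (simp add: scalar_prod_cvec[of "x t" n])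
    have dy: "(y has_vector_derivative z * y t) (at t within {0..\<tau>})" if t: "t \<in> {0..\<tau>}" for t
    proof -
      have u: "u t \<in> carrier_vec m" and xt: "x t \<in> carrier_vec n" using car[OF t] by auto
      note Ax = mult_mat_vec_carrier[OF A xt] and Bu = mult_mat_vec_carrier[OF B u]
      note v = add_carrier_vec[OF Ax Bu]
      have "(y has_vector_derivative
          (\<Sum>i<n. w $ i * of_real ((A *\<^sub>v x t + B *\<^sub>v u t) $ i) + 0 * of_real (x t $ i))) (at t within {0..\<tau>})"
        unfolding y_def using has_vec_deriv_cvec[OF deriv[OF t] xt v]
        by (intro has_vector_derivative_sum has_vector_derivative_mult has_vector_derivative_const) auto
      also have "(\<Sum>i<n. w $ i * of_real ((A *\<^sub>v x t + B *\<^sub>v u t) $ i) + 0 * of_real (x t $ i))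
          = w \<bullet> cvec (A *\<^sub>v x t) + w \<bullet> cvec (B *\<^sub>v u t)"
        using A B unfolding scalar_prod_cvec[OF Ax] scalar_prod_cvec[OF Bu]
        by (simp add: distrib_left sum.distrib del: index_mult_mat_vec)
      also have "\<dots> = z * y t"
        unfolding scalar_prod_cvec_mult[OF A w xt] scalar_prod_cvec_mult[OF B w u] eig kill y[OF t]
        using w xt u by simp
      finally show ?thesis .
    qed
    \<comment> \<open>Integrating factor for the scalar equation \<open>y' = z y\<close> with
      \<open>y 0 = 0\<close>.\<close>
    define f where "f t = exp (- z * of_real t) * y t" for t
    have dexp: "((\<lambda>t. exp (- z * of_real t)) has_vector_derivative - z * exp (- z * of_real t)) (at t within S)" for t S
      by (rule has_vector_derivative_real_field[of "\<lambda>s. exp (- z * s)"])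
        (auto intro!: derivative_eq_intros)
    have df: "(f has_vector_derivative 0) (at t within {0..\<tau>})" if "t \<in> {0..\<tau>}" for t
      using has_vector_derivative_mult[OF dexp dy[OF that]] unfolding f_def by (simp add: algebra_simps)
    have "f \<tau> = f 0"
    proof (rule constant_on_interval)
      show "continuous_on {0..\<tau>} f" using df by (rule continuous_on_vector_derivative)
      show "(f has_vector_derivative 0) (at t within {0..<\<tau>})" if "t \<in> {0..<\<tau>}" for t
        using df[of t] that by (auto intro: has_vector_derivative_within_subset)
    qed (use \<tau> in simp)
    moreover have "f 0 = 0" using ends by (simp add: f_def y_def)
    ultimately have "y \<tau> = 0" by (simp add: f_def)
    then show ?thesis using y[of \<tau>] \<tau> ends by simp
  qed
  note orth = this
  have "w $ i = 0" if i: "i < n" for i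
  proof -
    have "cvec (unit_vec n i) = unit_vec n i" by (intro eq_vecI) (auto simp: unit_vec_def)
    then show ?thesis using orth[of "unit_vec n i"] w i by simp
  qed
  then show ?thesis using w by (intro eq_vecI) auto
qed

section \<open>The period condition and controllability of the sampled system\<close>

lemma smult_vec_cancel:
  fixes v :: "'a :: field vec"
  assumes "v \<in> carrier_vec n" "v \<noteq> 0\<^sub>v n" "a \<cdot>\<^sub>v v = b \<cdot>\<^sub>v v"
  shows "a = b"
proof -
  obtain i where "i < n" "v $ i \<noteq> 0"
    using assms(1,2) by (metis eq_vecI carrier_vecD index_zero_vec)
  then show ?thesis using arg_cong[OF assms(3), of "\<lambda>v. v $ i"] assms(1) by simp
qed

lemma eigenvalue_transposeI:
  assumes A: "A \<in> carrier_mat n n" and w: "w \<in> carrier_vec n" "w \<noteq> 0\<^sub>v n"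
    and eig: "transpose_mat A *\<^sub>v w = (z :: complex) \<cdot>\<^sub>v w"
  shows "eigenvalue A z"
proof -
  have "eigenvalue (transpose_mat A) z"
    using A w eig unfolding eigenvalue_def eigenvector_def by auto
  then show ?thesis
    using A eigenvalue_root_char_poly[of "transpose_mat A" n z] eigenvalue_root_char_poly[OF A] by simp
qed

lemma eigenvalue_cnj:
  assumes A: "A \<in> carrier_mat n n" and z: "eigenvalue (cmat A) z"
  shows "eigenvalue (cmat A) (cnj z)"
proof -
  obtain w where w: "w \<in> carrier_vec n" "w \<noteq> 0\<^sub>v n" and eig: "cmat A *\<^sub>v w = z \<cdot>\<^sub>v w"
    using z A unfolding eigenvalue_def eigenvector_def by auto
  have cA: "cmat A \<in> carrier_mat n n" using A by simp
  have "cmat A *\<^sub>v map_vec cnj w = cnj z \<cdot>\<^sub>v map_vec cnj w"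
  proof (rule eq_vecI)
    fix i assume "i < dim_vec (cnj z \<cdot>\<^sub>v map_vec cnj w)"
    then have i: "i < n" using w by simp
    have "(cmat A *\<^sub>v map_vec cnj w) $ i = cnj ((cmat A *\<^sub>v w) $ i)"
      using A w i by (subst (1 2) mat_mult_vec_index[OF cA]) auto
    then show "(cmat A *\<^sub>v map_vec cnj w) $ i = (cnj z \<cdot>\<^sub>v map_vec cnj w) $ i"
      using w i unfolding eig by simp
  qed (use A w in simp)
  moreover have "map_vec cnj w \<noteq> 0\<^sub>v n"
  proof
    assume 0: "map_vec cnj w = 0\<^sub>v n"
    have "w $ i = 0" if "i < n" for i
      using arg_cong[OF 0, of "\<lambda>v. v $ i"] that w by simp
    then show False using w by (auto simp: vec_eq_iff)
  qed
  ultimately show ?thesis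
    using A w unfolding eigenvalue_def eigenvector_def by (intro exI[of _ "map_vec cnj w"]) auto
qed

lemma admissible_period_exp_inj:
  assumes T: "admissible_period A T" and z: "eigenvalue (cmat A) z" "eigenvalue (cmat A) z'"
    and eq: "exp (z * of_real T) = exp (z' * of_real T)"
  shows "z = z'"
proof -
  have pos: "T > 0" using T by (simp add: admissible_period_def)
  obtain k :: int where k: "z * of_real T = z' * of_real T + (of_int (2 * k) * pi) * \<i>"
    using eq unfolding exp_eq by blast
  have re: "Re z * T = Re z' * T" using arg_cong[OF k, of Re] by simp
  have im: "Im (z - z') * T = 2 * pi * of_int k"
    using arg_cong[OF k, of Im] by (simp add: algebra_simps)
  have "Im (z - z') = 0"
  proof (rule ccontr)
    assume nz: "Im (z - z') \<noteq> 0"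
    \<comment> \<open>The sign of the integer is adjusted because the period condition divides by
      the absolute value of the imaginary gap.\<close>
    then have "T = 2 * pi * of_int (if Im (z - z') > 0 then k else - k) / \<bar>Im (z - z')\<bar>"
      using im by (auto simp: field_simps abs_if)
    then show False using T z nz unfolding admissible_period_def by blast
  qed
  then show ?thesis using re pos by (simp add: complex_eq_iff)
qed

text \<open>For a nonzero eigenvalue \<open>z\<close> with \<open>exp (z T) = 1\<close>, the conjugate is an eigenvalue too, and
  \<open>z\<close> and its conjugate would violate the condition on the period.\<close>

lemma admissible_period_exp_neq_1:
  assumes A: "A \<in> carrier_mat n n" and T: "admissible_period A T"
    and z: "eigenvalue (cmat A) z" "z \<noteq> 0"
  shows "exp (z * of_real T) \<noteq> 1"
proof
  assume 1: "exp (z * of_real T) = 1"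
  then have "exp (cnj z * of_real T) = 1"
    using exp_cnj[of "z * of_real T"] by simp
  then have "z = cnj z"
    using admissible_period_exp_inj[OF T z(1) eigenvalue_cnj[OF A z(1)]] 1 by simp
  then have im: "Im z = 0" by (simp add: complex_eq_iff)
  have "norm (exp (z * of_real T)) = 1" using 1 by simp
  then have "Re z * T = 0" by simp
  then show False using im z(2) T by (simp add: admissible_period_def complex_eq_iff)
qed

text \<open>Sampling preserves controllability, in the form of the Hautus test. Under the period
  condition an eigenvector of the exponential is one of the transpose of \<open>A\<close> itself; on
  it the integrated exponential acts as a nonzero scalar, which reduces the claim to the
  continuous-time test.\<close>

lemma sampled_hautus:
  assumes A: "A \<in> carrier_mat n n" and B: "B \<in> carrier_mat n m" and ctr: "controllable n m A B"
    and T: "admissible_period A T"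
  defines "M \<equiv> transpose_mat (cmat A)"
  assumes w: "w \<in> carrier_vec n" and eig: "mat_exp n M (of_real T) *\<^sub>v w = l \<cdot>\<^sub>v w"
    and kill: "transpose_mat (cmat B) *\<^sub>v (mat_exp_int n M (of_real T) *\<^sub>v w) = 0\<^sub>v m"
  shows "w = 0\<^sub>v n"
proof (rule ccontr)
  assume w0: "w \<noteq> 0\<^sub>v n"
  have cA: "cmat A \<in> carrier_mat n n" using A by simp
  have M: "M \<in> carrier_mat n n" using A by (simp add: M_def)
  have T0: "T > 0" using T by (simp add: admissible_period_def)
  have ev: "eigenvalue (cmat A) z" if "u \<in> carrier_vec n" "u \<noteq> 0\<^sub>v n" "M *\<^sub>v u = z \<cdot>\<^sub>v u" for z u
    using eigenvalue_transposeI[OF cA] that unfolding M_def by blast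
  have exp_l: "exp (z * of_real T) = l"
    if "u \<in> carrier_vec n" "u \<noteq> 0\<^sub>v n" "M *\<^sub>v u = z \<cdot>\<^sub>v u" "mat_exp n M (of_real T) *\<^sub>v u = l \<cdot>\<^sub>v u" for z u
    using smult_vec_cancel[OF that(1,2)] mat_exp_eigen[OF M that(1,3)] that(4) by simp
  obtain z where z: "M *\<^sub>v w = z \<cdot>\<^sub>v w"
  proof (rule eigenvector_of_commuting[OF mat_exp_carrier(1) M w w0 mat_exp_commute[OF M] eig])
    show "z = z'" if "u \<in> carrier_vec n" "u \<noteq> 0\<^sub>v n" "u' \<in> carrier_vec n" "u' \<noteq> 0\<^sub>v n"
      "M *\<^sub>v u = z \<cdot>\<^sub>v u" "M *\<^sub>v u' = z' \<cdot>\<^sub>v u'"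
      "mat_exp n M (of_real T) *\<^sub>v u = l \<cdot>\<^sub>v u" "mat_exp n M (of_real T) *\<^sub>v u' = l \<cdot>\<^sub>v u'" for z z' u u'
      using admissible_period_exp_inj[OF T ev[OF that(1,2,5)] ev[OF that(3,4,6)]]
        exp_l[OF that(1,2,5,7)] exp_l[OF that(3,4,6,8)] by simp
  next
    show "u' = 0\<^sub>v n" if u: "u \<in> carrier_vec n" and u': "u' \<in> carrier_vec n"
      and chain: "M *\<^sub>v u = z \<cdot>\<^sub>v u + u'" "M *\<^sub>v u' = z \<cdot>\<^sub>v u'"
      and l: "mat_exp n M (of_real T) *\<^sub>v u = l \<cdot>\<^sub>v u" "mat_exp n M (of_real T) *\<^sub>v u' = l \<cdot>\<^sub>v u'" for z u u'
    proof (rule ccontr)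
      assume "u' \<noteq> 0\<^sub>v n"
      then have l': "exp (z * of_real T) = l" using exp_l[OF u' _ chain(2) l(2)] by blast
      have eq: "l \<cdot>\<^sub>v u = l \<cdot>\<^sub>v u + (of_real T * l) \<cdot>\<^sub>v u'"
        using mat_exp_chain[OF M u u' chain, of "of_real T"] l(1) l' by simp
      have "l \<noteq> 0" using l'[symmetric] by simp
      have "u' $ i = 0" if "i < n" for i
        using arg_cong[OF eq, of "\<lambda>v. v $ i"] that u u' T0 \<open>l \<noteq> 0\<close> by simp
      then show False using \<open>u' \<noteq> 0\<^sub>v n\<close> u' by (auto simp: vec_eq_iff)
    qed
  qed (use that in blast)
  \<comment> \<open>The integral of \<open>exp (z s)\<close> over \<open>[0, T]\<close>, by which
    the integrated exponential acts on \<open>w\<close>. It could vanish only for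
    \<open>z \<noteq> 0\<close> with \<open>exp (z T) = 1\<close>, which the period
    excludes.\<close>
  define c where "c = (if z = 0 then complex_of_real T else (exp (z * of_real T) - 1) / z)"
  have c0: "c \<noteq> 0"
    using T0 admissible_period_exp_neq_1[OF A T ev[OF w w0 z]] by (simp add: c_def)
  have Bt: "transpose_mat (cmat B) \<in> carrier_mat m n" using B by simp
  have "c \<cdot>\<^sub>v (transpose_mat (cmat B) *\<^sub>v w) = 0\<^sub>v m"
    using kill unfolding mat_exp_int_eigen[OF M w z] c_def[symmetric] mult_mat_vec[OF Bt w] .
  then have "transpose_mat (cmat B) *\<^sub>v w = 0\<^sub>v m"
    using c0 B by (auto simp: vec_eq_iff)
  then show False using controllable_hautus[OF A B ctr w z[unfolded M_def]] w0 by blast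
qed

section \<open>Full row rank of the Hankel matrix as absence of linear relations\<close>

lemma sum_blocks:
  fixes f :: "nat \<Rightarrow> 'a :: comm_monoid_add"
  shows "(\<Sum>t<L * m. f t) = (\<Sum>i<L. \<Sum>q<m. f (i * m + q))"
proof -
  have "(\<Sum>q<m. f (i * m + q)) = sum f {i * m..<i * m + m}" for i
    using sum.shift_bounds_nat_ivl[of f 0 "i * m" m] by (simp add: lessThan_atLeast0 add.commute)
  then show ?thesis using sum.nat_group[of f m L] by simp
qed

text \<open>Some \<open>r\<close> of the columns are independent and form an invertible square
  matrix \<open>Q\<close>; a left kernel vector of \<open>H\<close> is orthogonal to all of
  them.\<close>

lemma full_row_rank_left_kernel:
  fixes H :: "'a :: field mat"
  assumes H: "H \<in> carrier_mat r c" and rank: "vec_space.rank r H = r"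
    and h: "h \<in> carrier_vec r" "transpose_mat H *\<^sub>v h = 0\<^sub>v c"
  shows "h = 0\<^sub>v r"
proof -
  interpret vec_space "TYPE('a)" r .
  obtain S where S: "finite S" "maximal S (\<lambda>T. T \<subseteq> set (cols H) \<and> lin_indpt T)"
    using maximal_exists_superset[of "set (cols H)" "\<lambda>T. T \<subseteq> set (cols H) \<and> lin_indpt T" "{}"]
      finite_lin_indpt2[of "{}"] by auto
  have card: "card S = r" using rank_card_indpt[OF H S(2)] rank by simp
  have sub: "S \<subseteq> set (cols H)" and ind: "lin_indpt S" using S(2) by (auto simp: maximal_def)
  obtain vs where vs: "set vs = S" "distinct vs" using finite_distinct_list[OF S(1)] by blast
  have len: "length vs = r" using vs card distinct_card by fastforce
  have car: "set vs \<subseteq> carrier_vec r" using sub vs cols_dim H by blast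
  define Q where "Q = mat_of_cols r vs"
  have Q: "Q \<in> carrier_mat r r" using len by (simp add: Q_def carrier_matI)
  have cols: "cols Q = vs" unfolding Q_def using car by simp
  have "rank Q = r" using lin_indpt_full_rank[OF Q] cols vs ind by simp
  then have "det Q \<noteq> 0" using det_rank_iff[OF Q] by simp
  then have dt: "det (transpose_mat Q) \<noteq> 0" using det_transpose[OF Q] by simp
  have "transpose_mat Q *\<^sub>v h = 0\<^sub>v r"
  proof (rule eq_vecI)
    fix i assume "i < dim_vec (0\<^sub>v r :: 'a vec)"
    then have i: "i < r" by simp
    have "vs ! i \<in> set (cols H)" using sub vs len i nth_mem by blast
    then obtain j where j: "j < c" "col H j = vs ! i"
      using H by (auto simp: cols_def)
    have "col Q i = vs ! i" using cols i Q by (metis cols_nth carrier_matD(2))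
    then have "(transpose_mat Q *\<^sub>v h) $ i = (transpose_mat H *\<^sub>v h) $ j"
      using i j Q H by simp
    then show "(transpose_mat Q *\<^sub>v h) $ i = 0\<^sub>v r $ i" using h i j by simp
  qed (use Q in simp)
  then show ?thesis
    using det_0_iff_vec_prod_zero[of "transpose_mat Q" r] Q dt h by auto
qed

text \<open>A relation that holds at every shift \<open>j\<close> is a left kernel vector of the
  Hankel matrix. The coefficients are complex because the sampled dynamics is; the inputs are real,
  so real and imaginary parts are relations on their own.\<close>

lemma hankel_relation_trivial:
  assumes rank: "vec_space.rank (m * L) (block_hankel m L c \<mu>) = m * L"
    and rel: "\<And>j. j < c \<Longrightarrow> (\<Sum>i<L. \<Sum>q<m. a i q * complex_of_real (\<mu> (i + j) $ q)) = 0"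
    and iq: "i < L" "q < m"
  shows "a i q = 0"
proof -
  define H where "H = block_hankel m L c \<mu>"
  have H: "H \<in> carrier_mat (m * L) c" by (simp add: H_def block_hankel_def)
  have real: "b i q = 0"
    if rel: "\<And>j. j < c \<Longrightarrow> (\<Sum>i<L. \<Sum>q<m. b i q * \<mu> (i + j) $ q) = 0" for b :: "nat \<Rightarrow> nat \<Rightarrow> real"
  proof -
    define h where "h = vec (m * L) (\<lambda>t. b (t div m) (t mod m))"
    have h: "h \<in> carrier_vec (m * L)" by (simp add: h_def)
    have idx: "i * m + q < m * L" if "i < L" "q < m" for i q
    proof -
      have "i * m + q < Suc i * m" using that by simp
      also have "\<dots> \<le> L * m" using that by (intro mult_right_mono) auto
      finally show ?thesis by (simp add: mult.commute)
    qed
    have "transpose_mat H *\<^sub>v h = 0\<^sub>v c"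
    proof (rule eq_vecI)
      fix j assume "j < dim_vec (0\<^sub>v c :: real vec)"
      then have j: "j < c" by simp
      have "(transpose_mat H *\<^sub>v h) $ j = (\<Sum>t<L * m. H $$ (t, j) * h $ t)"
        using H h j by (subst mat_mult_vec_index[of _ c "m * L"]) (auto simp: mult.commute)
      also have "\<dots> = (\<Sum>i<L. \<Sum>q<m. b i q * \<mu> (i + j) $ q)"
        unfolding sum_blocks using idx j
        by (intro sum.cong refl) (auto simp: H_def block_hankel_def h_def)
      finally show "(transpose_mat H *\<^sub>v h) $ j = 0\<^sub>v c $ j" using rel[OF j] j by simp
    qed (use H in simp)
    then have "h = 0\<^sub>v (m * L)" using full_row_rank_left_kernel[OF H _ h] rank by (simp add: H_def)
    then have "h $ (i * m + q) = 0" using idx[OF iq] by simp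
    then show ?thesis using idx[OF iq] iq by (simp add: h_def)
  qed
  have "Re (a i q) = 0"
    using arg_cong[OF rel, of _ Re] by (intro real[of "\<lambda>i q. Re (a i q)"]) simp
  moreover have "Im (a i q) = 0"
    using arg_cong[OF rel, of _ Im] by (intro real[of "\<lambda>i q. Im (a i q)"]) simp
  ultimately show ?thesis by (simp add: complex_eq_iff)
qed

section \<open>Persistently excited data\<close>

lemma sample_time_less:
  assumes "T > 0" "j < M"
  shows "real j * T \<ge> 0" "real j * T < real M * T"
  using assms by auto

lemma data_sample_step:
  assumes A: "A \<in> carrier_mat n n" and B: "B \<in> carrier_mat n m"
    and T: "T > 0" and data: "input_state_data n m A B M T u x"
    and pc: "\<And>j t. j < M \<Longrightarrow> t \<in> {0..<T} \<Longrightarrow> u (t + real j * T) = \<mu> j"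
    and mu: "\<And>j. j < M \<Longrightarrow> \<mu> j \<in> carrier_vec m"
    and j: "Suc j < M" and y: "y \<in> carrier_vec n"
  defines "At \<equiv> transpose_mat (cmat A)"
  shows "y \<bullet> cvec (x (real (Suc j) * T)) = (mat_exp n At (of_real T) *\<^sub>v y) \<bullet> cvec (x (real j * T))
    + (transpose_mat (cmat B) *\<^sub>v (mat_exp_int n At (of_real T) *\<^sub>v y)) \<bullet> cvec (\<mu> j)"
proof -
  let ?a = "real j * T" and ?b = "real (Suc j) * T"
  have ab: "?a \<le> ?b" and a0: "?a \<ge> 0" using T by (simp_all add: mult_right_mono)
  \<comment> \<open>Because \<open>Suc j < M\<close>, the right endpoint still lies in the half-open
    data interval, so continuity is available there.\<close>
  have b: "?b < real M * T" using T j by (intro mult_strict_right_mono) auto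
  have sub: "{?a..?b} \<subseteq> {0..<real M * T}" using a0 b by auto
  have mj: "\<mu> j \<in> carrier_vec m" using mu j by simp
  have u: "u t = \<mu> j" if "t \<in> {?a..<?b}" for t
    using pc[of j "t - ?a"] that j by (simp add: algebra_simps)
  have "y \<bullet> cvec (x ?b) = (mat_exp n At (of_real (?b - ?a)) *\<^sub>v y) \<bullet> cvec (x ?a)
    + (mat_exp_int n At (of_real (?b - ?a)) *\<^sub>v y) \<bullet> cvec (B *\<^sub>v \<mu> j)"
    unfolding At_def
  proof (rule sampled_state[OF A ab y])
    show "B *\<^sub>v \<mu> j \<in> carrier_vec n" using mult_mat_vec_carrier[OF B mj] .
    show "x t \<in> carrier_vec n" if "t \<in> {?a..?b}" for t
      using data sub that unfolding input_state_data_def by blast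
    show "vec_continuous_on n {?a..?b} x"
      using data continuous_on_subset[OF _ sub] unfolding input_state_data_def vec_continuous_on_def by blast
    show "has_vec_deriv n x (A *\<^sub>v x t + B *\<^sub>v \<mu> j) (at t within {?a..<?b})" if t: "t \<in> {?a..<?b}" for t
      using data j t u[OF t] unfolding input_state_data_def by (metis Suc_lessD)
  qed
  moreover have len: "?b - ?a = T" by (simp add: algebra_simps)
  moreover have "mat_exp_int n At (of_real T) *\<^sub>v y \<in> carrier_vec n"
    by (rule mult_mat_vec_carrier[OF mat_exp_carrier(2) y])
  ultimately show ?thesis using scalar_prod_cvec_mult[OF B _ mj] unfolding len by metis
qed

text \<open>Applying the annihilating polynomial of \<open>w\<close> under the sampled dynamics to \<open>n + 1\<close>
  consecutive samples eliminates the state and leaves a relation between inputs, whose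
  coefficients vanish by persistency of excitation.\<close>

lemma data_left_kernel_trivial:
  assumes A: "A \<in> carrier_mat n n" and B: "B \<in> carrier_mat n m"
    and ctr: "controllable n m A B"
    and pe: "pcpe m A (n + 1) M T u" and data: "input_state_data n m A B M T u x"
    and v: "v \<in> carrier_vec n" and v': "v' \<in> carrier_vec m"
    and rel: "\<And>j. j < M \<Longrightarrow> v \<bullet> x (real j * T) + v' \<bullet> u (real j * T) = 0"
  shows "v = 0\<^sub>v n" "v' = 0\<^sub>v m"
proof -
  have adm: "admissible_period A T" using pe by (simp add: pcpe_def)
  then have T: "T > 0" by (simp add: admissible_period_def)
  obtain \<mu> where mu: "\<And>j. j < M \<Longrightarrow> \<mu> j \<in> carrier_vec m"
    and pc: "\<And>j t. j < M \<Longrightarrow> t \<in> {0..<T} \<Longrightarrow> u (t + real j * T) = \<mu> j"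
    and rank: "vec_space.rank (m * (n + 1)) (block_hankel m (n + 1) (M + 1 - (n + 1)) \<mu>) = m * (n + 1)"
    using pe unfolding pcpe_def by blast
  define At where "At = transpose_mat (cmat A)"
  define F where "F = mat_exp n At (of_real T)"
  define G where "G = transpose_mat (cmat B) * mat_exp_int n At (of_real T)"
  have F: "F \<in> carrier_mat n n" by (simp add: F_def)
  have Bt: "transpose_mat (cmat B) \<in> carrier_mat m n" using B by simp
  have G: "G \<in> carrier_mat m n" unfolding G_def by (rule mult_carrier_mat[OF Bt mat_exp_carrier(2)])
  have Gv: "G *\<^sub>v y = transpose_mat (cmat B) *\<^sub>v (mat_exp_int n At (of_real T) *\<^sub>v y)"
    if "y \<in> carrier_vec n" for y
    unfolding G_def by (rule assoc_mult_mat_vec[OF Bt mat_exp_carrier(2) that])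
  define \<xi> where "\<xi> j = cvec (x (real j * T))" for j
  define \<nu> where "\<nu> j = cvec (\<mu> j)" for j
  have xc: "x (real j * T) \<in> carrier_vec n" if "j < M" for j
    using data sample_time_less[OF T that] unfolding input_state_data_def by simp
  have step: "y \<bullet> \<xi> (Suc j) = (F *\<^sub>v y) \<bullet> \<xi> j + (G *\<^sub>v y) \<bullet> \<nu> j"
    if "Suc j < M" "y \<in> carrier_vec n" for j y
    using data_sample_step[OF A B T data pc mu that] Gv[OF that(2)]
    by (simp add: \<xi>_def \<nu>_def F_def At_def del: of_nat_Suc)
  \<comment> \<open>Dual form of variation of constants: the test vector moves back through the
    dynamics instead of the state moving forward, so the state is met only by Krylov vectors under
    \<open>F\<close>.\<close>
  have iter: "y \<bullet> \<xi> (j + k) = krylov F y k \<bullet> \<xi> j + (\<Sum>i<k. (G *\<^sub>v krylov F y (k - Suc i)) \<bullet> \<nu> (i + j))"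
    if "j + k < M" "y \<in> carrier_vec n" for j k y
    using that
  proof (induction k arbitrary: y)
    case (Suc k)
    have Fy: "F *\<^sub>v y \<in> carrier_vec n" using mult_mat_vec_carrier[OF F Suc.prems(2)] .
    have "y \<bullet> \<xi> (j + Suc k) = (F *\<^sub>v y) \<bullet> \<xi> (j + k) + (G *\<^sub>v y) \<bullet> \<nu> (j + k)"
      using step[of "j + k" y] Suc.prems by simp
    also have "(F *\<^sub>v y) \<bullet> \<xi> (j + k) = krylov F y (Suc k) \<bullet> \<xi> j
        + (\<Sum>i<k. (G *\<^sub>v krylov F y (Suc (k - Suc i))) \<bullet> \<nu> (i + j))"
      using Suc.IH[OF _ Fy] Suc.prems by (simp add: krylov_Suc')
    also have "(\<Sum>i<k. (G *\<^sub>v krylov F y (Suc (k - Suc i))) \<bullet> \<nu> (i + j)) =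
        (\<Sum>i<k. (G *\<^sub>v krylov F y (k - i)) \<bullet> \<nu> (i + j))"
      by (intro sum.cong refl) (simp add: Suc_diff_Suc)
    finally show ?case by (simp add: add.commute)
  qed simp
  define w where "w = cvec v"
  define w' where "w' = cvec v'"
  have w: "w \<in> carrier_vec n" and w': "w' \<in> carrier_vec m" using v v' by (simp_all add: w_def w'_def)
  have wrel: "w \<bullet> \<xi> j = - (w' \<bullet> \<nu> j)" if j: "j < M" for j
  proof -
    have "u (real j * T) = \<mu> j" using pc[OF j, of 0] T by simp
    then have "v \<bullet> x (real j * T) = - (v' \<bullet> \<mu> j)" using rel[OF j] by simp
    then have "complex_of_real (v \<bullet> x (real j * T)) = - complex_of_real (v' \<bullet> \<mu> j)" by simp
    then show ?thesis
      using xc[OF j] mu[OF j] v v'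
      by (simp add: w_def w'_def \<xi>_def \<nu>_def scalar_prod_cvec[of _ n] scalar_prod_cvec[of _ m]
          scalar_prod_sum[of _ n] scalar_prod_sum[of _ m])
  qed
  obtain p where p: "p \<noteq> 0" "degree p \<le> n" "poly_apply p F w = 0\<^sub>v n"
    using annihilating_poly_exists[OF F w] by metis
  define d where "d = degree p"
  define a where "a k = coeff p k" for k
  define h where "h l = G *\<^sub>v krylov F w l" for l
  have h: "h l \<in> carrier_vec m" for l
    unfolding h_def using mult_mat_vec_carrier[OF G krylov_carrier[OF F w]] .
  have d: "d \<le> n" and ad: "a d \<noteq> 0" using p by (simp_all add: d_def a_def)
  \<comment> \<open>The coefficient of component \<open>q\<close> of input number
    \<open>i + j\<close> once the relation at sample \<open>j + k\<close> has been weighted by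
    \<open>a k\<close> and rewritten by \<open>iter\<close>.\<close>
  define c where "c i q = a i * w' $ q + (\<Sum>k\<le>n. if i < k then a k * h (k - Suc i) $ q else 0)" for i q
  have c: "c i q = 0" if "i < n + 1" "q < m" for i q
  proof (rule hankel_relation_trivial[OF rank _ that])
    fix j assume "j < M + 1 - (n + 1)"
    then have j: "j + n < M" by simp
    have nu: "y \<bullet> \<nu> (i + j) = (\<Sum>q<m. y $ q * complex_of_real (\<mu> (i + j) $ q))" if "i \<le> n" for i y
      unfolding \<nu>_def using scalar_prod_cvec[OF mu] j that by simp
    have "0 = (\<Sum>k\<le>n. a k * (w \<bullet> \<xi> (j + k) + w' \<bullet> \<nu> (k + j)))"
      using j wrel by (intro sum.neutral[symmetric]) (simp add: add.commute)
    also have "\<dots> = (\<Sum>k\<le>n. a k * (krylov F w k \<bullet> \<xi> j)) + ((\<Sum>k\<le>n. a k * (w' \<bullet> \<nu> (k + j)))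
        + (\<Sum>k\<le>n. a k * (\<Sum>i<k. h (k - Suc i) \<bullet> \<nu> (i + j))))"
      unfolding sum.distrib[symmetric]
    proof (intro sum.cong refl)
      fix k assume "k \<in> {..n}"
      then have "w \<bullet> \<xi> (j + k) = krylov F w k \<bullet> \<xi> j + (\<Sum>i<k. h (k - Suc i) \<bullet> \<nu> (i + j))"
        using iter[of j k w] j w by (simp add: h_def)
      then show "a k * (w \<bullet> \<xi> (j + k) + w' \<bullet> \<nu> (k + j)) = a k * (krylov F w k \<bullet> \<xi> j)
          + (a k * (w' \<bullet> \<nu> (k + j)) + a k * (\<Sum>i<k. h (k - Suc i) \<bullet> \<nu> (i + j)))"
        by (simp add: distrib_left)
    qed
    \<comment> \<open>The state enters only through \<open>p(F) w\<close>, which is zero by the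
      choice of \<open>p\<close>.\<close>
    also have "(\<Sum>k\<le>n. a k * (krylov F w k \<bullet> \<xi> j)) = 0"
    proof -
      have xj: "\<xi> j \<in> carrier_vec n" using xc[of j] j by (simp add: \<xi>_def)
      have "(\<Sum>k\<le>n. a k * (krylov F w k \<bullet> \<xi> j)) = (\<Sum>k\<le>n. coeff p k * (\<xi> j \<bullet> krylov F w k))"
        using comm_scalar_prod[OF xj krylov_carrier[OF F w]] by (simp add: a_def)
      also have "\<dots> = \<xi> j \<bullet> poly_apply p F w" by (rule poly_apply_scalar_prod[OF F w p(2), symmetric])
      finally show ?thesis using p(3) xj by simp
    qed
    \<comment> \<open>The triangular sum is padded with zeros to a square one, so that the order of
      summation can be exchanged.\<close>
    also have "(\<Sum>k\<le>n. a k * (\<Sum>i<k. h (k - Suc i) \<bullet> \<nu> (i + j))) =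
        (\<Sum>k\<le>n. \<Sum>i\<le>n. if i < k then a k * (h (k - Suc i) \<bullet> \<nu> (i + j)) else 0)"
    proof (intro sum.cong refl)
      fix k assume "k \<in> {..n}"
      then have "{..n} \<inter> {i. i < k} = {..<k}" by auto
      then show "a k * (\<Sum>i<k. h (k - Suc i) \<bullet> \<nu> (i + j)) =
          (\<Sum>i\<le>n. if i < k then a k * (h (k - Suc i) \<bullet> \<nu> (i + j)) else 0)"
        by (simp add: sum.If_cases sum_distrib_left)
    qed
    also have "\<dots> = (\<Sum>i\<le>n. \<Sum>k\<le>n. if i < k then a k * (h (k - Suc i) \<bullet> \<nu> (i + j)) else 0)"
      by (rule sum.swap)
    also have "0 + ((\<Sum>k\<le>n. a k * (w' \<bullet> \<nu> (k + j))) + \<dots>) =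
        (\<Sum>i\<le>n. \<Sum>q<m. c i q * complex_of_real (\<mu> (i + j) $ q))"
      unfolding add_0 sum.distrib[symmetric]
    proof (intro sum.cong refl)
      fix i assume "i \<in> {..n}"
      then have i: "i \<le> n" by simp
      have "(\<Sum>q<m. c i q * complex_of_real (\<mu> (i + j) $ q)) = a i * (w' \<bullet> \<nu> (i + j))
          + (\<Sum>q<m. \<Sum>k\<le>n. if i < k then a k * (h (k - Suc i) $ q * complex_of_real (\<mu> (i + j) $ q)) else 0)"
      proof -
        have "c i q * r = a i * (w' $ q * r) + (\<Sum>k\<le>n. if i < k then a k * (h (k - Suc i) $ q * r) else 0)" for q r
          unfolding c_def distrib_right sum_distrib_right mult.assoc
          by (intro arg_cong2[of _ _ _ _ "(+)"] sum.cong refl) simp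
        then show ?thesis unfolding nu[OF i] by (simp add: sum.distrib sum_distrib_left)
      qed
      also have "(\<Sum>q<m. \<Sum>k\<le>n. if i < k then a k * (h (k - Suc i) $ q * complex_of_real (\<mu> (i + j) $ q)) else 0)
          = (\<Sum>k\<le>n. if i < k then a k * (h (k - Suc i) \<bullet> \<nu> (i + j)) else 0)"
        unfolding nu[OF i] by (subst sum.swap) (intro sum.cong refl, simp add: sum_distrib_left)
      finally show "a i * (w' \<bullet> \<nu> (i + j)) + (\<Sum>k\<le>n. if i < k then a k * (h (k - Suc i) \<bullet> \<nu> (i + j)) else 0)
          = (\<Sum>q<m. c i q * complex_of_real (\<mu> (i + j) $ q))" by simp
    qed
    finally show "(\<Sum>i<n + 1. \<Sum>q<m. c i q * complex_of_real (\<mu> (i + j) $ q)) = 0"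
      by (simp add: lessThan_Suc_atMost)
  qed
  have a_high: "a k = 0" if "k > d" for k using that by (simp add: a_def d_def coeff_eq_0)
  \<comment> \<open>At offset \<open>d\<close>, the degree of \<open>p\<close>, every term with an
    \<open>h\<close> carries a coefficient above the degree, so only \<open>a d * w' $ q\<close> is
    left.\<close>
  have w'0: "w' $ q = 0" if "q < m" for q
  proof -
    have "(\<Sum>k\<le>n. if d < k then a k * h (k - Suc d) $ q else 0) = 0"
      by (rule sum.neutral) (simp add: a_high)
    then show ?thesis using c[of d q] d ad that by (simp add: c_def)
  qed
  \<comment> \<open>Strong induction from the highest offsets down: at offset
    \<open>d - Suc l\<close> the indices \<open>k > d\<close> have zero coefficient, those below
    \<open>d\<close> lead to an \<open>h\<close> with index less than \<open>l\<close>, and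
    \<open>k = d\<close> isolates \<open>a d * h l $ q\<close>.\<close>
  have h0: "h l $ q = 0" if "l < d" "q < m" for l q
    using that(1)
  proof (induction l rule: less_induct)
    case (less l)
    define i where "i = d - Suc l"
    have i: "i < n + 1" "i < d" "d - Suc i = l" using less.prems d by (auto simp: i_def)
    have "(\<Sum>k\<le>n. if i < k then a k * h (k - Suc i) $ q else 0) = (\<Sum>k\<in>{d}. a d * h l $ q)"
    proof (rule sum.mono_neutral_cong_right)
      show "\<forall>k\<in>{..n} - {d}. (if i < k then a k * h (k - Suc i) $ q else 0) = 0"
      proof
        fix k assume k: "k \<in> {..n} - {d}"
        show "(if i < k then a k * h (k - Suc i) $ q else 0) = 0"
        proof (cases "k > d")
          case False
          then have "k - Suc i < l" if "i < k" using k i that by auto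
          then show ?thesis using less by simp
        qed (simp add: a_high)
      qed
    qed (use d i in auto)
    then have "a d * h l $ q = 0" using c[OF i(1) that(2)] w'0[OF that(2)] by (simp add: c_def)
    then show ?case using ad by simp
  qed
  have "w = 0\<^sub>v n"
  proof (rule ccontr)
    assume w0: "w \<noteq> 0\<^sub>v n"
    \<comment> \<open>The rows of \<open>G\<close> kill the Krylov vectors of index below the degree
      of \<open>p\<close>, which is what the extraction of an eigenvector requires.\<close>
    obtain z y where y: "y \<in> carrier_vec n" "y \<noteq> 0\<^sub>v n" "F *\<^sub>v y = z \<cdot>\<^sub>v y"
      and kill: "\<And>b. b \<in> row G ` {..<m} \<Longrightarrow> b \<bullet> y = 0"
    proof (rule eigenvector_in_krylov_kernel[OF F w w0 p(1,3), of "row G ` {..<m}"])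
      show "b \<bullet> krylov F w k = 0" if "b \<in> row G ` {..<m}" "k < degree p" for b k
        using that h0[of k] G by (auto simp: h_def d_def)
    qed (use that in blast)
    have "G *\<^sub>v y = 0\<^sub>v m" using kill G by (intro eq_vecI) auto
    then show False
      using sampled_hautus[OF A B ctr adm y(1), of z] y Gv[OF y(1)] by (simp add: F_def At_def)
  qed
  then show "v = 0\<^sub>v n" using v by (auto simp: w_def vec_eq_iff)
  show "v' = 0\<^sub>v m" using w'0 v' by (intro eq_vecI) (auto simp: w'_def)
qed

text \<open>The column blocks of a right inverse of the stacked data. \<open>Rx\<close> reproduces
  the state with zero input and \<open>Ru\<close> the input with zero state, so both can later be
  prescribed independently.\<close>

lemma data_right_inverse:
  assumes A: "A \<in> carrier_mat n n" and B: "B \<in> carrier_mat n m"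
    and ctr: "controllable n m A B"
    and pe: "pcpe m A (n + 1) M T u" and data: "input_state_data n m A B M T u x"
  defines "X \<equiv> data_mat n M T x 0" and "U \<equiv> data_mat m M T u 0"
  obtains Rx Ru where "Rx \<in> carrier_mat M n" "Ru \<in> carrier_mat M m"
    "X * Rx = 1\<^sub>m n" "X * Ru = 0\<^sub>m n m" "U * Rx = 0\<^sub>m m n" "U * Ru = 1\<^sub>m m"
proof -
  have T: "T > 0" using pe by (simp add: pcpe_def admissible_period_def)
  have X: "X \<in> carrier_mat n M" and U: "U \<in> carrier_mat m M"
    by (simp_all add: X_def U_def data_mat_def)
  define R where "R = X @\<^sub>r U"
  have R: "R \<in> carrier_mat (n + m) M" unfolding R_def using X U by simp
  have xu: "x (real j * T) \<in> carrier_vec n" "u (real j * T) \<in> carrier_vec m" if "j < M" for j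
    using data sample_time_less[OF T that] unfolding input_state_data_def by simp_all
  have cX: "col X j = x (real j * T)" and cU: "col U j = u (real j * T)" if "j < M" for j
    using xu[OF that] that by (auto intro!: eq_vecI simp: X_def U_def data_mat_def)
  obtain S where S: "S \<in> carrier_mat M (n + m)" "R * S = 1\<^sub>m (n + m)"
  proof (rule right_inverse_of_trivial_left_kernel[OF R])
    fix v assume v: "v \<in> carrier_vec (n + m)" and 0: "transpose_mat R *\<^sub>v v = 0\<^sub>v M"
    define v1 where "v1 = vec_first v n"
    define v2 where "v2 = vec_last v m"
    have vv: "v = v1 @\<^sub>v v2" using v by (simp add: v1_def v2_def)
    have c: "v1 \<in> carrier_vec n" "v2 \<in> carrier_vec m" by (simp_all add: v1_def v2_def)
    have rel: "v1 \<bullet> x (real j * T) + v2 \<bullet> u (real j * T) = 0" if j: "j < M" for j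
    proof -
      have "col R j = col X j @\<^sub>v col U j"
        using X U j by (intro eq_vecI) (auto simp: R_def append_rows_def)
      then have "(transpose_mat R *\<^sub>v v) $ j = col X j \<bullet> v1 + col U j \<bullet> v2"
        using R X U j c by (simp add: vv scalar_prod_append[of _ n _ m])
      then show ?thesis
        using 0 j c xu[OF j] comm_scalar_prod[of v1 n] comm_scalar_prod[of v2 m] by (simp add: cX cU)
    qed
    show "v = 0\<^sub>v (n + m)"
      using data_left_kernel_trivial[OF A B ctr pe data c rel] unfolding vv
      by (auto intro!: eq_vecI)
  qed (use that in blast)
  define Rx where "Rx = mat M n (\<lambda>(i, j). S $$ (i, j))"
  define Ru where "Ru = mat M m (\<lambda>(i, j). S $$ (i, n + j))"
  have Rx: "Rx \<in> carrier_mat M n" and Ru: "Ru \<in> carrier_mat M m" by (simp_all add: Rx_def Ru_def)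
  have colx: "col Rx j = col S j" if "j < n" for j
    using that S by (intro eq_vecI) (auto simp: Rx_def)
  have colu: "col Ru j = col S (n + j)" if "j < m" for j
    using that S by (intro eq_vecI) (auto simp: Ru_def)
  have rowx: "row R i = row X i" if "i < n" for i
    using that X U by (intro eq_vecI) (auto simp: R_def append_rows_def)
  have rowu: "row R (n + i) = row U i" if "i < m" for i
    using that X U by (intro eq_vecI) (auto simp: R_def append_rows_def)
  have RS: "row R i \<bullet> col S j = (if i = j then 1 else 0)" if "i < n + m" "j < n + m" for i j
    using arg_cong[OF S(2), of "\<lambda>K. K $$ (i, j)"] that R S(1) by simp
  show thesis
  proof (rule that[OF Rx Ru])
    show "X * Rx = 1\<^sub>m n" using X Rx RS by (intro eq_matI) (auto simp: colx rowx[symmetric])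
    show "X * Ru = 0\<^sub>m n m" using X Ru RS by (intro eq_matI) (auto simp: colu rowx[symmetric])
    show "U * Rx = 0\<^sub>m m n" using U Rx RS by (intro eq_matI) (auto simp: colx rowu[symmetric])
    show "U * Ru = 1\<^sub>m m" using U Ru RS by (intro eq_matI) (auto simp: colu rowu[symmetric])
  qed
qed

lemma data_derivative:
  assumes A: "A \<in> carrier_mat n n" and B: "B \<in> carrier_mat n m" and T: "T > 0"
    and data: "input_state_data n m A B M T u x"
  shows "data_mat n M T (right_deriv n x) 0 = A * data_mat n M T x 0 + B * data_mat m M T u 0"
proof (rule eq_matI)
  let ?X = "data_mat n M T x 0" and ?U = "data_mat m M T u 0"
  have X: "?X \<in> carrier_mat n M" and U: "?U \<in> carrier_mat m M" by (simp_all add: data_mat_def)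
  fix i j assume "i < dim_row (A * ?X + B * ?U)" "j < dim_col (A * ?X + B * ?U)"
  then have i: "i < n" and j: "j < M" using A B by (simp_all add: data_mat_def)
  let ?t = "real j * T" and ?b = "real (Suc j) * T"
  have tb: "?t < ?b" using T by simp
  have xu: "x ?t \<in> carrier_vec n" "u ?t \<in> carrier_vec m"
    using data sample_time_less[OF T j] unfolding input_state_data_def by simp_all
  have cX: "col ?X j = x ?t" and cU: "col ?U j = u ?t"
    using xu j by (auto intro!: eq_vecI simp: data_mat_def)
  let ?v = "A *\<^sub>v x ?t + B *\<^sub>v u ?t"
  have "has_vec_deriv n x ?v (at ?t within {?t..<?b})"
    using data j tb unfolding input_state_data_def by simp
  \<comment> \<open>Close to the switching instant the sampling interval and the closed ray agree,
    so the derivative given by the data is the right derivative.\<close>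
  moreover have "at ?t within {?t..<?b} = at ?t within {?t..}"
    by (rule at_within_nhd[of _ "{..<?b}"]) (use tb in auto)
  ultimately have "((\<lambda>s. x s $ i) has_vector_derivative ?v $ i) (at ?t within {?t..})"
    using i unfolding has_vec_deriv_def by simp
  then have "vector_derivative (\<lambda>s. x s $ i) (at ?t within {?t..}) = ?v $ i"
    by (intro vector_derivative_within) (simp_all add: at_within_Ici_at_right)
  moreover have "?v $ i = (A * ?X + B * ?U) $$ (i, j)"
    using A B X U i j cX cU xu by simp
  ultimately show "data_mat n M T (right_deriv n x) 0 $$ (i, j) = (A * ?X + B * ?U) $$ (i, j)"
    using i j by (simp add: data_mat_def right_deriv_def)
qed (use A B in \<open>simp_all add: data_mat_def\<close>)

section \<open>The grounded Laplacian\<close>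

definition grounded_laplacian :: "nat \<Rightarrow> real mat \<Rightarrow> real vec \<Rightarrow> real mat" where
  "grounded_laplacian N W g = laplacian N W + mat_diag N (\<lambda>i. g $ i)"

lemma grounded_laplacian_carrier [simp]:
  "W \<in> carrier_mat N N \<Longrightarrow> grounded_laplacian N W g \<in> carrier_mat N N"
  by (auto simp: grounded_laplacian_def laplacian_def mat_diag_def)

lemma grounded_laplacian_index:
  assumes "W \<in> carrier_mat N N" "i < N" "j < N"
  shows "grounded_laplacian N W g $$ (i, j) =
    (if i = j then (\<Sum>l<N. W $$ (i, l)) + g $ i else 0) - W $$ (i, j)"
  using assms by (auto simp: grounded_laplacian_def laplacian_def mat_diag_def)

text \<open>A row as a weighted sum of differences: the form needed for the minimum principle and
  for recognising \<open>sync_error\<close>.\<close>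

lemma grounded_laplacian_sum:
  assumes "W \<in> carrier_mat N N" "i < N"
  shows "(\<Sum>j<N. grounded_laplacian N W g $$ (i, j) * x j) = (\<Sum>j<N. W $$ (i, j) * (x i - x j)) + g $ i * x i"
proof -
  have "(\<Sum>j<N. grounded_laplacian N W g $$ (i, j) * x j) =
      (\<Sum>j<N. (if i = j then ((\<Sum>l<N. W $$ (i, l)) + g $ i) * x i else 0) - W $$ (i, j) * x j)"
    using assms by (intro sum.cong refl) (auto simp: grounded_laplacian_index algebra_simps)
  also have "\<dots> = ((\<Sum>l<N. W $$ (i, l)) + g $ i) * x i - (\<Sum>j<N. W $$ (i, j) * x j)"
    using assms(2) by (simp add: sum_subtractf)
  finally show ?thesis
    by (simp add: right_diff_distrib sum_subtractf sum_distrib_right distrib_right)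
qed

context
  fixes N :: nat and E :: "(nat \<times> nat) set" and W :: "real mat" and Acc :: "nat set" and g :: "real vec"
  assumes graph: "weighted_digraph N E W" and pin: "pinning_gain N Acc g"
    and lead: "leader_connected_to_root N E g"
begin

lemma weights_carrier: "W \<in> carrier_mat N N"
  using graph by (simp add: weighted_digraph_def)

lemma weights_nonneg: "i < N \<Longrightarrow> j < N \<Longrightarrow> W $$ (i, j) \<ge> 0"
  using graph unfolding weighted_digraph_def by (metis less_eq_real_def)

lemma weights_edge:
  assumes "(j, i) \<in> E"
  shows "i < N \<and> j < N \<and> W $$ (i, j) > 0"
proof -
  have "i < N" "j < N" using graph assms unfolding weighted_digraph_def by auto
  then show ?thesis using graph assms unfolding weighted_digraph_def by metis
qed

lemma gain_nonneg: "i < N \<Longrightarrow> g $ i \<ge> 0"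
  using pin unfolding pinning_gain_def by (metis less_eq_real_def)

text \<open>A minimum principle: a negative minimum would propagate against the edges to the pinned
  root.\<close>

lemma grounded_laplacian_monotone:
  assumes Hx: "\<And>i. i < N \<Longrightarrow> (\<Sum>j<N. grounded_laplacian N W g $$ (i, j) * x j) \<ge> 0" and i: "i < N"
  shows "x i \<ge> 0"
proof (rule ccontr)
  assume neg: "\<not> x i \<ge> 0"
  define a where "a = Min (x ` {..<N})"
  have a_le: "a \<le> x j" if "j < N" for j using that by (simp add: a_def)
  have "a \<in> x ` {..<N}" unfolding a_def using i by (intro Min_in) auto
  then obtain i0 where i0: "i0 < N" "x i0 = a" by auto
  have a_neg: "a < 0" using a_le[OF i] neg by simp
  \<comment> \<open>At a minimiser all terms of the row are nonpositive while their sum is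
    nonnegative, so each vanishes: the node is unpinned and its in-neighbours are minimisers as
    well.\<close>
  have spread: "g $ j = 0 \<and> (\<forall>l<N. W $$ (j, l) > 0 \<longrightarrow> x l = a)" if j: "j < N" "x j = a" for j
  proof -
    have t: "W $$ (j, l) * (a - x l) \<le> 0" if "l < N" for l
      using weights_nonneg[OF j(1) that] a_le[OF that] by (simp add: mult_nonneg_nonpos)
    have gt: "g $ j * a \<le> 0" using gain_nonneg[OF j(1)] a_neg by (simp add: mult_nonneg_nonpos)
    have s: "(\<Sum>l<N. W $$ (j, l) * (a - x l)) \<le> 0" using t by (intro sum_nonpos) auto
    have "(\<Sum>l<N. W $$ (j, l) * (a - x l)) + g $ j * a \<ge> 0"
      using Hx[OF j(1)] grounded_laplacian_sum[OF weights_carrier j(1), of g x] j(2) by simp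
    with s gt have 0: "(\<Sum>l<N. W $$ (j, l) * (a - x l)) = 0" "g $ j * a = 0" by linarith+
    have "\<forall>l\<in>{..<N}. - (W $$ (j, l) * (a - x l)) = 0"
      using 0(1) t by (subst sum_nonneg_eq_0_iff[symmetric]) (auto simp: sum_negf)
    then show ?thesis using 0(2) a_neg by force
  qed
  obtain r where r: "is_root N E r" "g $ r > 0"
    using lead by (auto simp: leader_connected_to_root_def)
  have "(r, i0) \<in> E\<^sup>*" using r(1) i0(1) by (simp add: is_root_def)
  then have "r < N \<and> x r = a"
  \<comment> \<open>Backwards along the path from \<open>r\<close> to \<open>i0\<close>: each edge
    ends at a minimiser, so it also starts at one.\<close>
  proof (induction rule: converse_rtrancl_induct)
    case (step y z)
    then show ?case using weights_edge spread[of z] by blast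
  qed (use i0 in simp)
  then show False using spread[of r] r(2) by simp
qed

text \<open>Injectivity is the minimum principle applied to a kernel vector and to its negative. The
  inverse is entrywise nonnegative because the matrix maps each of its columns to a unit
  vector.\<close>

lemma grounded_laplacian_inverse:
  obtains K where "K \<in> carrier_mat N N" "grounded_laplacian N W g * K = 1\<^sub>m N"
    "K * grounded_laplacian N W g = 1\<^sub>m N" "\<And>i j. i < N \<Longrightarrow> j < N \<Longrightarrow> K $$ (i, j) \<ge> 0"
proof -
  let ?H = "grounded_laplacian N W g"
  have H: "?H \<in> carrier_mat N N" using weights_carrier by simp
  obtain K where K: "K \<in> carrier_mat N N" "?H * K = 1\<^sub>m N" "K * ?H = 1\<^sub>m N"
  proof (rule inj_mat_inverse[OF H])
    fix v assume v: "v \<in> carrier_vec N" and 0: "?H *\<^sub>v v = 0\<^sub>v N"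
    have sum0: "(\<Sum>j<N. ?H $$ (i, j) * v $ j) = 0" if "i < N" for i
      using mat_mult_vec_index[OF H v that] 0 that by simp
    have "v $ i \<ge> 0" "- v $ i \<ge> 0" if "i < N" for i
      using grounded_laplacian_monotone[of "\<lambda>j. v $ j", OF _ that]
        grounded_laplacian_monotone[of "\<lambda>j. - v $ j", OF _ that] sum0 by (simp_all add: sum_negf)
    then show "v = 0\<^sub>v N" using v by (intro eq_vecI) force+
  qed (use that in blast)
  moreover have "K $$ (i, j) \<ge> 0" if "i < N" "j < N" for i j
  proof (rule grounded_laplacian_monotone[of "\<lambda>i. K $$ (i, j)", OF _ that(1)])
    fix i assume i: "i < N"
    then have "(\<Sum>l<N. ?H $$ (i, l) * K $$ (l, j)) = (?H * K) $$ (i, j)"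
      using mat_mult_index[OF H K(1) i that(2)] by simp
    then show "(\<Sum>l<N. ?H $$ (i, l) * K $$ (l, j)) \<ge> 0" using K(2) i that by simp
  qed
  ultimately show thesis using that by blast
qed

text \<open>With positive \<open>x\<close>, \<open>y\<close> such that \<open>H x = 1\<close> and \<open>H\<^sup>T y = 1\<close>, the scaling \<open>q = x / y\<close> makes
  the symmetric part of \<open>diag y (H diag q) diag y\<close> strictly diagonally dominant.\<close>

lemma grounded_laplacian_diagonal_stability:
  obtains q e :: "nat \<Rightarrow> real" where "\<And>i. i < N \<Longrightarrow> q i > 0" "\<And>i. i < N \<Longrightarrow> e i > 0"
    "\<And>z :: nat \<Rightarrow> real. (\<Sum>i<N. e i * (z i)\<^sup>2) \<le>
      (\<Sum>i<N. \<Sum>j<N. grounded_laplacian N W g $$ (i, j) * q j * (z i * z j))"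
proof -
  let ?H = "grounded_laplacian N W g"
  have H: "?H \<in> carrier_mat N N" using weights_carrier by simp
  obtain K where K: "K \<in> carrier_mat N N" "?H * K = 1\<^sub>m N" "K * ?H = 1\<^sub>m N"
    and K0: "\<And>i j. i < N \<Longrightarrow> j < N \<Longrightarrow> K $$ (i, j) \<ge> 0"
    using grounded_laplacian_inverse by blast
  define x where "x i = (\<Sum>j<N. K $$ (i, j))" for i
  define y where "y j = (\<Sum>i<N. K $$ (i, j))" for j
  have off: "?H $$ (i, j) \<le> 0" if "i < N" "j < N" "i \<noteq> j" for i j
    using that weights_nonneg by (simp add: grounded_laplacian_index[OF weights_carrier])
  have Hx: "(\<Sum>j<N. ?H $$ (i, j) * x j) = 1" if i: "i < N" for i
  proof -
    have "(\<Sum>j<N. ?H $$ (i, j) * x j) = (\<Sum>l<N. \<Sum>j<N. ?H $$ (i, j) * K $$ (j, l))"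
      unfolding x_def sum_distrib_left by (rule sum.swap)
    also have "\<dots> = (\<Sum>l<N. if i = l then 1 else 0)"
      using mat_mult_index[OF H K(1) i] K(2) i by (intro sum.cong refl) simp
    finally show ?thesis using i by simp
  qed
  have Hy: "(\<Sum>i<N. ?H $$ (i, j) * y i) = 1" if j: "j < N" for j
  proof -
    have "(\<Sum>i<N. ?H $$ (i, j) * y i) = (\<Sum>l<N. \<Sum>i<N. K $$ (l, i) * ?H $$ (i, j))"
      unfolding y_def sum_distrib_left by (subst sum.swap) (simp add: mult.commute)
    also have "\<dots> = (\<Sum>l<N. if l = j then 1 else 0)"
      using mat_mult_index[OF K(1) H _ j] K(3) j by (intro sum.cong refl) simp
    finally show ?thesis using j by simp
  qed
  have x0: "x i \<ge> 0" and y0: "y i \<ge> 0" if "i < N" for i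
    using K0 that by (auto simp: x_def y_def intro!: sum_nonneg)
  \<comment> \<open>If \<open>x i = 0\<close>, only off-diagonal entries contribute to row
    \<open>i\<close> of the product, and they are nonpositive, against the value 1.\<close>
  have x: "x i > 0" if i: "i < N" for i
  proof (rule ccontr)
    assume "\<not> x i > 0"
    then have "x i = 0" using x0[OF i] by simp
    then have "?H $$ (i, j) * x j \<le> 0" if "j < N" for j
      using off[OF i that] x0[OF that] by (cases "i = j") (auto simp: mult_nonpos_nonneg)
    then have "(\<Sum>j<N. ?H $$ (i, j) * x j) \<le> 0" by (intro sum_nonpos) auto
    then show False using Hx[OF i] by simp
  qed
  have y: "y j > 0" if j: "j < N" for j
  proof (rule ccontr)
    assume "\<not> y j > 0"
    then have "y j = 0" using y0[OF j] by simp
    then have "?H $$ (i, j) * y i \<le> 0" if "i < N" for i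
      using off[OF that j] y0[OF that] by (cases "i = j") (auto simp: mult_nonpos_nonneg)
    then have "(\<Sum>i<N. ?H $$ (i, j) * y i) \<le> 0" by (intro sum_nonpos) auto
    then show False using Hy[OF j] by simp
  qed
  define q where "q i = x i / y i" for i
  \<comment> \<open>In the variables \<open>s = z / y\<close> the matrix \<open>C\<close> below has
    row sums \<open>y\<close> and column sums \<open>x\<close>; \<open>e\<close> is half their sum,
    rescaled by the square of \<open>y\<close>.\<close>
  define e where "e i = (x i + y i) / (2 * (y i)\<^sup>2)" for i
  have "(\<Sum>i<N. e i * (z i)\<^sup>2) \<le> (\<Sum>i<N. \<Sum>j<N. ?H $$ (i, j) * q j * (z i * z j))" for z :: "nat \<Rightarrow> real"
  proof -
    define s where "s i = z i / y i" for i
    define C where "C i j = y i * ?H $$ (i, j) * x j" for i j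
    have row: "(\<Sum>j<N. C i j) = y i" if "i < N" for i
    proof -
      have "(\<Sum>j<N. C i j) = y i * (\<Sum>j<N. ?H $$ (i, j) * x j)"
        by (simp add: C_def sum_distrib_left mult.assoc)
      then show ?thesis using Hx[OF that] by simp
    qed
    have col: "(\<Sum>i<N. C i j) = x j" if "j < N" for j
    proof -
      have "(\<Sum>i<N. C i j) = x j * (\<Sum>i<N. ?H $$ (i, j) * y i)"
        by (simp add: C_def sum_distrib_left mult_ac)
      then show ?thesis using Hy[OF that] by simp
    qed
    have "(\<Sum>i<N. e i * (z i)\<^sup>2) = ((\<Sum>i<N. y i * (s i)\<^sup>2) + (\<Sum>j<N. x j * (s j)\<^sup>2)) / 2"
      unfolding sum.distrib[symmetric] sum_divide_distrib
      using y by (intro sum.cong refl) (simp add: e_def s_def power_divide distrib_right add_divide_distrib)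
    also have "(\<Sum>i<N. y i * (s i)\<^sup>2) = (\<Sum>i<N. \<Sum>j<N. C i j * (s i)\<^sup>2)"
      by (intro sum.cong refl) (simp add: row[symmetric] sum_distrib_right)
    also have "(\<Sum>j<N. x j * (s j)\<^sup>2) = (\<Sum>i<N. \<Sum>j<N. C i j * (s j)\<^sup>2)"
      by (subst sum.swap) (intro sum.cong refl, simp add: col[symmetric] sum_distrib_right)
    \<comment> \<open>By \<open>(a^2 + b^2) / 2 = a b + (a - b)^2 / 2\<close>. The square terms
      matter only off the diagonal, where \<open>C i j\<close> is nonpositive, so dropping them can
      only increase the sum.\<close>
    also have "((\<Sum>i<N. \<Sum>j<N. C i j * (s i)\<^sup>2) + (\<Sum>i<N. \<Sum>j<N. C i j * (s j)\<^sup>2)) / 2 =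
        (\<Sum>i<N. \<Sum>j<N. C i j * (s i * s j) + C i j * (s i - s j)\<^sup>2 / 2)"
      unfolding sum.distrib[symmetric] sum_divide_distrib
      by (intro sum.cong refl) (simp add: power2_eq_square field_simps)
    also have "\<dots> \<le> (\<Sum>i<N. \<Sum>j<N. ?H $$ (i, j) * q j * (z i * z j))"
    proof (intro sum_mono)
      fix i j assume ij: "i \<in> {..<N}" "j \<in> {..<N}"
      have "C i j * (s i - s j)\<^sup>2 \<le> 0"
      proof (cases "i = j")
        case False
        then have "C i j \<le> 0"
          using off[of i j] x[of j] y[of i] ij unfolding C_def
          by (intro mult_nonpos_nonneg[OF mult_nonneg_nonpos]) auto
        then show ?thesis by (simp add: mult_nonpos_nonneg)
      qed simp
      moreover have "C i j * (s i * s j) = ?H $$ (i, j) * q j * (z i * z j)"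
        using y[of i] y[of j] ij by (simp add: C_def s_def q_def)
      ultimately show "C i j * (s i * s j) + C i j * (s i - s j)\<^sup>2 / 2 \<le> ?H $$ (i, j) * q j * (z i * z j)"
        by simp
    qed
    finally show ?thesis .
  qed
  moreover have "q i > 0" "e i > 0" if "i < N" for i
    using x[OF that] y[OF that] by (simp_all add: q_def e_def)
  ultimately show thesis using that by blast
qed

end

text \<open>The finite-horizon observability Gramian of the pair \<open>(S, C)\<close>. It is
  applied to transposed system matrices and is then a controllability Gramian.\<close>

fun gramian :: "real mat \<Rightarrow> real mat \<Rightarrow> nat \<Rightarrow> real mat" where
  "gramian C S 0 = 0\<^sub>m (dim_col C) (dim_col C)"
| "gramian C S (Suc k) = gramian C S k + transpose_mat (C * S ^\<^sub>m k) * (C * S ^\<^sub>m k)"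

lemma gramian_carrier:
  assumes "C \<in> carrier_mat m n" "S \<in> carrier_mat n n"
  shows "gramian C S k \<in> carrier_mat n n" "transpose_mat (gramian C S k) = gramian C S k"
proof -
  have CS: "C * S ^\<^sub>m l \<in> carrier_mat m n" for l using assms by simp
  show c: "gramian C S k \<in> carrier_mat n n" for k
    by (induction k) (use assms CS in auto)
  show "transpose_mat (gramian C S k) = gramian C S k"
  proof (induction k)
    case (Suc k)
    have "transpose_mat (transpose_mat (C * S ^\<^sub>m k) * (C * S ^\<^sub>m k)) = transpose_mat (C * S ^\<^sub>m k) * (C * S ^\<^sub>m k)"
      using transpose_mult[of "transpose_mat (C * S ^\<^sub>m k)" n m "C * S ^\<^sub>m k" n] CS by simp
    moreover have "transpose_mat (C * S ^\<^sub>m k) * (C * S ^\<^sub>m k) \<in> carrier_mat n n"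
      by (rule mult_carrier_mat[of _ n m]) (use CS in auto)
    ultimately show ?case
      unfolding gramian.simps by (subst transpose_add[OF c]) (simp_all only: Suc)
  qed simp
qed

lemma gramian_form:
  assumes C: "C \<in> carrier_mat m n" and S: "S \<in> carrier_mat n n"
    and y: "y \<in> carrier_vec n" and z: "z \<in> carrier_vec n"
  shows "y \<bullet> (gramian C S k *\<^sub>v z) = (\<Sum>l<k. (C *\<^sub>v krylov S y l) \<bullet> (C *\<^sub>v krylov S z l))"
proof (induction k)
  case 0
  have "0\<^sub>m n n *\<^sub>v z = 0\<^sub>v n" using z by (intro eq_vecI) auto
  then show ?case using C y by simp
next
  case (Suc k)
  let ?G = "C * S ^\<^sub>m k"
  have G: "?G \<in> carrier_mat m n" using C S by simp
  then have Gt: "transpose_mat ?G \<in> carrier_mat n m" by simp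
  have GG: "transpose_mat ?G * ?G \<in> carrier_mat n n" using mult_carrier_mat[OF Gt G] .
  have Gv: "?G *\<^sub>v v = C *\<^sub>v krylov S v k" if "v \<in> carrier_vec n" for v
    using assoc_mult_mat_vec[OF C _ that, of "S ^\<^sub>m k"] S pow_mat_mult_vec[OF S that] by simp
  have Gz: "?G *\<^sub>v z \<in> carrier_vec m" by (rule mult_mat_vec_carrier[OF G z])
  have g: "gramian C S k \<in> carrier_mat n n" by (rule gramian_carrier[OF C S])
  have "y \<bullet> (gramian C S (Suc k) *\<^sub>v z) = y \<bullet> (gramian C S k *\<^sub>v z) + y \<bullet> (transpose_mat ?G * ?G *\<^sub>v z)"
    unfolding gramian.simps add_mult_distrib_mat_vec[OF g GG z]
    by (rule scalar_prod_add_distrib[OF y mult_mat_vec_carrier[OF g z] mult_mat_vec_carrier[OF GG z]])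
  also have "y \<bullet> (transpose_mat ?G * ?G *\<^sub>v z) = (?G *\<^sub>v y) \<bullet> (?G *\<^sub>v z)"
    unfolding assoc_mult_mat_vec[OF Gt G z]
    using scalar_prod_transpose[OF Gt y Gz] by simp
  finally show ?case using Suc Gv[OF y] Gv[OF z] by simp
qed

section \<open>A Lyapunov inequality for controllable pairs\<close>

text \<open>\<open>P\<close> is the finite-horizon controllability Gramian of the discrete-time pair obtained from
  \<open>(A + 1, B)\<close> by a Cayley transform, which turns the Stein inequality of \<open>P\<close> into a Lyapunov
  inequality for \<open>A + 1\<close>.\<close>

lemma controllable_lyapunov:
  assumes A: "A \<in> carrier_mat n n" and B: "B \<in> carrier_mat n m" and ctr: "controllable n m A B"
  obtains P \<kappa> where "pos_def n P" "\<kappa> > 0"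
    "\<And>z. z \<in> carrier_vec n \<Longrightarrow> z \<bullet> (A *\<^sub>v (P *\<^sub>v z)) + z \<bullet> (P *\<^sub>v z) \<le>
      \<kappa> * ((transpose_mat B *\<^sub>v z) \<bullet> (transpose_mat B *\<^sub>v z))"
proof -
  define At where "At = transpose_mat A"
  have At: "At \<in> carrier_mat n n" and nAt: "- At \<in> carrier_mat n n" using A by (simp_all add: At_def)
  have Bt: "transpose_mat B \<in> carrier_mat m n" using B by simp
  obtain c where c: "c > 0" and bound: "\<And>v. v \<in> carrier_vec n \<Longrightarrow> v \<bullet> ((- At) *\<^sub>v v) \<le> c * (v \<bullet> v)"
    using quadratic_form_bound[OF nAt] by metis
  \<comment> \<open>Large enough for \<open>L = A\<^sup>T + 1 + \<beta>\<close> to be invertible: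
    \<open>v \<bullet> L v\<close> is at least \<open>2 (v \<bullet> v)\<close>.\<close>
  define \<beta> where "\<beta> = c + 1"
  have \<beta>: "\<beta> > 0" using c by (simp add: \<beta>_def)
  define L where "L = At + (\<beta> + 1) \<cdot>\<^sub>m 1\<^sub>m n"
  have L: "L \<in> carrier_mat n n" using At by (simp add: L_def)
  have Lv: "L *\<^sub>v v = At *\<^sub>v v + (\<beta> + 1) \<cdot>\<^sub>v v" if "v \<in> carrier_vec n" for v
  proof -
    have "((\<beta> + 1) \<cdot>\<^sub>m 1\<^sub>m n) *\<^sub>v v = (\<beta> + 1) \<cdot>\<^sub>v v"
    proof (rule eq_vecI)
      fix i assume "i < dim_vec ((\<beta> + 1) \<cdot>\<^sub>v v)"
      then have i: "i < n" using that by simp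
      then have "(((\<beta> + 1) \<cdot>\<^sub>m 1\<^sub>m n) *\<^sub>v v) $ i = (\<Sum>j<n. ((\<beta> + 1) \<cdot>\<^sub>m 1\<^sub>m n) $$ (i, j) * v $ j)"
        using that by (intro mat_mult_vec_index) auto
      also have "\<dots> = (\<Sum>j<n. if i = j then (\<beta> + 1) * v $ j else 0)"
        using i by (intro sum.cong refl) auto
      finally show "(((\<beta> + 1) \<cdot>\<^sub>m 1\<^sub>m n) *\<^sub>v v) $ i = ((\<beta> + 1) \<cdot>\<^sub>v v) $ i" using i that by simp
    qed (use that in simp)
    then show ?thesis using At that by (simp add: L_def add_mult_distrib_mat_vec[OF At])
  qed
  obtain R where R: "R \<in> carrier_mat n n" "L * R = 1\<^sub>m n" "R * L = 1\<^sub>m n"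
  proof (rule inj_mat_inverse[OF L])
    fix v assume v: "v \<in> carrier_vec n" and 0: "L *\<^sub>v v = 0\<^sub>v n"
    have Atv: "At *\<^sub>v v \<in> carrier_vec n" using At v by simp
    have "0 = v \<bullet> (At *\<^sub>v v) + (\<beta> + 1) * (v \<bullet> v)"
      using arg_cong[OF 0, of "\<lambda>w. v \<bullet> w"] v Atv
      by (simp add: Lv scalar_prod_add_distrib[of v n])
    moreover have "v \<bullet> ((- At) *\<^sub>v v) = - (v \<bullet> (At *\<^sub>v v))"
    proof -
      have "(- At) *\<^sub>v v = - (At *\<^sub>v v)" using At v by (intro eq_vecI) auto
      then show ?thesis using v At by simp
    qed
    ultimately have "(\<beta> + 1 - c) * (v \<bullet> v) \<le> 0"
      using bound[OF v] by (simp add: algebra_simps)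
    then have "v \<bullet> v \<le> 0" by (simp add: \<beta>_def)
    then show "v = 0\<^sub>v n" using scalar_prod_self_eq_0[OF v] scalar_prod_self_ge_0[of v] by simp
  qed (use that in blast)
  have RL: "R *\<^sub>v (L *\<^sub>v v) = v" and LR: "L *\<^sub>v (R *\<^sub>v v) = v" if "v \<in> carrier_vec n" for v
    using assoc_mult_mat_vec[OF R(1) L that] assoc_mult_mat_vec[OF L R(1) that] R(2,3) that by simp_all
  \<comment> \<open>With \<open>Q = A\<^sup>T + 1\<close> one has \<open>L = \<beta> + Q\<close>,
    and \<open>S\<close> is the Cayley transform
    \<open>(\<beta> - Q) (\<beta> + Q)^-1\<close>.\<close>
  define S where "S = (2 * \<beta>) \<cdot>\<^sub>m R - 1\<^sub>m n"
  have S: "S \<in> carrier_mat n n" using R by (simp add: S_def minus_carrier_mat)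
  have Sv: "S *\<^sub>v v = (2 * \<beta>) \<cdot>\<^sub>v (R *\<^sub>v v) - v" if v: "v \<in> carrier_vec n" for v
    using R v unfolding S_def
    by (subst minus_mult_distrib_mat_vec[of _ n n]) auto
  define C where "C = transpose_mat B * R"
  have C: "C \<in> carrier_mat m n" using Bt R by (simp add: C_def)
  have Cv: "C *\<^sub>v v = transpose_mat B *\<^sub>v (R *\<^sub>v v)" if "v \<in> carrier_vec n" for v
    unfolding C_def by (rule assoc_mult_mat_vec[OF Bt R(1) that])
  define P where "P = gramian C S n"
  note P = gramian_carrier[OF C S, of n, folded P_def]
  define b where "b y z = y \<bullet> (P *\<^sub>v z)" for y z
  have form: "b y z = (\<Sum>l<n. (C *\<^sub>v krylov S y l) \<bullet> (C *\<^sub>v krylov S z l))"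
    if "y \<in> carrier_vec n" "z \<in> carrier_vec n" for y z
    unfolding b_def P_def by (rule gramian_form[OF C S that])
  have sq: "b y y = (\<Sum>l<n. (C *\<^sub>v krylov S y l) \<bullet> (C *\<^sub>v krylov S y l))" if "y \<in> carrier_vec n" for y
    by (rule form[OF that that])
  \<comment> \<open>Replacing \<open>y\<close> by \<open>S y\<close> shifts the sum of squares by
    one: the first term is lost and a nonnegative last one is gained.\<close>
  have stein: "b (S *\<^sub>v y) (S *\<^sub>v y) \<ge> b y y - (C *\<^sub>v y) \<bullet> (C *\<^sub>v y)" if y: "y \<in> carrier_vec n" for y
  proof -
    let ?f = "\<lambda>l. (C *\<^sub>v krylov S y l) \<bullet> (C *\<^sub>v krylov S y l)"
    have "b (S *\<^sub>v y) (S *\<^sub>v y) = (\<Sum>l<n. ?f (Suc l))"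
      using sq[OF mult_mat_vec_carrier[OF S y]] by (simp add: krylov_Suc')
    moreover have "(\<Sum>l<Suc n. ?f l) = ?f 0 + (\<Sum>l<n. ?f (Suc l))" by (rule sum.lessThan_Suc_shift)
    ultimately show ?thesis using sq[OF y] scalar_prod_self_ge_0[of "C *\<^sub>v krylov S y n"] by simp
  qed
  have bsym: "b y z = b z y" if "y \<in> carrier_vec n" "z \<in> carrier_vec n" for y z
    unfolding form[OF that] form[OF that(2,1)]
    by (intro sum.cong refl comm_scalar_prod[of _ m]) (use C S that in auto)
  have badd: "b (y + s \<cdot>\<^sub>v z) (y + s \<cdot>\<^sub>v z) = b y y + 2 * s * b y z + s * s * b z z"
    if y: "y \<in> carrier_vec n" and z: "z \<in> carrier_vec n" for y z s
  proof -
    have Pyz: "P *\<^sub>v (y + s \<cdot>\<^sub>v z) = P *\<^sub>v y + s \<cdot>\<^sub>v (P *\<^sub>v z)"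
      using P(1) y z by (simp add: mult_add_distrib_mat_vec[of _ n n] mult_mat_vec[OF P(1) z])
    have "P *\<^sub>v y \<in> carrier_vec n" "P *\<^sub>v z \<in> carrier_vec n" using P(1) y z by simp_all
    then show ?thesis
      unfolding b_def Pyz using y z bsym[OF y z]
      by (simp add: b_def add_scalar_prod_distrib[of _ n] scalar_prod_add_distrib[of _ n] algebra_simps)
  qed
  have lyap: "z \<bullet> (A *\<^sub>v (P *\<^sub>v z)) + z \<bullet> (P *\<^sub>v z) \<le>
      1 / (4 * \<beta>) * ((transpose_mat B *\<^sub>v z) \<bullet> (transpose_mat B *\<^sub>v z))" if z: "z \<in> carrier_vec n" for z
  proof -
    have Atz: "At *\<^sub>v z \<in> carrier_vec n" using At z by simp
    have Lz: "L *\<^sub>v z \<in> carrier_vec n" using L z by simp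
    \<comment> \<open>The Stein inequality at \<open>L z = y + \<beta> z\<close> compares the form
      at \<open>y - \<beta> z\<close> and at \<open>y + \<beta> z\<close>. The difference is
      \<open>4 \<beta>\<close> times the mixed term \<open>b y z\<close>, whence the constant
      \<open>1 / (4 \<beta>)\<close>.\<close>
    define y where "y = At *\<^sub>v z + z"
    have y: "y \<in> carrier_vec n" using At z by (simp add: y_def)
    have Ly: "L *\<^sub>v z = y + \<beta> \<cdot>\<^sub>v z"
      unfolding Lv[OF z] y_def using Atz z by (intro eq_vecI) (auto simp: algebra_simps)
    have "S *\<^sub>v (L *\<^sub>v z) = (2 * \<beta>) \<cdot>\<^sub>v z - (y + \<beta> \<cdot>\<^sub>v z)"
      unfolding Sv[OF Lz] RL[OF z] by (simp add: Ly)
    also have "\<dots> = (-1) \<cdot>\<^sub>v (y + (- \<beta>) \<cdot>\<^sub>v z)"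
      using y z by (intro eq_vecI) (auto simp: algebra_simps)
    finally have SL: "S *\<^sub>v (L *\<^sub>v z) = (-1) \<cdot>\<^sub>v (y + (- \<beta>) \<cdot>\<^sub>v z)" .
    have w: "y + (- \<beta>) \<cdot>\<^sub>v z \<in> carrier_vec n" using y z by simp
    have "b ((-1) \<cdot>\<^sub>v (y + (- \<beta>) \<cdot>\<^sub>v z)) ((-1) \<cdot>\<^sub>v (y + (- \<beta>) \<cdot>\<^sub>v z)) = b (y + (- \<beta>) \<cdot>\<^sub>v z) (y + (- \<beta>) \<cdot>\<^sub>v z)"
      unfolding b_def mult_mat_vec[OF P(1) w] using P(1) w by simp
    then have "b y y - 2 * \<beta> * b y z + \<beta> * \<beta> * b z z \<ge>
        b y y + 2 * \<beta> * b y z + \<beta> * \<beta> * b z z - (C *\<^sub>v (L *\<^sub>v z)) \<bullet> (C *\<^sub>v (L *\<^sub>v z))"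
      using stein[OF Lz] unfolding SL unfolding Ly badd[OF y z] by simp
    moreover have "C *\<^sub>v (L *\<^sub>v z) = transpose_mat B *\<^sub>v z" unfolding Cv[OF Lz] RL[OF z] ..
    ultimately have "4 * \<beta> * b y z \<le> (transpose_mat B *\<^sub>v z) \<bullet> (transpose_mat B *\<^sub>v z)" by simp
    moreover have "b y z = z \<bullet> (A *\<^sub>v (P *\<^sub>v z)) + z \<bullet> (P *\<^sub>v z)"
    proof -
      have Pz: "P *\<^sub>v z \<in> carrier_vec n" using P(1) z by simp
      show ?thesis
        unfolding b_def y_def add_scalar_prod_distrib[OF Atz z Pz]
        using scalar_prod_transpose[OF A z Pz] by (simp add: At_def)
    qed
    ultimately show ?thesis using \<beta> by (simp add: field_simps)
  qed
  have "z = 0\<^sub>v n" if z: "z \<in> carrier_vec n" and 0: "b z z = 0" for z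
  proof (rule ccontr)
    assume z0: "z \<noteq> 0\<^sub>v n"
    have kill: "C *\<^sub>v krylov S z l = 0\<^sub>v m" if "l < n" for l
    proof (rule scalar_prod_self_eq_0)
      have "\<forall>l\<in>{..<n}. (C *\<^sub>v krylov S z l) \<bullet> (C *\<^sub>v krylov S z l) = 0"
        using 0 unfolding sq[OF z] by (subst (asm) sum_nonneg_eq_0_iff) (auto intro: scalar_prod_self_ge_0)
      then show "(C *\<^sub>v krylov S z l) \<bullet> (C *\<^sub>v krylov S z l) = 0" using that by simp
      show "C *\<^sub>v krylov S z l \<in> carrier_vec m"
        by (rule mult_mat_vec_carrier[OF C krylov_carrier[OF S z]])
    qed
    have cS: "cmat S \<in> carrier_mat n n" and cC: "cmat C \<in> carrier_mat m n" using S C by simp_all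
    have cz: "cvec z \<in> carrier_vec n" "cvec z \<noteq> 0\<^sub>v n"
      using z z0 by (auto simp: vec_eq_iff)
    have kr: "krylov (cmat S) (cvec z) k = cvec (krylov S z k)" for k
      by (induction k) (simp_all add: krylov_Suc cvec_mult_mat[OF S krylov_carrier[OF S z]])
    obtain p where p: "p \<noteq> 0" "degree p \<le> n" "poly_apply p (cmat S) (cvec z) = 0\<^sub>v n"
      using annihilating_poly_exists[OF cS cz(1)] by metis
    obtain l u where u: "u \<in> carrier_vec n" "u \<noteq> 0\<^sub>v n" "cmat S *\<^sub>v u = l \<cdot>\<^sub>v u"
      and ku: "\<And>b. b \<in> row (cmat C) ` {..<m} \<Longrightarrow> b \<bullet> u = 0"
    proof (rule eigenvector_in_krylov_kernel[OF cS cz p(1,3), of "row (cmat C) ` {..<m}"])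
      show "b \<bullet> krylov (cmat S) (cvec z) k = 0"
        if b: "b \<in> row (cmat C) ` {..<m}" and k: "k < degree p" for b k
      proof -
        have "cmat C *\<^sub>v krylov (cmat S) (cvec z) k = 0\<^sub>v m"
          unfolding kr cvec_mult_mat[OF C krylov_carrier[OF S z], symmetric]
          using kill[of k] k p(2) by (auto intro!: eq_vecI)
        moreover obtain q where "q < m" "b = row (cmat C) q" using b by blast
        ultimately show ?thesis
          using C by (metis index_mult_mat_vec index_zero_vec(1) carrier_matD(1) index_map_mat(2))
      qed
    qed (use that in blast)
    have Cu: "cmat C *\<^sub>v u = 0\<^sub>v m" using ku C by (intro eq_vecI) auto
    have cR: "cmat R \<in> carrier_mat n n" and cL: "cmat L \<in> carrier_mat n n"
      and cBt: "cmat (transpose_mat B) \<in> carrier_mat m n" using R L Bt by simp_all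
    \<comment> \<open>As \<open>C = B\<^sup>T R\<close>, the vector \<open>R u\<close> is killed by
      \<open>B\<^sup>T\<close>; it remains to see that it is an eigenvector of
      \<open>A\<^sup>T\<close>.\<close>
    define v where "v = cmat R *\<^sub>v u"
    have v: "v \<in> carrier_vec n" using cR u by (simp add: v_def)
    have Lv': "cmat L *\<^sub>v v = u"
    proof -
      have "cmat L * cmat R = 1\<^sub>m n"
        using of_real_hom.mat_hom_mult[OF L R(1), where 'a = complex] R(2) by (simp add: of_real_hom.mat_hom_one)
      then show ?thesis unfolding v_def using assoc_mult_mat_vec[OF cL cR u(1)] u by simp
    qed
    have "v \<noteq> 0\<^sub>v n"
    proof
      assume "v = 0\<^sub>v n"
      then have "u = 0\<^sub>v n" using Lv'[symmetric] cL by (auto intro!: eq_vecI)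
      with u show False by simp
    qed
    have Bv: "transpose_mat (cmat B) *\<^sub>v v = 0\<^sub>v m"
    proof -
      have "cmat C = transpose_mat (cmat B) * cmat R"
        unfolding C_def of_real_hom.mat_hom_mult[OF Bt R(1)] by (simp add: map_mat_transpose)
      then show ?thesis
        using Cu assoc_mult_mat_vec[of "transpose_mat (cmat B)" m n "cmat R" n u] cR u B by (simp add: v_def)
    qed
    have Su: "(l + 1) \<cdot>\<^sub>v u = complex_of_real (2 * \<beta>) \<cdot>\<^sub>v v"
    proof (rule eq_vecI)
      fix i assume "i < dim_vec (complex_of_real (2 * \<beta>) \<cdot>\<^sub>v v)"
      then have i: "i < n" using v by simp
      have "(cmat S *\<^sub>v u) $ i = (\<Sum>j<n. of_real (2 * \<beta>) * (of_real (R $$ (i, j)) * u $ j) - (if i = j then u $ j else 0))"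
        using S R u i by (subst mat_mult_vec_index[OF cS u(1) i])
          (auto simp: S_def algebra_simps intro!: sum.cong)
      also have "\<dots> = of_real (2 * \<beta>) * v $ i - u $ i"
        using R u i mat_mult_vec_index[OF cR u(1) i]
        by (simp add: sum_subtractf v_def sum_distrib_left)
      finally show "((l + 1) \<cdot>\<^sub>v u) $ i = (complex_of_real (2 * \<beta>) \<cdot>\<^sub>v v) $ i"
        using u i v by (simp add: algebra_simps)
    qed (use u v in simp)
    have "l + 1 \<noteq> 0"
    proof
      assume "l + 1 = 0"
      then have "(l + 1) \<cdot>\<^sub>v u = 0\<^sub>v n" using u(1) by (intro eq_vecI) auto
      then have "complex_of_real (2 * \<beta>) \<cdot>\<^sub>v v = 0\<^sub>v n" unfolding Su .
      then show False using \<open>v \<noteq> 0\<^sub>v n\<close> v \<beta> by (auto simp: vec_eq_iff)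
    qed
    \<comment> \<open>The eigenvalue \<open>l\<close> of \<open>S\<close> pulled back through the
      Cayley transform: \<open>L v = u\<close> is \<open>2 \<beta> / (l + 1)\<close> times
      \<open>v\<close>, and \<open>L\<close> exceeds \<open>A\<^sup>T\<close> by
      \<open>\<beta> + 1\<close>.\<close>
    define \<zeta> where "\<zeta> = of_real (2 * \<beta>) / (l + 1) - of_real (\<beta> + 1)"
    have "transpose_mat (cmat A) *\<^sub>v v = \<zeta> \<cdot>\<^sub>v v"
    proof (rule eq_vecI)
      fix i assume "i < dim_vec (\<zeta> \<cdot>\<^sub>v v)"
      then have i: "i < n" using v by simp
      have cAt: "transpose_mat (cmat A) \<in> carrier_mat n n" using A by simp
      have "u $ i = (\<Sum>j<n. (transpose_mat (cmat A)) $$ (i, j) * v $ j + (if i = j then of_real (\<beta> + 1) * v $ j else 0))"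
        unfolding Lv'[symmetric] using A v i
        by (subst mat_mult_vec_index[OF cL v i], intro sum.cong refl) (auto simp: L_def At_def algebra_simps)
      also have "\<dots> = (transpose_mat (cmat A) *\<^sub>v v) $ i + of_real (\<beta> + 1) * v $ i"
        unfolding mat_mult_vec_index[OF cAt v i] using i by (simp add: sum.distrib)
      finally have "(transpose_mat (cmat A) *\<^sub>v v) $ i = u $ i - of_real (\<beta> + 1) * v $ i" by simp
      moreover have "u $ i = of_real (2 * \<beta>) / (l + 1) * v $ i"
        using arg_cong[OF Su, of "\<lambda>w. w $ i"] i u v \<open>l + 1 \<noteq> 0\<close> by (simp add: field_simps)
      ultimately show "(transpose_mat (cmat A) *\<^sub>v v) $ i = (\<zeta> \<cdot>\<^sub>v v) $ i"
        using i v by (simp add: \<zeta>_def left_diff_distrib)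
    qed (use A v in simp)
    then show False using controllable_hautus[OF A B ctr v _ Bv] \<open>v \<noteq> 0\<^sub>v n\<close> by blast
  qed
  moreover have "b z z \<ge> 0" if "z \<in> carrier_vec n" for z
    unfolding sq[OF that] by (intro sum_nonneg scalar_prod_self_ge_0)
  ultimately have "pos_def n P"
    using P unfolding pos_def_def b_def by (metis less_eq_real_def)
  then show thesis using that[OF _ _ lyap] \<beta> by simp
qed

section \<open>Kronecker products and block matrices\<close>

lemma block_index_less:
  assumes "i < N" "k < (n :: nat)"
  shows "i * n + k < N * n"
proof -
  have "i * n + k < Suc i * n" using assms by simp
  also have "\<dots> \<le> N * n" using assms by (intro mult_right_mono) auto
  finally show ?thesis .
qed

lemma block_index_cases:
  assumes "t < N * (n :: nat)"
  obtains i k where "i < N" "k < n" "t = i * n + k"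
proof -
  have "n > 0" using assms by (cases n) auto
  then show thesis
    using that[of "t div n" "t mod n"] assms by (simp add: less_mult_imp_div_less)
qed

lemma kronecker_carrier [simp]:
  "A \<in> carrier_mat a b \<Longrightarrow> B \<in> carrier_mat c d \<Longrightarrow> kronecker A B \<in> carrier_mat (a * c) (b * d)"
  by (auto simp: kronecker_def)

lemma kronecker_index:
  assumes "A \<in> carrier_mat a b" "B \<in> carrier_mat c d" "i < a" "k < c" "j < b" "l < d"
  shows "kronecker A B $$ (i * c + k, j * d + l) = A $$ (i, j) * B $$ (k, l)"
  using assms block_index_less[of i a k c] block_index_less[of j b l d] by (simp add: kronecker_def)

lemma block_mat_eqI:
  assumes "A \<in> carrier_mat (a * c) (b * d)" "B \<in> carrier_mat (a * c) (b * d)"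
    and "\<And>i k j l. i < a \<Longrightarrow> k < c \<Longrightarrow> j < b \<Longrightarrow> l < d \<Longrightarrow>
      A $$ (i * c + k, j * d + l) = B $$ (i * c + k, j * d + l)"
  shows "A = B"
proof (rule eq_matI)
  fix s t assume "s < dim_row B" "t < dim_col B"
  then have "s < a * c" "t < b * d" using assms by auto
  then show "A $$ (s, t) = B $$ (s, t)"
    using assms(3) block_index_cases[of s a c] block_index_cases[of t b d] by metis
qed (use assms in auto)

lemma kronecker_mult:
  assumes A: "A \<in> carrier_mat a b" and B: "B \<in> carrier_mat c d"
    and A': "A' \<in> carrier_mat b e" and B': "B' \<in> carrier_mat d f"
  shows "kronecker A B * kronecker A' B' = kronecker (A * A') (B * B')"
proof (rule block_mat_eqI[of _ a c e f])
  note AB = kronecker_carrier[OF A B] and AB' = kronecker_carrier[OF A' B']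
  note AA = mult_carrier_mat[OF A A'] and BB = mult_carrier_mat[OF B B']
  show "kronecker A B * kronecker A' B' \<in> carrier_mat (a * c) (e * f)"
    by (rule mult_carrier_mat[OF AB AB'])
  show "kronecker (A * A') (B * B') \<in> carrier_mat (a * c) (e * f)"
    by (rule kronecker_carrier[OF AA BB])
  fix i k j l assume ij: "i < a" "k < c" "j < e" "l < f"
  have "(kronecker A B * kronecker A' B') $$ (i * c + k, j * f + l) =
      (\<Sum>t<b * d. kronecker A B $$ (i * c + k, t) * kronecker A' B' $$ (t, j * f + l))"
    by (rule mat_mult_index[OF AB AB' block_index_less[OF ij(1,2)] block_index_less[OF ij(3,4)]])
  also have "\<dots> = (\<Sum>s<b. \<Sum>t<d. (A $$ (i, s) * A' $$ (s, j)) * (B $$ (k, t) * B' $$ (t, l)))"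
    unfolding sum_blocks using ij
    by (intro sum.cong refl) (simp add: kronecker_index[OF A B] kronecker_index[OF A' B'])
  also have "\<dots> = (A * A') $$ (i, j) * (B * B') $$ (k, l)"
    unfolding mat_mult_index[OF A A' ij(1,3)] mat_mult_index[OF B B' ij(2,4)] sum_product ..
  finally show "(kronecker A B * kronecker A' B') $$ (i * c + k, j * f + l) =
      kronecker (A * A') (B * B') $$ (i * c + k, j * f + l)"
    using kronecker_index[OF AA BB] ij by simp
qed

lemma kronecker_add_left:
  assumes "A \<in> carrier_mat a b" "A' \<in> carrier_mat a b" "B \<in> carrier_mat c d"
  shows "kronecker (A + A') B = kronecker A B + kronecker A' B"
proof (rule block_mat_eqI[of _ a c b d])
  fix i k j l assume ij: "i < a" "k < c" "j < b" "l < d"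
  note idx = block_index_less[OF ij(1,2)] block_index_less[OF ij(3,4)]
  show "kronecker (A + A') B $$ (i * c + k, j * d + l) = (kronecker A B + kronecker A' B) $$ (i * c + k, j * d + l)"
    using ij idx assms carrier_matD[OF kronecker_carrier[OF assms(2,3)]]
    by (simp add: kronecker_index[of _ a b _ c d] distrib_right)
qed (use assms in auto)

lemma kronecker_add_right:
  assumes "A \<in> carrier_mat a b" "B \<in> carrier_mat c d" "B' \<in> carrier_mat c d"
  shows "kronecker A (B + B') = kronecker A B + kronecker A B'"
proof (rule block_mat_eqI[of _ a c b d])
  fix i k j l assume ij: "i < a" "k < c" "j < b" "l < d"
  note idx = block_index_less[OF ij(1,2)] block_index_less[OF ij(3,4)]
  show "kronecker A (B + B') $$ (i * c + k, j * d + l) = (kronecker A B + kronecker A B') $$ (i * c + k, j * d + l)"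
    using ij idx assms carrier_matD[OF kronecker_carrier[OF assms(1,3)]]
    by (simp add: kronecker_index[of _ a b _ c d] distrib_left)
qed (use assms in auto)

lemma kronecker_one: "kronecker (1\<^sub>m a) (1\<^sub>m b) = 1\<^sub>m (a * b)"
proof (rule block_mat_eqI[of _ a b a b])
  fix i k j l assume ij: "i < a" "k < b" "j < a" "l < b"
  have "(i * b + k = j * b + l) = (i = j \<and> k = l)"
  proof
    assume eq: "i * b + k = j * b + l"
    then have "(i * b + k) div b = (j * b + l) div b" "(i * b + k) mod b = (j * b + l) mod b" by simp_all
    then show "i = j \<and> k = l" using ij by simp
  qed auto
  then show "kronecker (1\<^sub>m a) (1\<^sub>m b) $$ (i * b + k, j * b + l) = 1\<^sub>m (a * b) $$ (i * b + k, j * b + l)"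
    using ij block_index_less[OF ij(1,2)] block_index_less[OF ij(3,4)]
    by (simp add: kronecker_index[of _ a a _ b b])
qed (auto simp: kronecker_def)

lemma kronecker_zero:
  assumes "A \<in> carrier_mat a b"
  shows "kronecker A (0\<^sub>m c d) = 0\<^sub>m (a * c) (b * d)" "kronecker (0\<^sub>m c d) A = 0\<^sub>m (c * a) (d * b)"
proof -
  show "kronecker A (0\<^sub>m c d) = 0\<^sub>m (a * c) (b * d)"
    using assms by (intro block_mat_eqI[of _ a c b d])
      (auto simp: kronecker_index[OF assms zero_carrier_mat] block_index_less)
  show "kronecker (0\<^sub>m c d) A = 0\<^sub>m (c * a) (d * b)"
    using assms by (intro block_mat_eqI[of _ c a d b])
      (auto simp: kronecker_index[OF zero_carrier_mat assms] block_index_less)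
qed

lemma diag_block_mat_carrier:
  assumes "\<And>i. i < N \<Longrightarrow> P i \<in> carrier_mat a b"
  shows "diag_block_mat (map P [0..<N]) \<in> carrier_mat (N * a) (N * b)"
  using assms
proof (induction N)
  case (Suc N)
  have D: "diag_block_mat (map P [0..<N]) \<in> carrier_mat (N * a) (N * b)" using Suc by simp
  have "P N \<in> carrier_mat a b" using Suc.prems by simp
  with D show ?case
    using four_block_carrier_mat[OF D] by (simp add: diag_block_mat_last Let_def add.commute)
qed simp

lemma diag_block_mat_index:
  assumes P: "\<And>i. i < N \<Longrightarrow> P i \<in> carrier_mat a b" and ij: "i < N" "k < a" "j < N" "l < b"
  shows "diag_block_mat (map P [0..<N]) $$ (i * a + k, j * b + l) = (if i = j then P i $$ (k, l) else 0)"
  using assms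
proof (induction N)
  case (Suc N)
  have D: "diag_block_mat (map P [0..<N]) \<in> carrier_mat (N * a) (N * b)"
    by (rule diag_block_mat_carrier) (use Suc in simp)
  have PN: "P N \<in> carrier_mat a b" using Suc.prems by simp
  have idx: "(i * a + k < N * a) = (i < N)" "(j * b + l < N * b) = (j < N)"
    using Suc.prems block_index_less[of i N k a] block_index_less[of j N l b]
    by (auto simp: not_less less_Suc_eq)
  have "i * a + k < N * a + a" "j * b + l < N * b + b"
    using block_index_less[OF Suc.prems(2,3)] block_index_less[OF Suc.prems(4,5)] by simp_all
  then have "diag_block_mat (map P [0..<Suc N]) $$ (i * a + k, j * b + l) =
      (if i < N then if j < N then diag_block_mat (map P [0..<N]) $$ (i * a + k, j * b + l) else 0
       else if j < N then 0 else P N $$ (i * a + k - N * a, j * b + l - N * b))"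
    using D PN Suc.prems(2-) by (auto simp: diag_block_mat_last Let_def idx)
  then show ?case
    using Suc by (auto simp: less_Suc_eq)
qed simp

definition block_vec :: "nat \<Rightarrow> real vec \<Rightarrow> nat \<Rightarrow> real vec" where
  "block_vec n v i = vec n (\<lambda>k. v $ (i * n + k))"

lemma block_vec_carrier [simp]: "block_vec n v i \<in> carrier_vec n"
  by (simp add: block_vec_def)

lemma block_vec_index [simp]: "k < n \<Longrightarrow> block_vec n v i $ k = v $ (i * n + k)"
  by (simp add: block_vec_def)

lemma scalar_prod_blocks:
  assumes "w \<in> carrier_vec (N * n)"
  shows "v \<bullet> w = (\<Sum>i<N. block_vec n v i \<bullet> block_vec n w i)"
  unfolding scalar_prod_sum[OF assms] sum_blocks by (simp add: scalar_prod_sum[of _ n])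

lemma block_vec_diag:
  assumes P: "\<And>i. i < N \<Longrightarrow> P i \<in> carrier_mat a b" and v: "v \<in> carrier_vec (N * b)" and j: "j < N"
  shows "block_vec a (diag_block_mat (map P [0..<N]) *\<^sub>v v) j = P j *\<^sub>v block_vec b v j"
proof (rule eq_vecI)
  note D = diag_block_mat_carrier[of N P a b, OF P]
  fix k assume "k < dim_vec (P j *\<^sub>v block_vec b v j)"
  then have k: "k < a" using P[OF j] by simp
  have "block_vec a (diag_block_mat (map P [0..<N]) *\<^sub>v v) j $ k =
      (\<Sum>i<N. \<Sum>l<b. diag_block_mat (map P [0..<N]) $$ (j * a + k, i * b + l) * v $ (i * b + l))"
    using k mat_mult_vec_index[OF D v block_index_less[OF j k]] by (simp add: sum_blocks)
  also have "\<dots> = (\<Sum>i<N. if j = i then (\<Sum>l<b. P i $$ (k, l) * v $ (i * b + l)) else 0)"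
    using j k by (intro sum.cong refl) (auto simp: diag_block_mat_index[of N P a b, OF P])
  also have "\<dots> = (P j *\<^sub>v block_vec b v j) $ k"
    using j mat_mult_vec_index[OF P[OF j] block_vec_carrier k] by simp
  finally show "block_vec a (diag_block_mat (map P [0..<N]) *\<^sub>v v) j $ k = (P j *\<^sub>v block_vec b v j) $ k" .
qed (use P[OF j] in \<open>simp add: block_vec_def\<close>)

text \<open>Evaluates the Lyapunov form block by block: with the identity for \<open>H\<close> it
  gives the drift term, with the grounded Laplacian the coupling term. Feasibility and stability
  both rest on it.\<close>

lemma scalar_prod_kronecker_diag:
  assumes H: "H \<in> carrier_mat N N" and B: "B \<in> carrier_mat n m"
    and F: "\<And>i. i < N \<Longrightarrow> F i \<in> carrier_mat m b"
    and w: "w \<in> carrier_vec (N * b)"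
  shows "v \<bullet> (kronecker H B * diag_block_mat (map F [0..<N]) *\<^sub>v w) =
    (\<Sum>i<N. \<Sum>j<N. H $$ (i, j) * (block_vec n v i \<bullet> (B *\<^sub>v (F j *\<^sub>v block_vec b w j))))"
proof -
  note D = diag_block_mat_carrier[of N F m b, OF F]
  note HB = kronecker_carrier[OF H B]
  define y where "y = diag_block_mat (map F [0..<N]) *\<^sub>v w"
  have y: "y \<in> carrier_vec (N * m)" unfolding y_def by (rule mult_mat_vec_carrier[OF D w])
  have By: "B *\<^sub>v block_vec m y j \<in> carrier_vec n" for j by (rule mult_mat_vec_carrier[OF B block_vec_carrier])
  have comp: "(kronecker H B *\<^sub>v y) $ (i * n + k) = (\<Sum>j<N. H $$ (i, j) * (B *\<^sub>v block_vec m y j) $ k)"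
    if ik: "i < N" "k < n" for i k
  proof -
    have "(kronecker H B *\<^sub>v y) $ (i * n + k) = (\<Sum>j<N. \<Sum>l<m. kronecker H B $$ (i * n + k, j * m + l) * y $ (j * m + l))"
      using mat_mult_vec_index[OF HB y block_index_less[OF ik]] by (simp add: sum_blocks)
    also have "\<dots> = (\<Sum>j<N. \<Sum>l<m. H $$ (i, j) * (B $$ (k, l) * y $ (j * m + l)))"
      using ik by (intro sum.cong refl) (simp add: kronecker_index[OF H B])
    finally show ?thesis
      using mat_mult_vec_index[OF B block_vec_carrier ik(2)] by (simp add: sum_distrib_left)
  qed
  have "v \<bullet> (kronecker H B *\<^sub>v y) = (\<Sum>i<N. \<Sum>k<n. v $ (i * n + k) * (\<Sum>j<N. H $$ (i, j) * (B *\<^sub>v block_vec m y j) $ k))"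
    unfolding scalar_prod_sum[OF mult_mat_vec_carrier[OF HB y]] sum_blocks
    by (intro sum.cong refl) (simp add: comp)
  also have "\<dots> = (\<Sum>i<N. \<Sum>j<N. \<Sum>k<n. v $ (i * n + k) * (H $$ (i, j) * (B *\<^sub>v block_vec m y j) $ k))"
    unfolding sum_distrib_left by (intro sum.cong refl sum.swap)
  also have "\<dots> = (\<Sum>i<N. \<Sum>j<N. H $$ (i, j) * (block_vec n v i \<bullet> (B *\<^sub>v block_vec m y j)))"
    by (intro sum.cong refl) (simp add: scalar_prod_sum[OF By] sum_distrib_left mult.left_commute)
  also have "\<dots> = (\<Sum>i<N. \<Sum>j<N. H $$ (i, j) * (block_vec n v i \<bullet> (B *\<^sub>v (F j *\<^sub>v block_vec b w j))))"
    by (intro sum.cong refl) (simp add: y_def block_vec_diag[of N F m b, OF F w])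
  finally show ?thesis
    by (simp add: y_def assoc_mult_mat_vec[OF HB D w])
qed

section \<open>The design problem\<close>

lemma append_cols_carrier [simp]:
  "X \<in> carrier_mat r a \<Longrightarrow> Y \<in> carrier_mat r b \<Longrightarrow> append_cols X Y \<in> carrier_mat r (a + b)"
  by (auto simp: append_cols_def)

lemma append_cols_index:
  assumes "X \<in> carrier_mat r a" "Y \<in> carrier_mat r b" "i < r" "j < a + b"
  shows "append_cols X Y $$ (i, j) = (if j < a then X $$ (i, j) else Y $$ (i, j - a))"
  using assms by (auto simp: append_cols_def)

text \<open>The right factors select the two groups of columns. For the pinned Laplacian this
  separates the leader column from the grounded part.\<close>

lemma append_cols_decompose:
  assumes X: "X \<in> carrier_mat r a" and Y: "Y \<in> carrier_mat r b"
  shows "append_cols X Y = X * append_cols (1\<^sub>m a) (0\<^sub>m a b) + Y * append_cols (0\<^sub>m b a) (1\<^sub>m b)"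
proof (rule eq_matI)
  have 1: "append_cols (1\<^sub>m a) (0\<^sub>m a b) \<in> carrier_mat a (a + b)"
    and 2: "append_cols (0\<^sub>m b a) (1\<^sub>m b) \<in> carrier_mat b (a + b)" by simp_all
  note XY = mult_carrier_mat[OF X 1] mult_carrier_mat[OF Y 2]
  fix i j assume "i < dim_row (X * append_cols (1\<^sub>m a) (0\<^sub>m a b) + Y * append_cols (0\<^sub>m b a) (1\<^sub>m b))"
    "j < dim_col (X * append_cols (1\<^sub>m a) (0\<^sub>m a b) + Y * append_cols (0\<^sub>m b a) (1\<^sub>m b))"
  then have ij: "i < r" "j < a + b" using XY by auto
  have x: "(X * append_cols (1\<^sub>m a) (0\<^sub>m a b)) $$ (i, j) = (if j < a then X $$ (i, j) else 0)"
  proof -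
    have "(X * append_cols (1\<^sub>m a) (0\<^sub>m a b)) $$ (i, j) = (\<Sum>k<a. if k = j then X $$ (i, k) else 0)"
      unfolding mat_mult_index[OF X 1 ij]
      using ij by (intro sum.cong refl) (auto simp: append_cols_index[of _ a a _ b])
    then show ?thesis by simp
  qed
  have y: "(Y * append_cols (0\<^sub>m b a) (1\<^sub>m b)) $$ (i, j) = (if j < a then 0 else Y $$ (i, j - a))"
  proof -
    have "(Y * append_cols (0\<^sub>m b a) (1\<^sub>m b)) $$ (i, j) = (\<Sum>k<b. if k = j - a \<and> \<not> j < a then Y $$ (i, k) else 0)"
      unfolding mat_mult_index[OF Y 2 ij]
      using ij by (intro sum.cong refl) (auto simp: append_cols_index[of _ b a _ b])
    then show ?thesis using ij by (cases "j < a") auto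
  qed
  show "append_cols X Y $$ (i, j) =
      (X * append_cols (1\<^sub>m a) (0\<^sub>m a b) + Y * append_cols (0\<^sub>m b a) (1\<^sub>m b)) $$ (i, j)"
    using append_cols_index[OF X Y ij] x y carrier_matD[OF XY(2)] ij by simp
qed (use assms in \<open>auto simp: append_cols_def\<close>)

lemma append_cols_select_right:
  assumes X: "X \<in> carrier_mat r a" and Y: "Y \<in> carrier_mat r b"
  shows "append_cols X Y * transpose_mat (append_cols (0\<^sub>m b a) (1\<^sub>m b)) = Y"
proof (rule eq_matI)
  have XY: "append_cols X Y \<in> carrier_mat r (a + b)" using X Y by simp
  have I: "append_cols (0\<^sub>m b a) (1\<^sub>m b) \<in> carrier_mat b (a + b)" by simp
  have It: "transpose_mat (append_cols (0\<^sub>m b a) (1\<^sub>m b)) \<in> carrier_mat (a + b) b" using I by simp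
  fix i j assume "i < dim_row Y" "j < dim_col Y"
  then have ij: "i < r" "j < b" using Y by auto
  have "(append_cols X Y * transpose_mat (append_cols (0\<^sub>m b a) (1\<^sub>m b))) $$ (i, j) =
      (\<Sum>k<a + b. if k = a + j then Y $$ (i, j) else 0)"
    unfolding mat_mult_index[OF XY It ij]
    using ij carrier_matD[OF I] by (intro sum.cong refl)
      (auto simp: append_cols_index[OF X Y] append_cols_index[of _ b a _ b])
  then show "(append_cols X Y * transpose_mat (append_cols (0\<^sub>m b a) (1\<^sub>m b))) $$ (i, j) = Y $$ (i, j)"
    using ij by simp
qed (use assms in \<open>auto simp: append_cols_def\<close>)

text \<open>Writes the matrix of the zero-input constraint of the leader as a Kronecker product, so
  that the mixed product rule applies to it.\<close>

lemma kronecker_first_unit: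
  assumes U: "U \<in> carrier_mat m M"
  shows "kronecker (append_cols (1\<^sub>m 1) (0\<^sub>m 1 N)) U = append_cols U (0\<^sub>m m (M * N))"
proof (rule block_mat_eqI[of _ 1 m "N + 1" M])
  have e: "append_cols (1\<^sub>m 1) (0\<^sub>m 1 N) \<in> carrier_mat 1 (1 + N)" by (rule append_cols_carrier) simp_all
  have Z: "(0\<^sub>m m (M * N) :: real mat) \<in> carrier_mat m (M * N)" by simp
  show "kronecker (append_cols (1\<^sub>m 1) (0\<^sub>m 1 N)) U \<in> carrier_mat (1 * m) ((N + 1) * M)"
    using kronecker_carrier[OF e U] by (simp add: add.commute)
  show "append_cols U (0\<^sub>m m (M * N)) \<in> carrier_mat (1 * m) ((N + 1) * M)"
    using append_cols_carrier[OF U Z] by (simp add: algebra_simps)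
  fix i k j l assume ij: "i < (1::nat)" "k < m" "j < N + 1" "l < M"
  have "j * M + l < (N + 1) * M" by (rule block_index_less[OF ij(3,4)])
  then have "j * M + l < M + M * N" by (simp add: algebra_simps)
  then show "kronecker (append_cols (1\<^sub>m 1) (0\<^sub>m 1 N)) U $$ (i * m + k, j * M + l) =
      append_cols U (0\<^sub>m m (M * N)) $$ (i * m + k, j * M + l)"
    using ij kronecker_index[OF e U, of i k j l] append_cols_index[OF U Z ij(2), of "j * M + l"]
      append_cols_index[of "1\<^sub>m 1" 1 1 "0\<^sub>m 1 N" N i j]
    by (cases j) (auto simp: algebra_simps)
qed

context
  fixes N :: nat and W :: "real mat" and g :: "real vec"
  assumes W: "W \<in> carrier_mat N N"
begin

private abbreviation "Lg \<equiv> pinned_laplacian N W g"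
private abbreviation "Ig \<equiv> pinned_identity N"
private abbreviation "H \<equiv> grounded_laplacian N W g"
private abbreviation "e0 \<equiv> append_cols (1\<^sub>m 1) (0\<^sub>m 1 N) :: real mat"

lemma pinned_carrier:
  "Lg \<in> carrier_mat N (N + 1)" "Ig \<in> carrier_mat N (N + 1)" "e0 \<in> carrier_mat 1 (N + 1)"
proof -
  have "mat_of_cols N [- g] \<in> carrier_mat N 1" using mat_of_cols_carrier(1)[of N "[- g]"] by simp
  then show "Lg \<in> carrier_mat N (N + 1)"
    unfolding pinned_laplacian_def grounded_laplacian_def[symmetric] add.commute[of N 1]
    by (rule append_cols_carrier) (use W in simp)
  show "Ig \<in> carrier_mat N (N + 1)" "e0 \<in> carrier_mat 1 (N + 1)"
    unfolding pinned_identity_def add.commute[of N 1] by (rule append_cols_carrier; simp)+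
qed

lemma pinned_decompose: "Lg = mat_of_cols N [- g] * e0 + H * Ig"
  unfolding pinned_laplacian_def pinned_identity_def grounded_laplacian_def[symmetric]
  by (rule append_cols_decompose) (use W mat_of_cols_carrier(1)[of N "[- g]"] in auto)

lemma pinned_select:
  "Lg * transpose_mat Ig = H" "Ig * transpose_mat Ig = 1\<^sub>m N" "e0 * transpose_mat Ig = 0\<^sub>m 1 N"
  unfolding pinned_laplacian_def pinned_identity_def grounded_laplacian_def[symmetric]
  by (rule append_cols_select_right,
      use W mat_of_cols_carrier(1)[of N "[- g]"] in auto)+

text \<open>The mixed product rule pulls \<open>A\<close> and \<open>B\<close> out to the left. In
  the input part the leader column \<open>- g\<close> multiplies exactly the block that
  \<open>eq0\<close> annihilates, so only the grounded Laplacian couples the gains.\<close>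

lemma design_lyapunov_matrix:
  assumes A: "A \<in> carrier_mat n n" and B: "B \<in> carrier_mat n m"
    and X: "X \<in> carrier_mat n M" and U: "U \<in> carrier_mat m M"
    and \<Lambda>: "\<Lambda> \<in> carrier_mat (M * (N + 1)) (n * N)"
    and eqP: "kronecker Lg X * \<Lambda> = Pd" and eq0: "append_cols U (0\<^sub>m m (M * N)) * \<Lambda> = 0\<^sub>m m (n * N)"
    and eqF: "kronecker Ig U * \<Lambda> = Fd"
  shows "kronecker Lg (A * X + B * U) * \<Lambda> = kronecker (1\<^sub>m N) A * Pd + kronecker H B * Fd"
proof -
  note c = pinned_carrier
  have H: "H \<in> carrier_mat N N" using W by simp
  have G: "mat_of_cols N [- g] \<in> carrier_mat N 1" using mat_of_cols_carrier(1)[of N "[- g]"] by simp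
  have L: "\<Lambda> \<in> carrier_mat ((N + 1) * M) (n * N)" using \<Lambda> by (simp add: mult.commute)
  have AX: "A * X \<in> carrier_mat n M" and BU: "B * U \<in> carrier_mat n M" using A B X U by auto
  have K: "kronecker Lg (A * X) \<in> carrier_mat (N * n) ((N + 1) * M)"
    "kronecker Lg (B * U) \<in> carrier_mat (N * n) ((N + 1) * M)"
    using kronecker_carrier[OF c(1) AX] kronecker_carrier[OF c(1) BU] by simp_all
  have 1: "kronecker Lg (A * X) = kronecker (1\<^sub>m N) A * kronecker Lg X"
    using kronecker_mult[OF one_carrier_mat A c(1) X] c(1) by simp
  have Ge: "mat_of_cols N [- g] * e0 \<in> carrier_mat N (N + 1)" by (rule mult_carrier_mat[OF G c(3)])
  have HI: "H * Ig \<in> carrier_mat N (N + 1)" by (rule mult_carrier_mat[OF H c(2)])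
  have 2: "kronecker Lg (B * U) = kronecker (mat_of_cols N [- g]) B * append_cols U (0\<^sub>m m (M * N))
      + kronecker H B * kronecker Ig U"
    unfolding pinned_decompose kronecker_add_left[OF Ge HI BU]
      kronecker_mult[OF G B c(3) U, symmetric] kronecker_mult[OF H B c(2) U, symmetric]
      kronecker_first_unit[OF U] ..
  have GB: "kronecker (mat_of_cols N [- g]) B \<in> carrier_mat (N * n) m"
    using kronecker_carrier[OF G B] by simp
  have U0: "append_cols U (0\<^sub>m m (M * N)) \<in> carrier_mat m ((N + 1) * M)"
    using append_cols_carrier[OF U zero_carrier_mat[of m "M * N"]] by (simp add: algebra_simps)
  note IA = kronecker_carrier[OF one_carrier_mat A, of N] and LX = kronecker_carrier[OF c(1) X]
    and HB = kronecker_carrier[OF H B] and IU = kronecker_carrier[OF c(2) U]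
  have "kronecker Lg (A * X + B * U) * \<Lambda> = kronecker Lg (A * X) * \<Lambda> + kronecker Lg (B * U) * \<Lambda>"
    unfolding kronecker_add_right[OF c(1) AX BU] by (rule add_mult_distrib_mat[OF K L])
  also have "kronecker Lg (A * X) * \<Lambda> = kronecker (1\<^sub>m N) A * Pd"
    unfolding 1 assoc_mult_mat[OF IA LX L] eqP ..
  also have "kronecker Lg (B * U) * \<Lambda> = kronecker (mat_of_cols N [- g]) B * 0\<^sub>m m (n * N) + kronecker H B * Fd"
    unfolding 2 add_mult_distrib_mat[OF mult_carrier_mat[OF GB U0] mult_carrier_mat[OF HB IU] L]
      assoc_mult_mat[OF GB U0 L] assoc_mult_mat[OF HB IU L] eq0 eqF ..
  also have "\<dots> = kronecker H B * Fd"
  proof -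
    have "Fd \<in> carrier_mat (N * m) (n * N)" unfolding eqF[symmetric] by (rule mult_carrier_mat[OF IU L])
    then have "kronecker H B * Fd \<in> carrier_mat (N * n) (n * N)" by (rule mult_carrier_mat[OF HB])
    then show ?thesis using GB by simp
  qed
  finally show ?thesis .
qed

text \<open>The right-hand sides \<open>Pd\<close> and \<open>Fd\<close> are arbitrary: the three
  linear constraints can be met for any of them, so only the matrix inequality restricts the
  design.\<close>

lemma design_exists_for_blocks:
  assumes X: "X \<in> carrier_mat n M" and U: "U \<in> carrier_mat m M"
    and R: "Rx \<in> carrier_mat M n" "Ru \<in> carrier_mat M m"
      "X * Rx = 1\<^sub>m n" "X * Ru = 0\<^sub>m n m" "U * Rx = 0\<^sub>m m n" "U * Ru = 1\<^sub>m m"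
    and K: "K \<in> carrier_mat N N" "H * K = 1\<^sub>m N"
    and Pd: "Pd \<in> carrier_mat (N * n) (n * N)" and Fd: "Fd \<in> carrier_mat (N * m) (n * N)"
  obtains \<Lambda> where "\<Lambda> \<in> carrier_mat (M * (N + 1)) (n * N)" "kronecker Lg X * \<Lambda> = Pd"
    "append_cols U (0\<^sub>m m (M * N)) * \<Lambda> = 0\<^sub>m m (n * N)" "kronecker Ig U * \<Lambda> = Fd"
proof -
  note c = pinned_carrier
  have It: "transpose_mat Ig \<in> carrier_mat (N + 1) N" using c by simp
  have IK: "transpose_mat Ig * K \<in> carrier_mat (N + 1) N" by (rule mult_carrier_mat[OF It K(1)])
  note k1 = kronecker_carrier[OF IK R(1)] and k2 = kronecker_carrier[OF It R(2)]
  \<comment> \<open>The leader block is zero, as the transpose of \<open>Ig\<close> has a zero first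
    row. \<open>K\<close> cancels the \<open>H\<close> that \<open>Lg\<close> produces in the state
    equation; \<open>X * Ru = 0\<close> and \<open>U * Rx = 0\<close> keep the two summands from
    interfering.\<close>
  define \<Lambda> where "\<Lambda> = kronecker (transpose_mat Ig * K) Rx * Pd + kronecker (transpose_mat Ig) Ru * Fd"
  have prod: "kronecker Q Y * \<Lambda> = kronecker (Q * transpose_mat Ig * K) (Y * Rx) * Pd
      + kronecker (Q * transpose_mat Ig) (Y * Ru) * Fd"
    if Q: "Q \<in> carrier_mat a (N + 1)" and Y: "Y \<in> carrier_mat b M" for Q Y a b
  proof -
    note QY = kronecker_carrier[OF Q Y]
    show ?thesis
      unfolding \<Lambda>_def mult_add_distrib_mat[OF QY mult_carrier_mat[OF k1 Pd] mult_carrier_mat[OF k2 Fd]]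
        assoc_mult_mat[OF QY k1 Pd, symmetric] assoc_mult_mat[OF QY k2 Fd, symmetric]
        kronecker_mult[OF Q Y IK R(1)] kronecker_mult[OF Q Y It R(2)] assoc_mult_mat[OF Q It K(1)] ..
  qed
  have H: "H \<in> carrier_mat N N" using W by simp
  show thesis
  proof (rule that[of \<Lambda>])
    show "\<Lambda> \<in> carrier_mat (M * (N + 1)) (n * N)"
      using mult_carrier_mat[OF k2 Fd] unfolding \<Lambda>_def by (simp add: mult.commute)
    show "kronecker Lg X * \<Lambda> = Pd"
      unfolding prod[OF c(1) X] pinned_select R K kronecker_one kronecker_zero[OF H] using Pd Fd by simp
    show "kronecker Ig U * \<Lambda> = Fd"
      unfolding prod[OF c(2) U] pinned_select R using Pd Fd K(1)
      by (simp add: kronecker_one kronecker_zero[OF K(1)])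
    show "append_cols U (0\<^sub>m m (M * N)) * \<Lambda> = 0\<^sub>m m (n * N)"
      unfolding kronecker_first_unit[OF U, symmetric] prod[OF c(3) U] pinned_select R
        left_mult_zero_mat[OF K(1)] kronecker_zero(2)[OF zero_carrier_mat] kronecker_zero(2)[OF one_carrier_mat]
      using Pd Fd by simp
  qed
qed

end

section \<open>The matrix inequality as a statement about quadratic forms\<close>

lemma neg_def_sym_part:
  assumes Y: "Y \<in> carrier_mat d d"
  shows "neg_def d (Y + transpose_mat Y) \<longleftrightarrow> (\<forall>v \<in> carrier_vec d. v \<noteq> 0\<^sub>v d \<longrightarrow> v \<bullet> (Y *\<^sub>v v) < 0)"
proof -
  have Yt: "transpose_mat Y \<in> carrier_mat d d" using Y by simp
  have form: "v \<bullet> ((Y + transpose_mat Y) *\<^sub>v v) = 2 * (v \<bullet> (Y *\<^sub>v v))" if v: "v \<in> carrier_vec d" for v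
  proof -
    have "v \<bullet> (transpose_mat Y *\<^sub>v v) = v \<bullet> (Y *\<^sub>v v)"
      using scalar_prod_transpose[OF Y v v] comm_scalar_prod[of v d "transpose_mat Y *\<^sub>v v"] v Yt by simp
    then show ?thesis
      unfolding add_mult_distrib_mat_vec[OF Y Yt v]
      using scalar_prod_add_distrib[OF v mult_mat_vec_carrier[OF Y v] mult_mat_vec_carrier[OF Yt v]] by simp
  qed
  have "transpose_mat (Y + transpose_mat Y) = Y + transpose_mat Y"
    using transpose_add[OF Y Yt] comm_add_mat[OF Yt Y] by simp
  then show ?thesis using Y form by (auto simp: neg_def_def)
qed

text \<open>Put \<open>b i = B\<^sup>T z i\<close> for the blocks \<open>z i\<close> of
  \<open>v\<close>. The coupling term is at most \<open>- c\<close> times the sum of the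
  \<open>e i * (b i \<bullet> b i)\<close>, the drift term is bounded by \<open>lyap\<close>, and
  \<open>c\<close> absorbs the squares of \<open>b\<close>, leaving minus the sum of the
  \<open>q i * (z i \<bullet> P z i)\<close>.\<close>

lemma design_form_neg:
  assumes A: "A \<in> carrier_mat n n" and B: "B \<in> carrier_mat n m" and H: "H \<in> carrier_mat N N"
    and q: "\<And>i. i < N \<Longrightarrow> q i > 0" and e: "\<And>i. i < N \<Longrightarrow> e i > 0"
    and stab: "\<And>z :: nat \<Rightarrow> real. (\<Sum>i<N. e i * (z i)\<^sup>2) \<le> (\<Sum>i<N. \<Sum>j<N. H $$ (i, j) * q j * (z i * z j))"
    and P: "pos_def n P" and \<kappa>: "\<kappa> > 0"
    and lyap: "\<And>z. z \<in> carrier_vec n \<Longrightarrow> z \<bullet> (A *\<^sub>v (P *\<^sub>v z)) + z \<bullet> (P *\<^sub>v z) \<le>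
      \<kappa> * ((transpose_mat B *\<^sub>v z) \<bullet> (transpose_mat B *\<^sub>v z))"
    and c: "\<And>i. i < N \<Longrightarrow> \<kappa> * q i \<le> c * e i" "c \<ge> 0"
    and v: "v \<in> carrier_vec (N * n)" "v \<noteq> 0\<^sub>v (N * n)"
  defines "Pd \<equiv> diag_block_mat (map (\<lambda>i. q i \<cdot>\<^sub>m P) [0..<N])"
    and "Fd \<equiv> diag_block_mat (map (\<lambda>i. (- (c * q i)) \<cdot>\<^sub>m transpose_mat B) [0..<N])"
  shows "v \<bullet> ((kronecker (1\<^sub>m N) A * Pd + kronecker H B * Fd) *\<^sub>v v) < 0"
proof -
  have Pc: "P \<in> carrier_mat n n" using P by (simp add: pos_def_def)
  have Bt: "transpose_mat B \<in> carrier_mat m n" using B by simp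
  have Pdc: "Pd \<in> carrier_mat (N * n) (N * n)" unfolding Pd_def by (rule diag_block_mat_carrier) (use Pc in simp)
  have Fdc: "Fd \<in> carrier_mat (N * m) (N * n)" unfolding Fd_def by (rule diag_block_mat_carrier) (use Bt in simp)
  define z where "z = block_vec n v"
  define b where "b i = transpose_mat B *\<^sub>v z i" for i
  have z: "z i \<in> carrier_vec n" and b: "b i \<in> carrier_vec m" for i
    using Bt by (simp_all add: z_def b_def)
  have Pz: "P *\<^sub>v z i \<in> carrier_vec n" for i using mult_mat_vec_carrier[OF Pc z] .
  have APz: "A *\<^sub>v (P *\<^sub>v z i) \<in> carrier_vec n" for i using mult_mat_vec_carrier[OF A Pz] .
  have sm: "(s \<cdot>\<^sub>m Q) *\<^sub>v w = s \<cdot>\<^sub>v (Q *\<^sub>v w)" if "Q \<in> carrier_mat r n" "w \<in> carrier_vec n" for s :: real and Q r w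
    using that by (intro eq_vecI) (auto simp: row_smult)
  have 1: "v \<bullet> (kronecker (1\<^sub>m N) A * Pd *\<^sub>v v) = (\<Sum>i<N. q i * (z i \<bullet> (A *\<^sub>v (P *\<^sub>v z i))))"
  proof -
    have "v \<bullet> (kronecker (1\<^sub>m N) A * Pd *\<^sub>v v) =
        (\<Sum>i<N. \<Sum>j<N. (1\<^sub>m N) $$ (i, j) * (z i \<bullet> (A *\<^sub>v ((q j \<cdot>\<^sub>m P) *\<^sub>v z j))))"
      unfolding Pd_def z_def by (rule scalar_prod_kronecker_diag[OF one_carrier_mat A _ v(1)]) (use Pc in simp)
    also have "\<dots> = (\<Sum>i<N. \<Sum>j<N. if i = j then q i * (z i \<bullet> (A *\<^sub>v (P *\<^sub>v z i))) else 0)"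
      by (intro sum.cong refl)
        (auto simp: sm[OF Pc z] mult_mat_vec[OF A Pz] scalar_prod_smult_distrib[OF z APz])
    finally show ?thesis by simp
  qed
  have 2: "v \<bullet> (kronecker H B * Fd *\<^sub>v v) = - c * (\<Sum>i<N. \<Sum>j<N. H $$ (i, j) * q j * (b i \<bullet> b j))"
  proof -
    have "v \<bullet> (kronecker H B * Fd *\<^sub>v v) =
        (\<Sum>i<N. \<Sum>j<N. H $$ (i, j) * (z i \<bullet> (B *\<^sub>v (((- (c * q j)) \<cdot>\<^sub>m transpose_mat B) *\<^sub>v z j))))"
      unfolding Fd_def z_def by (rule scalar_prod_kronecker_diag[OF H B _ v(1)]) (use Bt in simp)
    also have "\<dots> = (\<Sum>i<N. \<Sum>j<N. - c * (H $$ (i, j) * q j * (b i \<bullet> b j)))"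
    proof (intro sum.cong refl)
      fix i j
      have "z i \<bullet> (B *\<^sub>v b j) = b i \<bullet> b j"
        using scalar_prod_transpose[OF B z b, of i j] by (simp add: b_def)
      moreover have "B *\<^sub>v b j \<in> carrier_vec n" by (rule mult_mat_vec_carrier[OF B b])
      ultimately have "z i \<bullet> (B *\<^sub>v (((- (c * q j)) \<cdot>\<^sub>m transpose_mat B) *\<^sub>v z j)) = - (c * q j) * (b i \<bullet> b j)"
        using z[of i] by (simp add: sm[OF Bt z] b_def[symmetric] mult_mat_vec[OF B b])
      then show "H $$ (i, j) * (z i \<bullet> (B *\<^sub>v (((- (c * q j)) \<cdot>\<^sub>m transpose_mat B) *\<^sub>v z j))) =
          - c * (H $$ (i, j) * q j * (b i \<bullet> b j))" by simp
    qed
    finally show ?thesis by (simp add: sum_distrib_left)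
  qed
  \<comment> \<open>The scalar inequality \<open>stab\<close> is applied to each of the
    \<open>m\<close> coordinates of the vectors \<open>b i\<close> and summed.\<close>
  have "(\<Sum>i<N. e i * (b i \<bullet> b i)) = (\<Sum>k<m. \<Sum>i<N. e i * (b i $ k)\<^sup>2)"
    by (subst sum.swap) (simp add: scalar_prod_sum[OF b] sum_distrib_left power2_eq_square)
  also have "\<dots> \<le> (\<Sum>k<m. \<Sum>i<N. \<Sum>j<N. H $$ (i, j) * q j * (b i $ k * b j $ k))"
    by (intro sum_mono stab)
  also have "\<dots> = (\<Sum>i<N. \<Sum>k<m. \<Sum>j<N. H $$ (i, j) * q j * (b i $ k * b j $ k))"
    by (rule sum.swap)
  also have "\<dots> = (\<Sum>i<N. \<Sum>j<N. H $$ (i, j) * q j * (b i \<bullet> b j))"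
    by (rule sum.cong[OF refl], subst sum.swap) (simp add: scalar_prod_sum[OF b] sum_distrib_left)
  finally have 3: "(\<Sum>i<N. e i * (b i \<bullet> b i)) \<le> (\<Sum>i<N. \<Sum>j<N. H $$ (i, j) * q j * (b i \<bullet> b j))" .
  have 4: "(\<Sum>i<N. q i * (z i \<bullet> (A *\<^sub>v (P *\<^sub>v z i)))) \<le>
      (\<Sum>i<N. c * (e i * (b i \<bullet> b i)) - q i * (z i \<bullet> (P *\<^sub>v z i)))"
  proof (rule sum_mono)
    fix i assume "i \<in> {..<N}"
    then have i: "i < N" by simp
    have "q i * (z i \<bullet> (A *\<^sub>v (P *\<^sub>v z i)) + z i \<bullet> (P *\<^sub>v z i)) \<le> q i * (\<kappa> * (b i \<bullet> b i))"
      using lyap[OF z, of i] q[OF i] by (simp add: b_def)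
    also have "\<dots> = (\<kappa> * q i) * (b i \<bullet> b i)" by simp
    also have "\<dots> \<le> (c * e i) * (b i \<bullet> b i)" using c(1)[OF i] scalar_prod_self_ge_0 by (rule mult_right_mono)
    finally show "q i * (z i \<bullet> (A *\<^sub>v (P *\<^sub>v z i))) \<le> c * (e i * (b i \<bullet> b i)) - q i * (z i \<bullet> (P *\<^sub>v z i))"
      by (simp add: algebra_simps)
  qed
  have zPz: "z i \<bullet> (P *\<^sub>v z i) \<ge> 0" for i
  proof (cases "z i = 0\<^sub>v n")
    case True
    then show ?thesis using Pz[of i] by (metis order_refl scalar_prod_left_zero)
  next
    case False
    then show ?thesis using P z[of i] unfolding pos_def_def by (metis less_eq_real_def)
  qed
  have "(\<Sum>i<N. q i * (z i \<bullet> (P *\<^sub>v z i))) > 0"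
  proof -
    obtain t where t: "t < N * n" "v $ t \<noteq> 0"
      using v by (metis eq_vecI carrier_vecD index_zero_vec)
    then obtain i k where ik: "i < N" "k < n" "t = i * n + k" by (metis block_index_cases)
    then have "z i \<noteq> 0\<^sub>v n" using t by (auto simp: z_def dest: arg_cong[of _ _ "\<lambda>w. w $ k"])
    then have "z i \<bullet> (P *\<^sub>v z i) > 0" using P z unfolding pos_def_def by blast
    then have "q i * (z i \<bullet> (P *\<^sub>v z i)) > 0" using q[OF ik(1)] by simp
    then show ?thesis
      using ik(1) q zPz by (intro sum_pos2[of _ i]) (auto simp: less_imp_le)
  qed
  moreover have "v \<bullet> ((kronecker (1\<^sub>m N) A * Pd + kronecker H B * Fd) *\<^sub>v v) =
      v \<bullet> (kronecker (1\<^sub>m N) A * Pd *\<^sub>v v) + v \<bullet> (kronecker H B * Fd *\<^sub>v v)"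
  proof -
    note Y = mult_carrier_mat[OF kronecker_carrier[OF one_carrier_mat A] Pdc]
      mult_carrier_mat[OF kronecker_carrier[OF H B] Fdc]
    show ?thesis
      unfolding add_mult_distrib_mat_vec[OF Y v(1)]
      by (rule scalar_prod_add_distrib[OF v(1) mult_mat_vec_carrier[OF Y(1) v(1)] mult_mat_vec_carrier[OF Y(2) v(1)]])
  qed
  moreover have "c * (\<Sum>i<N. e i * (b i \<bullet> b i)) \<le> c * (\<Sum>i<N. \<Sum>j<N. H $$ (i, j) * q j * (b i \<bullet> b j))"
    using 3 c(2) by (rule mult_left_mono)
  ultimately show ?thesis
    using 4 unfolding 1 2 sum_subtractf sum_distrib_left[symmetric] by linarith
qed

lemma pos_def_smult:
  assumes "pos_def n P" "(q :: real) > 0"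
  shows "pos_def n (q \<cdot>\<^sub>m P)"
proof -
  have P: "P \<in> carrier_mat n n" using assms by (simp add: pos_def_def)
  have "v \<bullet> ((q \<cdot>\<^sub>m P) *\<^sub>v v) = q * (v \<bullet> (P *\<^sub>v v))" if v: "v \<in> carrier_vec n" for v
  proof -
    have "(q \<cdot>\<^sub>m P) *\<^sub>v v = q \<cdot>\<^sub>v (P *\<^sub>v v)" using P v by (intro eq_vecI) (auto simp: row_smult)
    then show ?thesis using scalar_prod_smult_distrib[OF v mult_mat_vec_carrier[OF P v]] by simp
  qed
  moreover have "transpose_mat (q \<cdot>\<^sub>m P) = q \<cdot>\<^sub>m transpose_mat P" by (intro eq_matI) auto
  ultimately show ?thesis using assms by (simp add: pos_def_def)
qed

text \<open>The product of \<open>V\<close> with \<open>exp (a t)\<close> has nonpositive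
  derivative. Derivatives are one-sided at 0, so monotonicity is drawn from interior points together
  with continuity.\<close>

lemma exponential_decay:
  fixes V V' :: "real \<Rightarrow> real"
  assumes deriv: "\<And>t. t \<ge> 0 \<Longrightarrow> (V has_vector_derivative V' t) (at t within {0..})"
    and le: "\<And>t. t \<ge> 0 \<Longrightarrow> V' t \<le> - a * V t" and t: "t \<ge> 0"
  shows "V t \<le> V 0 * exp (- a * t)"
proof -
  define f where "f s = V s * exp (a * s)" for s
  have df: "(f has_real_derivative (V' s + a * V s) * exp (a * s)) (at s within {0..})" if "s \<ge> 0" for s
    unfolding f_def
    by (auto intro!: derivative_eq_intros deriv[OF that, folded has_real_derivative_iff_has_vector_derivative]
        simp: algebra_simps)
  have "f t \<le> f 0"
  proof (rule DERIV_nonpos_imp_decreasing_open[OF t])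
    fix s assume s: "0 < s" "s < t"
    have "at s within {0..} = at s" using s by (intro at_within_interior) auto
    then have "DERIV f s :> (V' s + a * V s) * exp (a * s)" using df[of s] s by simp
    moreover have "(V' s + a * V s) * exp (a * s) \<le> 0" using le[of s] s by (intro mult_nonpos_nonneg) auto
    ultimately show "\<exists>y. DERIV f s :> y \<and> y \<le> 0" by blast
  next
    have "continuous_on {0..} f" using df by (intro DERIV_continuous_on) auto
    then show "continuous_on {0..t} f" by (rule continuous_on_subset) auto
  qed
  then show ?thesis by (simp add: f_def exp_minus field_simps)
qed

lemma pos_def_inverse_symmetric:
  assumes "pos_def n P" "R \<in> carrier_mat n n" "P * R = 1\<^sub>m n" "R * P = 1\<^sub>m n"
  shows "transpose_mat R = R"
proof -
  have P: "P \<in> carrier_mat n n" "transpose_mat P = P" using assms by (auto simp: pos_def_def)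
  have Rt: "transpose_mat R \<in> carrier_mat n n" using assms by simp
  have 1: "transpose_mat R * P = 1\<^sub>m n" using transpose_inverse[OF P(1) assms(2,3)] P(2) by simp
  have "transpose_mat R = transpose_mat R * (P * R)" using assms(3) Rt by simp
  also have "\<dots> = transpose_mat R * P * R" by (rule assoc_mult_mat[OF Rt P(1) assms(2), symmetric])
  also have "\<dots> = R" unfolding 1 using assms(2) by simp
  finally show ?thesis .
qed

section \<open>Synchronization\<close>

text \<open>In the variables \<open>z i\<close>, the inverse of \<open>P i\<close> applied to
  \<open>\<delta> i\<close>, the stacked error satisfies \<open>\<delta>' = Y z\<close>, so the
  derivative of the Lyapunov function is twice the quadratic form of \<open>Y\<close> at
  \<open>z\<close>.\<close>

lemma closed_loop_synchronizes:
  assumes A: "A \<in> carrier_mat n n" and B: "B \<in> carrier_mat n m"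
    and W: "W \<in> carrier_mat N N"
    and K: "K \<in> carrier_mat N N" "K * grounded_laplacian N W g = 1\<^sub>m N"
    and P: "\<And>i. i < N \<Longrightarrow> pos_def n (P i)" and F: "\<And>i. i < N \<Longrightarrow> F i \<in> carrier_mat m n"
    and neg: "neg_def (N * n) (Y + transpose_mat Y)"
    and Y: "Y = kronecker (1\<^sub>m N) A * diag_block_mat (map P [0..<N])
      + kronecker (grounded_laplacian N W g) B * diag_block_mat (map F [0..<N])"
    and loop: "closed_loop n A B N W g (\<lambda>i. feedback_gain (F i) (P i)) x0 xs"
  shows "synchronizes n N x0 xs"
proof -
  let ?H = "grounded_laplacian N W g"
  have H: "?H \<in> carrier_mat N N" using W by simp
  have Pc: "P i \<in> carrier_mat n n" if "i < N" for i using P[OF that] by (simp add: pos_def_def)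
  define R where "R i = the (mat_inverse (P i))" for i
  have R: "R i \<in> carrier_mat n n" "P i * R i = 1\<^sub>m n" "transpose_mat (R i) = R i" if i: "i < N" for i
  proof -
    obtain Q where Q: "Q \<in> carrier_mat n n" "P i * Q = 1\<^sub>m n" "Q * P i = 1\<^sub>m n" "mat_inverse (P i) = Some Q"
      using pos_def_inverse[OF P[OF i]] by metis
    then have "R i = Q" by (simp add: R_def)
    then show "R i \<in> carrier_mat n n" "P i * R i = 1\<^sub>m n" "transpose_mat (R i) = R i"
      using Q pos_def_inverse_symmetric[OF P[OF i] Q(1-3)] by simp_all
  qed
  define \<delta> where "\<delta> i t = sync_error n N W g x0 xs i t" for i t
  define z where "z i t = R i *\<^sub>v \<delta> i t" for i t
  define e where "e i t = xs i t - x0 t" for i t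
  have \<delta>: "\<delta> i t \<in> carrier_vec n" for i t by (simp add: \<delta>_def sync_error_def)
  have z: "z i t \<in> carrier_vec n" if "i < N" for i t
    unfolding z_def by (rule mult_mat_vec_carrier[OF R(1)[OF that] \<delta>])
  have Pz: "P i *\<^sub>v z i t = \<delta> i t" if "i < N" for i t
    unfolding z_def using assoc_mult_mat_vec[OF Pc[OF that] R(1)[OF that] \<delta>] R(2)[OF that]
    by (metis one_mult_mat_vec \<delta>)
  have x0: "x0 t \<in> carrier_vec n" "has_vec_deriv n x0 (A *\<^sub>v x0 t) (at t within {0..})" if "t \<ge> 0" for t
    using loop that unfolding closed_loop_def by auto
  have Fz: "F i *\<^sub>v z i t \<in> carrier_vec m" and BFz: "B *\<^sub>v (F i *\<^sub>v z i t) \<in> carrier_vec n" if "i < N" for i t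
    using mult_mat_vec_carrier[OF F[OF that] z[OF that]] mult_mat_vec_carrier[OF B] by auto
  \<comment> \<open>The minus signs of the input and of the gain cancel, so the input is linear in
    \<open>z\<close> with the design matrix \<open>F i\<close> itself.\<close>
  have input: "- (feedback_gain (F i) (P i) *\<^sub>v \<delta> i t) = F i *\<^sub>v z i t" if i: "i < N" for i t
  proof -
    have FR: "F i * R i \<in> carrier_mat m n" using F[OF i] R(1)[OF i] by simp
    have "- ((- (F i * R i)) *\<^sub>v \<delta> i t) = (F i * R i) *\<^sub>v \<delta> i t"
      using FR \<delta>[of i t] by (intro eq_vecI) auto
    then show ?thesis
      unfolding feedback_gain_def R_def[symmetric] z_def assoc_mult_mat_vec[OF F[OF i] R(1)[OF i] \<delta>] .
  qed
  have xs: "xs i t \<in> carrier_vec n"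
    "has_vec_deriv n (xs i) (A *\<^sub>v xs i t + B *\<^sub>v (F i *\<^sub>v z i t)) (at t within {0..})" if "i < N" "t \<ge> 0" for i t
    using loop that unfolding closed_loop_def by (auto simp: input[symmetric] \<delta>_def)
  have e: "e i t \<in> carrier_vec n" if "i < N" "t \<ge> 0" for i t
    using xs(1)[OF that] x0(1)[OF that(2)] by (simp add: e_def)
  have e_idx: "e i t $ k = xs i t $ k - x0 t $ k" if "t \<ge> 0" "k < n" for i t k
    using x0(1)[OF that(1)] that(2) by (simp add: e_def)
  have de: "((\<lambda>t. xs i t $ k - x0 t $ k) has_vector_derivative
      (A *\<^sub>v e i t) $ k + (B *\<^sub>v (F i *\<^sub>v z i t)) $ k) (at t within {0..})"
    if i: "i < N" and t: "t \<ge> 0" and k: "k < n" for i t k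
  proof -
    have "(A *\<^sub>v xs i t + B *\<^sub>v (F i *\<^sub>v z i t)) $ k - (A *\<^sub>v x0 t) $ k =
        (A *\<^sub>v e i t) $ k + (B *\<^sub>v (F i *\<^sub>v z i t)) $ k"
      using k A B mult_minus_distrib_mat_vec[OF A xs(1)[OF i t] x0(1)[OF t]] by (simp add: e_def)
    moreover have "((\<lambda>t. xs i t $ k - x0 t $ k) has_vector_derivative
        (A *\<^sub>v xs i t + B *\<^sub>v (F i *\<^sub>v z i t)) $ k - (A *\<^sub>v x0 t) $ k) (at t within {0..})"
      using xs(2)[OF i t] x0(2)[OF t] k unfolding has_vec_deriv_def
      by (intro has_vector_derivative_diff) auto
    ultimately show ?thesis by simp
  qed
  have \<delta>_e: "\<delta> i t $ k = (\<Sum>j<N. ?H $$ (i, j) * (xs j t $ k - x0 t $ k))" if "i < N" "k < n" for i t k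
    unfolding grounded_laplacian_sum[OF W that(1)] \<delta>_def using that by (simp add: sync_error_def)
  define D where "D i t = A *\<^sub>v \<delta> i t + vec n (\<lambda>k. \<Sum>j<N. ?H $$ (i, j) * (B *\<^sub>v (F j *\<^sub>v z j t)) $ k)" for i t
  have D: "D i t \<in> carrier_vec n" for i t
    unfolding D_def by (intro add_carrier_vec mult_mat_vec_carrier[OF A \<delta>] vec_carrier)
  have d\<delta>: "((\<lambda>t. \<delta> i t $ k) has_vector_derivative D i t $ k) (at t within {0..})"
    if i: "i < N" and t: "t \<ge> 0" and k: "k < n" for i t k
  proof -
    have "((\<lambda>t. \<Sum>j<N. ?H $$ (i, j) * (xs j t $ k - x0 t $ k)) has_vector_derivative
        (\<Sum>j<N. ?H $$ (i, j) * ((A *\<^sub>v e j t) $ k + (B *\<^sub>v (F j *\<^sub>v z j t)) $ k))) (at t within {0..})"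
      using de[OF _ t k] by (intro has_vector_derivative_sum has_vector_derivative_mult_right) auto
    \<comment> \<open>All agents share \<open>A\<close>, which therefore passes through the weighted
      sum over \<open>j\<close>.\<close>
    moreover have "(\<Sum>j<N. ?H $$ (i, j) * (A *\<^sub>v e j t) $ k) = (A *\<^sub>v \<delta> i t) $ k"
    proof -
      have "(\<Sum>j<N. ?H $$ (i, j) * (A *\<^sub>v e j t) $ k) = (\<Sum>j<N. \<Sum>l<n. A $$ (k, l) * (?H $$ (i, j) * (xs j t $ l - x0 t $ l)))"
        using mat_mult_vec_index[OF A e[OF _ t] k] t
        by (intro sum.cong refl) (simp add: e_idx sum_distrib_left mult.left_commute)
      also have "\<dots> = (\<Sum>l<n. A $$ (k, l) * \<delta> i t $ l)"
        by (subst sum.swap) (simp add: \<delta>_e[OF i] sum_distrib_left)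
      finally show ?thesis using mat_mult_vec_index[OF A \<delta> k] by simp
    qed
    ultimately show ?thesis
      using k A by (simp add: \<delta>_e[OF i k] D_def distrib_left sum.distrib del: index_mult_mat_vec)
  qed
  define V where "V t = (\<Sum>i<N. z i t \<bullet> \<delta> i t)" for t
  define v where "v t = vec (N * n) (\<lambda>s. z (s div n) t $ (s mod n))" for t
  have v: "v t \<in> carrier_vec (N * n)" for t by (simp add: v_def)
  have vz: "block_vec n (v t) i = z i t" if "i < N" for i t
    using z[OF that, of t] block_index_less[OF that]
    by (intro eq_vecI) (auto simp: v_def)
  have Pdc: "diag_block_mat (map P [0..<N]) \<in> carrier_mat (N * n) (N * n)"
    and Fdc: "diag_block_mat (map F [0..<N]) \<in> carrier_mat (N * m) (N * n)"
    using diag_block_mat_carrier Pc F by blast+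
  have Yc: "Y \<in> carrier_mat (N * n) (N * n)"
    unfolding Y using mult_carrier_mat[OF kronecker_carrier[OF one_carrier_mat A] Pdc]
      mult_carrier_mat[OF kronecker_carrier[OF H B] Fdc] by simp
  have vYv: "(\<Sum>i<N. z i t \<bullet> D i t) = v t \<bullet> (Y *\<^sub>v v t)" for t
  proof -
    note Y12 = mult_carrier_mat[OF kronecker_carrier[OF one_carrier_mat A] Pdc]
      mult_carrier_mat[OF kronecker_carrier[OF H B] Fdc]
    have A\<delta>: "A *\<^sub>v \<delta> i t \<in> carrier_vec n" for i by (rule mult_mat_vec_carrier[OF A \<delta>])
    have "v t \<bullet> (Y *\<^sub>v v t) = v t \<bullet> (kronecker (1\<^sub>m N) A * diag_block_mat (map P [0..<N]) *\<^sub>v v t)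
        + v t \<bullet> (kronecker ?H B * diag_block_mat (map F [0..<N]) *\<^sub>v v t)"
      unfolding Y add_mult_distrib_mat_vec[OF Y12 v]
      by (rule scalar_prod_add_distrib[OF v mult_mat_vec_carrier[OF Y12(1) v] mult_mat_vec_carrier[OF Y12(2) v]])
    also have "v t \<bullet> (kronecker (1\<^sub>m N) A * diag_block_mat (map P [0..<N]) *\<^sub>v v t) =
        (\<Sum>i<N. \<Sum>j<N. if i = j then z i t \<bullet> (A *\<^sub>v \<delta> i t) else 0)"
      by (rule trans[OF scalar_prod_kronecker_diag[OF one_carrier_mat A Pc v]], simp)
        (intro sum.cong refl, auto simp: vz Pz)
    also have "\<dots> = (\<Sum>i<N. z i t \<bullet> (A *\<^sub>v \<delta> i t))" by simp
    also have "v t \<bullet> (kronecker ?H B * diag_block_mat (map F [0..<N]) *\<^sub>v v t) =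
        (\<Sum>i<N. \<Sum>j<N. ?H $$ (i, j) * (z i t \<bullet> (B *\<^sub>v (F j *\<^sub>v z j t))))"
      by (rule trans[OF scalar_prod_kronecker_diag[OF H B F v]]) (auto simp: vz intro!: sum.cong)
    also have "(\<Sum>i<N. z i t \<bullet> (A *\<^sub>v \<delta> i t)) + \<dots> = (\<Sum>i<N. z i t \<bullet> D i t)"
      unfolding sum.distrib[symmetric]
    proof (intro sum.cong refl)
      fix i assume "i \<in> {..<N}"
      then have i: "i < N" by simp
      have "z i t \<bullet> vec n (\<lambda>k. \<Sum>j<N. ?H $$ (i, j) * (B *\<^sub>v (F j *\<^sub>v z j t)) $ k) =
          (\<Sum>k<n. \<Sum>j<N. ?H $$ (i, j) * (z i t $ k * (B *\<^sub>v (F j *\<^sub>v z j t)) $ k))"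
        unfolding scalar_prod_sum[OF vec_carrier] by (simp add: sum_distrib_left mult.left_commute)
      also have "\<dots> = (\<Sum>j<N. ?H $$ (i, j) * (z i t \<bullet> (B *\<^sub>v (F j *\<^sub>v z j t))))"
        by (subst sum.swap) (simp add: scalar_prod_sum[OF BFz] sum_distrib_left)
      finally show "z i t \<bullet> (A *\<^sub>v \<delta> i t) + (\<Sum>j<N. ?H $$ (i, j) * (z i t \<bullet> (B *\<^sub>v (F j *\<^sub>v z j t)))) = z i t \<bullet> D i t"
        unfolding D_def scalar_prod_add_distrib[OF z[OF i] A\<delta> vec_carrier] by simp
    qed
    finally show ?thesis by simp
  qed
  have dV: "(V has_vector_derivative 2 * (v t \<bullet> (Y *\<^sub>v v t))) (at t within {0..})" if t: "t \<ge> 0" for t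
  proof -
    have V: "V = (\<lambda>t. \<Sum>i<N. \<Sum>k<n. z i t $ k * \<delta> i t $ k)"
      by (simp add: V_def scalar_prod_sum[OF \<delta>] fun_eq_iff)
    have dz: "((\<lambda>t. z i t $ k) has_vector_derivative (R i *\<^sub>v D i t) $ k) (at t within {0..})"
      if i: "i < N" and k: "k < n" for i k
    proof -
      have "((\<lambda>t. \<Sum>l<n. R i $$ (k, l) * \<delta> i t $ l) has_vector_derivative
          (\<Sum>l<n. R i $$ (k, l) * D i t $ l)) (at t within {0..})"
        using d\<delta>[OF i t] by (intro has_vector_derivative_sum has_vector_derivative_mult_right) auto
      then show ?thesis
        unfolding z_def mat_mult_vec_index[OF R(1)[OF i] \<delta> k] mat_mult_vec_index[OF R(1)[OF i] D k] .
    qed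
    have "(V has_vector_derivative (\<Sum>i<N. \<Sum>k<n. z i t $ k * D i t $ k + (R i *\<^sub>v D i t) $ k * \<delta> i t $ k))
        (at t within {0..})"
      unfolding V using dz d\<delta>[OF _ t] by (intro has_vector_derivative_sum has_vector_derivative_mult) auto
    moreover have "(\<Sum>k<n. z i t $ k * D i t $ k + (R i *\<^sub>v D i t) $ k * \<delta> i t $ k) = 2 * (z i t \<bullet> D i t)"
      if i: "i < N" for i
    proof -
      have "(R i *\<^sub>v D i t) \<bullet> \<delta> i t = D i t \<bullet> z i t"
        using scalar_prod_transpose[OF R(1)[OF i] D \<delta>] R(3)[OF i] by (simp add: z_def)
      also have "\<dots> = z i t \<bullet> D i t" by (rule comm_scalar_prod[OF D z[OF i]])
      finally show ?thesis by (simp add: sum.distrib scalar_prod_sum[OF D] scalar_prod_sum[OF \<delta>])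
    qed
    then have "(\<Sum>i<N. \<Sum>k<n. z i t $ k * D i t $ k + (R i *\<^sub>v D i t) $ k * \<delta> i t $ k) = (\<Sum>i<N. 2 * (z i t \<bullet> D i t))"
      by (intro sum.cong refl) simp
    ultimately show ?thesis by (simp add: vYv[symmetric] sum_distrib_left del: sum.distrib)
  qed
  have "pos_def (N * n) (- (Y + transpose_mat Y))"
  proof -
    have S: "Y + transpose_mat Y \<in> carrier_mat (N * n) (N * n)" using Yc by simp
    have "(- (Y + transpose_mat Y)) *\<^sub>v w = - ((Y + transpose_mat Y) *\<^sub>v w)" if "w \<in> carrier_vec (N * n)" for w
      using S that by (intro eq_vecI) auto
    then have "w \<bullet> ((- (Y + transpose_mat Y)) *\<^sub>v w) = - (w \<bullet> ((Y + transpose_mat Y) *\<^sub>v w))"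
      if "w \<in> carrier_vec (N * n)" for w
      using that Yc by simp
    moreover have "transpose_mat (- (Y + transpose_mat Y)) = - transpose_mat (Y + transpose_mat Y)"
      by (intro eq_matI) auto
    ultimately show ?thesis using neg S unfolding pos_def_def neg_def_def by auto
  qed
  then obtain \<epsilon> where \<epsilon>: "\<epsilon> > 0"
    and low: "\<And>w. w \<in> carrier_vec (N * n) \<Longrightarrow> \<epsilon> * (w \<bullet> w) \<le> w \<bullet> ((- (Y + transpose_mat Y)) *\<^sub>v w)"
    using pos_def_lower_bound by metis
  have low': "2 * (w \<bullet> (Y *\<^sub>v w)) \<le> - \<epsilon> * (w \<bullet> w)" if w: "w \<in> carrier_vec (N * n)" for w
  proof -
    have Yt: "transpose_mat Y \<in> carrier_mat (N * n) (N * n)" using Yc by simp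
    have Yw: "Y *\<^sub>v w \<in> carrier_vec (N * n)" "transpose_mat Y *\<^sub>v w \<in> carrier_vec (N * n)"
      using Yc Yt w by simp_all
    have "(- (Y + transpose_mat Y)) *\<^sub>v w = - (Y *\<^sub>v w + transpose_mat Y *\<^sub>v w)"
      using Yc w by (intro eq_vecI) (auto simp: add_scalar_prod_distrib[of _ "N * n"])
    then have "w \<bullet> ((- (Y + transpose_mat Y)) *\<^sub>v w) = - (w \<bullet> (Y *\<^sub>v w) + w \<bullet> (transpose_mat Y *\<^sub>v w))"
      using w Yw scalar_prod_add_distrib[OF w Yw] Yc by simp
    moreover have "w \<bullet> (transpose_mat Y *\<^sub>v w) = w \<bullet> (Y *\<^sub>v w)"
      using scalar_prod_transpose[OF Yc w w] comm_scalar_prod[OF w Yw(2)] by simp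
    ultimately show ?thesis using low[OF w] by simp
  qed
  obtain c where c: "c > 0"
    and up: "\<And>w. w \<in> carrier_vec (N * n) \<Longrightarrow> w \<bullet> (diag_block_mat (map P [0..<N]) *\<^sub>v w) \<le> c * (w \<bullet> w)"
    using quadratic_form_bound[OF Pdc] by metis
  have V_up: "V t \<le> c * (v t \<bullet> v t)" for t
  proof -
    have "v t \<bullet> (diag_block_mat (map P [0..<N]) *\<^sub>v v t) = V t"
      unfolding scalar_prod_blocks[OF mult_mat_vec_carrier[OF Pdc v]] V_def
      by (intro sum.cong refl) (simp add: block_vec_diag[of N P n n, OF Pc v] vz Pz)
    then show ?thesis using up[OF v] by metis
  qed
  \<comment> \<open>The rate combines \<open>low'\<close>, a decrease of at least
    \<open>\<epsilon> (v t \<bullet> v t)\<close>, with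
    \<open>V t \<le> c (v t \<bullet> v t)\<close>.\<close>
  have decay: "V t \<le> V 0 * exp (- (\<epsilon> / c) * t)" if "t \<ge> 0" for t
  proof (rule exponential_decay[OF dV _ that])
    fix t :: real
    have "\<epsilon> / c * V t \<le> \<epsilon> / c * (c * (v t \<bullet> v t))" using V_up \<epsilon> c by (intro mult_left_mono) auto
    then show "2 * (v t \<bullet> (Y *\<^sub>v v t)) \<le> - (\<epsilon> / c) * V t"
      using low'[OF v, of t] c by simp
  qed
  have lim0: "((\<lambda>t. V 0 * exp (- (\<epsilon> / c) * t)) \<longlongrightarrow> 0) at_top"
  proof -
    have "\<epsilon> / c > 0" using \<epsilon> c by simp
    then have "((\<lambda>t. exp (- (\<epsilon> / c) * t)) \<longlongrightarrow> 0) at_top"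
      by (intro filterlim_compose[OF exp_at_bot] filterlim_tendsto_neg_mult_at_bot[OF tendsto_const _ filterlim_ident]) auto
    then show ?thesis by (rule tendsto_mult_right_zero)
  qed
  \<comment> \<open>All summands of \<open>V\<close> are nonnegative, so \<open>V\<close> dominates
    each block of \<open>z\<close>. The limit then passes to \<open>\<delta> i\<close>, which is
    \<open>P i\<close> times \<open>z i\<close>, and through the inverse \<open>K\<close> to the
    differences \<open>xs i - x0\<close>.\<close>
  have z_lim: "((\<lambda>t. z i t $ k) \<longlongrightarrow> 0) at_top" if i: "i < N" and k: "k < n" for i k
  proof -
    obtain p where p: "p > 0" and plow: "\<And>w. w \<in> carrier_vec n \<Longrightarrow> p * (w \<bullet> w) \<le> w \<bullet> (P i *\<^sub>v w)"
      using pos_def_lower_bound[OF P[OF i]] by metis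
    have nonneg: "z j t \<bullet> \<delta> j t \<ge> 0" if "j < N" for j t
    proof (cases "z j t = 0\<^sub>v n")
      case True
      then show ?thesis using \<delta>[of j t] by simp
    next
      case False
      then show ?thesis using P[OF that] z[OF that, of t] Pz[OF that, of t] unfolding pos_def_def
        by (metis less_eq_real_def)
    qed
    have "(z i t $ k)\<^sup>2 \<le> 1 / p * (V 0 * exp (- (\<epsilon> / c) * t))" if t: "t \<ge> 0" for t
    proof -
      have "(z i t $ k)\<^sup>2 \<le> z i t \<bullet> z i t"
        unfolding scalar_prod_sum[OF z[OF i]] power2_eq_square
        using member_le_sum[of k "{..<n}" "\<lambda>k. z i t $ k * z i t $ k"] k by simp
      moreover have "p * (z i t \<bullet> z i t) \<le> z i t \<bullet> \<delta> i t" using plow[OF z[OF i]] Pz[OF i] by metis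
      moreover have "z i t \<bullet> \<delta> i t \<le> V t"
        unfolding V_def using member_le_sum[of i "{..<N}" "\<lambda>i. z i t \<bullet> \<delta> i t"] i nonneg by simp
      ultimately have "p * (z i t $ k)\<^sup>2 \<le> V 0 * exp (- (\<epsilon> / c) * t)"
        using decay[OF t] p by (smt (verit) mult_left_mono)
      then show ?thesis using p by (simp add: field_simps)
    qed
    then have "((\<lambda>t. (z i t $ k)\<^sup>2) \<longlongrightarrow> 0) at_top"
      by (intro tendsto_sandwich[OF _ _ tendsto_const tendsto_mult_right_zero[OF lim0, of "1 / p"]])
        (auto intro!: eventually_at_top_linorderI[of 0])
    then show ?thesis by simp
  qed
  have \<delta>_lim: "((\<lambda>t. \<delta> i t $ k) \<longlongrightarrow> 0) at_top" if i: "i < N" and k: "k < n" for i k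
  proof -
    have "((\<lambda>t. \<Sum>l<n. P i $$ (k, l) * z i t $ l) \<longlongrightarrow> (\<Sum>l<n. P i $$ (k, l) * 0)) at_top"
      using z_lim[OF i] by (intro tendsto_sum tendsto_mult tendsto_const) auto
    moreover have "\<delta> i t $ k = (\<Sum>l<n. P i $$ (k, l) * z i t $ l)" for t
      using mat_mult_vec_index[OF Pc[OF i] z[OF i] k] Pz[OF i] by simp
    ultimately show ?thesis by simp
  qed
  show ?thesis
    unfolding synchronizes_def
  proof (intro allI impI)
    fix i k assume i: "i < N" and k: "k < n"
    have "((\<lambda>t. \<Sum>l<N. K $$ (i, l) * \<delta> l t $ k) \<longlongrightarrow> (\<Sum>l<N. K $$ (i, l) * 0)) at_top"
      using \<delta>_lim[OF _ k] by (intro tendsto_sum tendsto_mult tendsto_const) auto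
    moreover have "(\<Sum>l<N. K $$ (i, l) * \<delta> l t $ k) = xs i t $ k - x0 t $ k" for t
    proof -
      have "(\<Sum>l<N. K $$ (i, l) * \<delta> l t $ k) =
          (\<Sum>l<N. \<Sum>j<N. K $$ (i, l) * ?H $$ (l, j) * (xs j t $ k - x0 t $ k))"
        using k by (intro sum.cong refl) (simp add: \<delta>_e sum_distrib_left mult.assoc)
      also have "\<dots> = (\<Sum>j<N. (K * ?H) $$ (i, j) * (xs j t $ k - x0 t $ k))"
        by (subst sum.swap) (simp add: mat_mult_index[OF K(1) H i] sum_distrib_right)
      also have "\<dots> = (\<Sum>j<N. if i = j then xs j t $ k - x0 t $ k else 0)"
        using i by (intro sum.cong refl) (auto simp: K(2))
      finally show ?thesis using i by simp
    qed
    ultimately show "((\<lambda>t. xs i t $ k - x0 t $ k) \<longlongrightarrow> 0) at_top" by simp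
  qed
qed

theorem theorem2:
  fixes n m N M :: nat
    and A B W :: "real mat" and g :: "real vec"
    and E :: "(nat \<times> nat) set" and Acc :: "nat set"
    and T :: real and u x :: "real \<Rightarrow> real vec"
    and X Xd U :: "real mat"
  assumes "A \<in> carrier_mat n n" and "B \<in> carrier_mat n m"
    and "controllable n m A B"
    and "weighted_digraph N E W" and "pinning_gain N Acc g"
    and "has_spanning_tree N E" and "leader_connected_to_root N E g"
    and "pcpe m A (n + 1) M T u" and "input_state_data n m A B M T u x"
  defines "X \<equiv> data_mat n M T x 0"
    and "Xd \<equiv> data_mat n M T (right_deriv n x) 0"
    and "U \<equiv> data_mat m M T u 0"
  shows "(\<exists>\<Lambda> P F. design_solution n m N M W g X Xd U \<Lambda> P F) \<and>
    (\<forall>\<Lambda> P F. design_solution n m N M W g X Xd U \<Lambda> P F \<longrightarrow>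
      (\<forall>x0 xs. closed_loop n A B N W g (\<lambda>i. feedback_gain (F i) (P i)) x0 xs \<longrightarrow>
        synchronizes n N x0 xs))"
proof -
  note A = assms(1) and B = assms(2) and ctr = assms(3) and graph = assms(4) and pin = assms(5)
    and lead = assms(7) and pe = assms(8) and data = assms(9)
  let ?H = "grounded_laplacian N W g" and ?Lg = "pinned_laplacian N W g"
  have W: "W \<in> carrier_mat N N" using graph by (simp add: weighted_digraph_def)
  have H: "?H \<in> carrier_mat N N" using W by simp
  have T: "T > 0" using pe by (simp add: pcpe_def admissible_period_def)
  have X: "X \<in> carrier_mat n M" and U: "U \<in> carrier_mat m M" by (simp_all add: X_def U_def data_mat_def)
  have Xd: "Xd = A * X + B * U"
    unfolding X_def Xd_def U_def by (rule data_derivative[OF A B T data])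
  have Xdc: "Xd \<in> carrier_mat n M" unfolding Xd using A B X U by simp
  have LXd: "kronecker ?Lg Xd \<in> carrier_mat (N * n) (M * (N + 1))"
    using kronecker_carrier[OF pinned_carrier(1)[OF W] Xdc] by (simp add: mult.commute)
  obtain K where K: "K \<in> carrier_mat N N" "?H * K = 1\<^sub>m N" "K * ?H = 1\<^sub>m N"
    using grounded_laplacian_inverse[OF graph pin lead] by metis
  have lyap_eq: "kronecker ?Lg Xd * \<Lambda> + transpose_mat \<Lambda> * transpose_mat (kronecker ?Lg Xd) = Y + transpose_mat Y"
    if "\<Lambda> \<in> carrier_mat (M * (N + 1)) (n * N)" "Y = kronecker ?Lg Xd * \<Lambda>" for \<Lambda> Y
    using transpose_mult[OF LXd that(1)] that(2) by simp
  have "\<exists>\<Lambda> P F. design_solution n m N M W g X Xd U \<Lambda> P F"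
  proof -
    obtain q e where q: "\<And>i. i < N \<Longrightarrow> q i > 0" and e: "\<And>i. i < N \<Longrightarrow> e i > 0"
      and stab: "\<And>z :: nat \<Rightarrow> real. (\<Sum>i<N. e i * (z i)\<^sup>2) \<le> (\<Sum>i<N. \<Sum>j<N. ?H $$ (i, j) * q j * (z i * z j))"
      using grounded_laplacian_diagonal_stability[OF graph pin lead] by blast
    obtain P \<kappa> where P: "pos_def n P" and \<kappa>: "\<kappa> > 0"
      and lyap: "\<And>z. z \<in> carrier_vec n \<Longrightarrow> z \<bullet> (A *\<^sub>v (P *\<^sub>v z)) + z \<bullet> (P *\<^sub>v z) \<le>
        \<kappa> * ((transpose_mat B *\<^sub>v z) \<bullet> (transpose_mat B *\<^sub>v z))"
      using controllable_lyapunov[OF A B ctr] by blast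
    obtain Rx Ru where R: "Rx \<in> carrier_mat M n" "Ru \<in> carrier_mat M m"
      "X * Rx = 1\<^sub>m n" "X * Ru = 0\<^sub>m n m" "U * Rx = 0\<^sub>m m n" "U * Ru = 1\<^sub>m m"
      using data_right_inverse[OF A B ctr pe data, folded X_def U_def] by metis
    \<comment> \<open>A single gain for all agents: the sum dominates each quotient
      \<open>\<kappa> * q i / e i\<close>, as \<open>design_form_neg\<close> requires.\<close>
    define c where "c = (\<Sum>i<N. \<kappa> * q i / e i)"
    have c: "\<kappa> * q i \<le> c * e i" if i: "i < N" for i
    proof -
      have "\<kappa> * q i / e i \<le> c"
        unfolding c_def using i q e \<kappa>
        by (intro member_le_sum[of i "{..<N}" "\<lambda>i. \<kappa> * q i / e i"]) (auto simp: less_imp_le)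
      then show ?thesis using e[OF i] by (simp add: field_simps)
    qed
    have c0: "c \<ge> 0" unfolding c_def using q e \<kappa> by (intro sum_nonneg) (auto simp: less_imp_le)
    define Ps where "Ps i = q i \<cdot>\<^sub>m P" for i
    define Fs where "Fs i = (- (c * q i)) \<cdot>\<^sub>m transpose_mat B" for i
    have Ps: "Ps i \<in> carrier_mat n n" and Fs: "Fs i \<in> carrier_mat m n" for i
      using P B by (simp_all add: Ps_def Fs_def pos_def_def)
    let ?Pd = "diag_block_mat (map Ps [0..<N])" and ?Fd = "diag_block_mat (map Fs [0..<N])"
    have Pd: "?Pd \<in> carrier_mat (N * n) (N * n)" and Fd: "?Fd \<in> carrier_mat (N * m) (N * n)"
      using diag_block_mat_carrier Ps Fs by blast+
    obtain \<Lambda> where L: "\<Lambda> \<in> carrier_mat (M * (N + 1)) (n * N)" "kronecker ?Lg X * \<Lambda> = ?Pd"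
      "append_cols U (0\<^sub>m m (M * N)) * \<Lambda> = 0\<^sub>m m (n * N)" "kronecker (pinned_identity N) U * \<Lambda> = ?Fd"
      using design_exists_for_blocks[OF W X U R K(1,2), of ?Pd ?Fd] Pd Fd by (auto simp: mult.commute)
    define Y where "Y = kronecker ?Lg Xd * \<Lambda>"
    have Yc: "Y \<in> carrier_mat (N * n) (N * n)"
      using mult_carrier_mat[OF LXd L(1)] by (simp add: Y_def mult.commute)
    have Y: "Y = kronecker (1\<^sub>m N) A * ?Pd + kronecker ?H B * ?Fd"
      unfolding Y_def Xd by (rule design_lyapunov_matrix[OF W A B X U L])
    have "neg_def (N * n) (Y + transpose_mat Y)"
      unfolding neg_def_sym_part[OF Yc] unfolding Y Ps_def[abs_def] Fs_def[abs_def]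
      using design_form_neg[OF A B H q e stab P \<kappa> lyap c c0] by blast
    then have "neg_def (n * N) (Y + transpose_mat Y)" by (simp add: mult.commute)
    then have "design_solution n m N M W g X Xd U \<Lambda> Ps Fs"
      unfolding design_solution_def lyap_eq[OF L(1) Y_def]
      using L Ps Fs pos_def_smult[OF P q] by (simp add: Ps_def)
    then show ?thesis by blast
  qed
  moreover have "synchronizes n N x0 xs"
    if sol: "design_solution n m N M W g X Xd U \<Lambda> P F"
      and loop: "closed_loop n A B N W g (\<lambda>i. feedback_gain (F i) (P i)) x0 xs" for \<Lambda> P F x0 xs
  proof -
    define Y where "Y = kronecker ?Lg Xd * \<Lambda>"
    have L: "\<Lambda> \<in> carrier_mat (M * (N + 1)) (n * N)"
      and eqs: "kronecker ?Lg X * \<Lambda> = diag_block_mat (map P [0..<N])"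
        "append_cols U (0\<^sub>m m (M * N)) * \<Lambda> = 0\<^sub>m m (n * N)"
        "kronecker (pinned_identity N) U * \<Lambda> = diag_block_mat (map F [0..<N])"
      and P: "\<And>i. i < N \<Longrightarrow> pos_def n (P i)" and F: "\<And>i. i < N \<Longrightarrow> F i \<in> carrier_mat m n"
      using sol unfolding design_solution_def by auto
    have neg: "neg_def (N * n) (Y + transpose_mat Y)"
      using sol unfolding design_solution_def lyap_eq[OF L Y_def] by (simp add: mult.commute)
    have Y: "Y = kronecker (1\<^sub>m N) A * diag_block_mat (map P [0..<N]) + kronecker ?H B * diag_block_mat (map F [0..<N])"
      unfolding Y_def Xd by (rule design_lyapunov_matrix[OF W A B X U L eqs])
    show ?thesis by (rule closed_loop_synchronizes[OF A B W K(1,3) P F neg Y loop])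
  qed
  ultimately show ?thesis by blast
qed

end
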